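(* Let $m\geqslant2$, and let $\mathcal E$ and $\mathcal F$ be complex separable Hilbert spaces. Let $\pmb\mu=(\mu_1,\ldots,\mu_{m-1})$ be an $(m-1)$-tuple of $\mathcal B(\mathcal E)$-valued semi-spectral measures on the unit circle $\mathbb T$ and $\pmb\nu=(\nu_1,\ldots,\nu_{m-1})$ an $(m-1)$-tuple of $\mathcal B(\mathcal F)$-valued semi-spectral measures on $\mathbb T$. Then the operators $M_z$ on $\mathcal H_{\pmb\mu}(\mathcal E)$ and $M_z$ on $\mathcal H_{\pmb\nu}(\mathcal F)$ are unitarily equivalent if and only if there exists a unitary $V\in\mathcal B(\mathcal E,\mathcal F)$ such that $\mu_r(\Delta)=V^*\nu_r(\Delta)V$ for every Borel subset $\Delta\subseteq\mathbb T$ and for all $r=1,\ldots,m-1$.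
   Context: $\mathbb D$ is the open unit disc, $dA$ its normalized Lebesgue area measure, and $\mathcal O(\mathbb D,\mathcal E)$ the space of $\mathcal E$-valued holomorphic functions on $\mathbb D$. A $\mathcal B(\mathcal E)$-valued semi-spectral measure on $\mathbb T$ is a finitely additive set function $\mu$ from the Borel $\sigma$-algebra of $\mathbb T$ into the positive operators in $\mathcal B(\mathcal E)$ such that $\mu_{x,y}(\cdot):=\langle\mu(\cdot)x,y\rangle$ is a regular complex Borel measure for all $x,y\in\mathcal E$. Its Poisson integral is $P_\mu(z)=\int_{\mathbb T}\frac{1-|z|^2}{|z-\zeta|^2}d\mu(\zeta)$, $z\in\mathbb D$. For $n\ge1$ and $f\in\mathcal O(\mathbb D,\mathcal E)$, $$D_{\mu,n}(f):=\frac1{n!(n-1)!}\int_{\mathbb D}\langle P_\mu(z)f^{(n)}(z),f^{(n)}(z)\rangle(1-|z|^2)^{n-1}dA(z),$$ and $\mathcal H_{\mu,n}(\mathcal E):=\{f\in\mathcal O(\mathbb D,\mathcal E):D_{\mu,n}(f)<\infty\}$. $H^2(\mathcal E)$ is the Hardy space of functions $\sum_{j\ge0}a_jz^j$, $a_j\in\mathcal E$, with $\|f\|^2_{H^2(\mathcal E)}=\sum_j\|a_j\|^2<\infty$. $\mathcal H_{\pmb\mu}(\mathcal E):=\bigcap_{j=1}^{m-1}\mathcal H_{\mu_j,j}(\mathcal E)\cap H^2(\mathcal E)$, a Hilbert space with norm $\|f\|^2_{\pmb\mu}=\|f\|^2_{H^2(\mathcal E)}+\sum_{j=1}^{m-1}D_{\mu_j,j}(f)$;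 similarly for $\mathcal H_{\pmb\nu}(\mathcal F)$. $M_z$ is the bounded operator $(M_zf)(z)=zf(z)$. *)

theory Defs
  imports "HOL-Analysis.Analysis" "HOL-Library.Function_Algebras"
begin

section \<open>Complex separable Hilbert spaces\<close>

class scaleC =
  fixes scaleC :: "complex \<Rightarrow> 'a \<Rightarrow> 'a" (infixr \<open>*\<^sub>C\<close> 75)

instantiation "fun" :: (type, scaleC) scaleC
begin

definition scaleC_fun_def: "c *\<^sub>C f = (\<lambda>x. c *\<^sub>C f x)"

instance ..

end

text \<open>The inner product is linear in the first argument. Completeness comes from \<open>banach\<close>.
  The space may be finite-dimensional, including the zero space.\<close>

class chilbert_space = banach + scaleC +
  fixes cinner :: "'a \<Rightarrow> 'a \<Rightarrow> complex"
  assumes scaleC_add_right: "c *\<^sub>C (x + y) = c *\<^sub>C x + c *\<^sub>C y"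
    and scaleC_add_left: "(c + d) *\<^sub>C x = c *\<^sub>C x + d *\<^sub>C x"
    and scaleC_scaleC: "c *\<^sub>C d *\<^sub>C x = (c * d) *\<^sub>C x"
    and scaleC_of_real: "complex_of_real r *\<^sub>C x = r *\<^sub>R x"
    and cinner_commute: "cinner x y = cnj (cinner y x)"
    and cinner_add_left: "cinner (x + y) z = cinner x z + cinner y z"
    and cinner_scaleC_left: "cinner (c *\<^sub>C x) y = c * cinner x y"
    and cinner_self: "cinner x x = complex_of_real ((norm x)\<^sup>2)"

class separable_chilbert_space = chilbert_space +
  assumes ex_countable_dense: "\<exists>D. countable D \<and> (\<forall>X. open X \<longrightarrow> X \<noteq> {} \<longrightarrow> D \<inter> X \<noteq> {})"

text \<open>This makes the library's measure theory for second countable spaces applicable.\<close>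

instance separable_chilbert_space \<subseteq> second_countable_topology
proof
  obtain D :: "'a set" where D: "countable D" "\<And>X. open X \<Longrightarrow> X \<noteq> {} \<Longrightarrow> D \<inter> X \<noteq> {}"
    using ex_countable_dense by blast
  define B where "B = (\<lambda>(d::'a, n::nat). ball d (1 / real (Suc n))) ` (D \<times> UNIV)"
  have "countable B" using D(1) by (auto simp: B_def)
  moreover have "topological_basis B"
  proof (rule topological_basisI)
    show "open b" if "b \<in> B" for b using that by (auto simp: B_def)
  next
    fix S :: "'a set" and x assume "open S" "x \<in> S"
    then obtain e where e: "e > 0" "ball x e \<subseteq> S" by (meson open_contains_ball)
    obtain n where n: "1 / real (Suc n) < e / 2"
      using e(1) nat_approx_posE[of "e / 2"] by (metis half_gt_zero)
    have "D \<inter> ball x (1 / real (Suc n)) \<noteq> {}" by (rule D(2)) auto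
    then obtain d where d: "d \<in> D" "dist d x < 1 / real (Suc n)"
      by (auto simp: dist_commute)
    have "ball d (1 / real (Suc n)) \<subseteq> ball x e"
    proof
      fix y assume "y \<in> ball d (1 / real (Suc n))"
      then show "y \<in> ball x e"
        using n d(2) dist_triangle[of x y d] by (simp add: dist_commute)
    qed
    then show "\<exists>b\<in>B. x \<in> b \<and> b \<subseteq> S"
      using d e(2) by (intro bexI[of _ "ball d (1 / real (Suc n))"]) (auto simp: B_def)
  qed
  ultimately show "\<exists>B::'a set set. countable B \<and> open = generate_topology B"
    using topological_basis_imp_subbasis by blast
qed

definition bounded_clinear :: "('a::chilbert_space \<Rightarrow> 'b::chilbert_space) \<Rightarrow> bool" where
  "bounded_clinear T \<longleftrightarrow> bounded_linear T \<and> (\<forall>c x. T (c *\<^sub>C x) = c *\<^sub>C T x)"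

definition positive_operator :: "('a::chilbert_space \<Rightarrow> 'a) \<Rightarrow> bool" where
  "positive_operator T \<longleftrightarrow>
    bounded_clinear T \<and> (\<forall>x. cinner (T x) x \<in> \<real> \<and> 0 \<le> Re (cinner (T x) x))"

definition cadjoint :: "('a::chilbert_space \<Rightarrow> 'b::chilbert_space) \<Rightarrow> 'b \<Rightarrow> 'a" where
  "cadjoint V = (THE W. \<forall>x y. cinner (V x) y = cinner x (W y))"

text \<open>Unitary operators between Hilbert spaces given by a carrier and an inner product on it.
  The values of \<open>U\<close> outside the carrier \<open>A\<close> are irrelevant.\<close>

definition unitary_on ::
  "'a::{plus,scaleC} set \<Rightarrow> ('a \<Rightarrow> 'a \<Rightarrow> complex) \<Rightarrow>
   'b::{plus,scaleC} set \<Rightarrow> ('b \<Rightarrow> 'b \<Rightarrow> complex) \<Rightarrow> ('a \<Rightarrow> 'b) \<Rightarrow> bool" where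
  "unitary_on A ipA B ipB U \<longleftrightarrow>
    (\<forall>x\<in>A. \<forall>y\<in>A. U (x + y) = U x + U y) \<and>
    (\<forall>c. \<forall>x\<in>A. U (c *\<^sub>C x) = c *\<^sub>C U x) \<and>
    U ` A = B \<and>
    (\<forall>x\<in>A. \<forall>y\<in>A. ipB (U x) (U y) = ipA x y)"

definition unitarily_equivalent ::
  "'a::{plus,scaleC} set \<Rightarrow> ('a \<Rightarrow> 'a \<Rightarrow> complex) \<Rightarrow> ('a \<Rightarrow> 'a) \<Rightarrow>
   'b::{plus,scaleC} set \<Rightarrow> ('b \<Rightarrow> 'b \<Rightarrow> complex) \<Rightarrow> ('b \<Rightarrow> 'b) \<Rightarrow> bool" where
  "unitarily_equivalent A ipA S B ipB T \<longleftrightarrow>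
    (\<exists>U. unitary_on A ipA B ipB U \<and> (\<forall>x\<in>A. U (S x) = T (U x)))"

abbreviation unitary_operator :: "('a::chilbert_space \<Rightarrow> 'b::chilbert_space) \<Rightarrow> bool" where
  "unitary_operator V \<equiv> bounded_clinear V \<and> unitary_on UNIV cinner UNIV cinner V"

text \<open>The inner product of a Hilbert space whose squared norm is \<open>q\<close>.\<close>

definition polarization :: "('a::{plus,scaleC} \<Rightarrow> real) \<Rightarrow> 'a \<Rightarrow> 'a \<Rightarrow> complex" where
  "polarization q f g = (\<Sum>k<4. \<i> ^ k * complex_of_real (q (f + \<i> ^ k *\<^sub>C g))) / 4"

section \<open>Semi-spectral measures and their Poisson integrals\<close>

definition complex_measure :: "'a measure \<Rightarrow> ('a set \<Rightarrow> complex) \<Rightarrow> bool" where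
  "complex_measure M \<kappa> \<longleftrightarrow>
    (\<forall>A::nat \<Rightarrow> 'a set. range A \<subseteq> sets M \<and> disjoint_family A \<longrightarrow>
      (\<lambda>i. \<kappa> (A i)) sums \<kappa> (\<Union>i. A i))"

text \<open>The regularity condition is regularity of the total variation: since
  \<open>\<bar>\<kappa>\<bar>(E) \<le> 4 sup {\<bar>\<kappa>(B)\<bar> | B \<subseteq> E}\<close>, it says that \<open>\<bar>\<kappa>\<bar>(U - K)\<close> can be made arbitrarily small.\<close>

definition regular_complex_borel_measure ::
  "'a::topological_space set \<Rightarrow> ('a set \<Rightarrow> complex) \<Rightarrow> bool" where
  "regular_complex_borel_measure S \<kappa> \<longleftrightarrow>
    complex_measure (restrict_space borel S) \<kappa> \<and>
    (\<forall>A\<in>sets (restrict_space borel S). \<forall>e>0. \<exists>K U.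
      compact K \<and> openin (top_of_set S) U \<and> K \<subseteq> A \<and> A \<subseteq> U \<and>
      (\<forall>B\<in>sets (restrict_space borel S). B \<subseteq> U - K \<longrightarrow> norm (\<kappa> B) < e))"

text \<open>\<open>\<integral> g d\<kappa>\<close> for a complex measure \<open>\<kappa> = M1 - M2 + i (M3 - M4)\<close> with finite positive \<open>Mi\<close>;
  the value does not depend on the decomposition.\<close>

definition complex_measure_integral ::
  "'a measure \<Rightarrow> ('a set \<Rightarrow> complex) \<Rightarrow> ('a \<Rightarrow> complex) \<Rightarrow> complex" where
  "complex_measure_integral M \<kappa> g = (THE c. \<exists>M1 M2 M3 M4.
    (\<forall>N\<in>{M1, M2, M3, M4}. finite_measure N \<and> sets N = sets M \<and> integrable N g) \<and>
    (\<forall>A\<in>sets M. \<kappa> A =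
      Complex (measure M1 A - measure M2 A) (measure M3 A - measure M4 A)) \<and>
    c = integral\<^sup>L M1 g - integral\<^sup>L M2 g + \<i> * (integral\<^sup>L M3 g - integral\<^sup>L M4 g))"

abbreviation circle :: "complex set" where "circle \<equiv> sphere 0 1"

abbreviation disc :: "complex set" where "disc \<equiv> ball 0 1"

abbreviation circle_borel :: "complex measure" where
  "circle_borel \<equiv> restrict_space borel circle"

definition semi_spectral_measure :: "(complex set \<Rightarrow> 'a::chilbert_space \<Rightarrow> 'a) \<Rightarrow> bool" where
  "semi_spectral_measure \<mu> \<longleftrightarrow>
    (\<forall>A\<in>sets circle_borel. positive_operator (\<mu> A)) \<and>
    (\<forall>A\<in>sets circle_borel. \<forall>B\<in>sets circle_borel. A \<inter> B = {} \<longrightarrow> \<mu> (A \<union> B) = \<mu> A + \<mu> B) \<and>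
    (\<forall>x y. regular_complex_borel_measure circle (\<lambda>A. cinner (\<mu> A x) y))"

definition poisson_kernel :: "complex \<Rightarrow> complex \<Rightarrow> real" where
  "poisson_kernel z \<zeta> = (1 - (norm z)\<^sup>2) / (norm (z - \<zeta>))\<^sup>2"

text \<open>The operator-valued integral is understood weakly.\<close>

definition poisson_integral ::
  "(complex set \<Rightarrow> 'a::chilbert_space \<Rightarrow> 'a) \<Rightarrow> complex \<Rightarrow> 'a \<Rightarrow> 'a" where
  "poisson_integral \<mu> z = (THE T. bounded_clinear T \<and>
    (\<forall>x y. cinner (T x) y = complex_measure_integral circle_borel
       (\<lambda>A. cinner (\<mu> A x) y) (\<lambda>\<zeta>. complex_of_real (poisson_kernel z \<zeta>))))"

section \<open>Function spaces on the disc\<close>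

definition has_cderiv :: "(complex \<Rightarrow> 'a::chilbert_space) \<Rightarrow> 'a \<Rightarrow> complex \<Rightarrow> bool" where
  "has_cderiv f d z \<longleftrightarrow> (f has_derivative (\<lambda>h. h *\<^sub>C d)) (at z)"

definition cderiv :: "(complex \<Rightarrow> 'a::chilbert_space) \<Rightarrow> complex \<Rightarrow> 'a" where
  "cderiv f z = (THE d. has_cderiv f d z)"

text \<open>A function on the disc is represented by its extension by \<open>0\<close> to the whole plane, so that
  equality of functions on the disc is equality in HOL and the pointwise operations are the
  right ones.\<close>

definition holomorphic_disc :: "(complex \<Rightarrow> 'a::chilbert_space) set" where
  "holomorphic_disc = {f. (\<forall>z\<in>disc. \<exists>d. has_cderiv f d z) \<and> (\<forall>z. z \<notin> disc \<longrightarrow> f z = 0)}"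

text \<open>\<open>D_{\<mu>,n}(f)\<close>, possibly infinite; the measure is normalized area measure on the disc.\<close>

definition dirichlet_integral ::
  "(complex set \<Rightarrow> 'a::chilbert_space \<Rightarrow> 'a) \<Rightarrow> nat \<Rightarrow> (complex \<Rightarrow> 'a) \<Rightarrow> ennreal" where
  "dirichlet_integral \<mu> n f = ennreal (1 / (fact n * fact (n - 1))) *
    (\<integral>\<^sup>+ z. ennreal
       (Re (cinner (poisson_integral \<mu> z ((cderiv ^^ n) f z)) ((cderiv ^^ n) f z)) *
        (1 - (norm z)\<^sup>2) ^ (n - 1))
     \<partial>uniform_measure lborel disc)"

definition dirichlet_space ::
  "(complex set \<Rightarrow> 'a::chilbert_space \<Rightarrow> 'a) \<Rightarrow> nat \<Rightarrow> (complex \<Rightarrow> 'a) set" where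
  "dirichlet_space \<mu> n = {f \<in> holomorphic_disc. dirichlet_integral \<mu> n f < \<infinity>}"

definition has_power_series :: "(complex \<Rightarrow> 'a::chilbert_space) \<Rightarrow> (nat \<Rightarrow> 'a) \<Rightarrow> bool" where
  "has_power_series f a \<longleftrightarrow> (\<forall>z\<in>disc. (\<lambda>j. z ^ j *\<^sub>C a j) sums f z)"

definition hardy_space :: "(complex \<Rightarrow> 'a::chilbert_space) set" where
  "hardy_space =
    {f \<in> holomorphic_disc. \<exists>a. has_power_series f a \<and> summable (\<lambda>j. (norm (a j))\<^sup>2)}"

definition hardy_norm_sq :: "(complex \<Rightarrow> 'a::chilbert_space) \<Rightarrow> real" where
  "hardy_norm_sq f = (\<Sum>j. (norm ((THE a. has_power_series f a) j))\<^sup>2)"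

text \<open>The tuple is \<open>(\<mu> 1, \<dots>, \<mu> (m - 1))\<close>; other values of \<open>\<mu>\<close> are not used.\<close>

definition H_space ::
  "nat \<Rightarrow> (nat \<Rightarrow> complex set \<Rightarrow> 'a::chilbert_space \<Rightarrow> 'a) \<Rightarrow> (complex \<Rightarrow> 'a) set" where
  "H_space m \<mu> = (\<Inter>j\<in>{1..m-1}. dirichlet_space (\<mu> j) j) \<inter> hardy_space"

definition H_norm_sq ::
  "nat \<Rightarrow> (nat \<Rightarrow> complex set \<Rightarrow> 'a::chilbert_space \<Rightarrow> 'a) \<Rightarrow> (complex \<Rightarrow> 'a) \<Rightarrow> real" where
  "H_norm_sq m \<mu> f =
    hardy_norm_sq f + (\<Sum>j=1..m-1. enn2real (dirichlet_integral (\<mu> j) j f))"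

definition H_inner ::
  "nat \<Rightarrow> (nat \<Rightarrow> complex set \<Rightarrow> 'a::chilbert_space \<Rightarrow> 'a) \<Rightarrow>
   (complex \<Rightarrow> 'a) \<Rightarrow> (complex \<Rightarrow> 'a) \<Rightarrow> complex" where
  "H_inner m \<mu> = polarization (H_norm_sq m \<mu>)"

definition M_z :: "(complex \<Rightarrow> 'a::chilbert_space) \<Rightarrow> complex \<Rightarrow> 'a" where
  "M_z f = (\<lambda>z. z *\<^sub>C f z)"

end

theory Submission
  imports Defs
begin

text \<open>
  Write \<open>m\<^sub>x\<close> for the positive measure \<open>\<langle>\<mu>(\<cdot>)x, x\<rangle>\<close>. All values of a Dirichlet integral on polynomials are
  determined by the moments of these measures: if \<open>T\<^sub>k\<^sub>l(x, y)\<close> denotes the integral of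
  \<open>\<zeta> ^ k * cnj \<zeta> ^ l\<close> against \<open>\<langle>\<mu>(\<cdot>)x, y\<rangle>\<close>, then the form \<open>D\<^sub>\<mu>\<^sub>,\<^sub>n\<close> takes the value
  \<open>(min k l choose n) * T\<^sub>k\<^sub>l(x, y)\<close> at the monomials \<open>z ^ k * x\<close> and \<open>z ^ l * y\<close>. Indeed, integration of
  \<open>z\<^sup>a * cnj z\<^sup>b\<close> times the Poisson integral against a radial weight picks out one term of the expansion of the
  Poisson kernel (\<open>poisson_disc_moment\<close>), and the radial factor is a Beta integral.

  If \<open>\<mu>\<close> and \<open>\<nu>\<close> are conjugate under \<open>V\<close>, then composition with \<open>V\<close> is a unitary equivalence
  (\<open>unitarily_equivalent_if\<close>). Conversely, let \<open>U\<close> be a unitary that commutes with \<open>M_z\<close>. Derivatives annihilate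
  constants, so the constants are orthogonal to \<open>z\<close> times the space, and they are its whole orthogonal complement
  because every \<open>f\<close> in the space is \<open>f 0 + z * h\<close> with \<open>h\<close> in the space. Hence \<open>U\<close> maps constants onto
  constants, through a unitary \<open>V\<close>, and it maps \<open>z ^ k * x\<close> to \<open>z ^ k * V x\<close>. Comparing inner products of
  monomials gives the equations
  \<open>(\<Sum>r. (min k l choose r) * T\<^sub>r\<^sub>k\<^sub>l(x, x)) = (\<Sum>r. (min k l choose r) * S\<^sub>r\<^sub>k\<^sub>l(V x, V x))\<close>, where \<open>T\<close> and \<open>S\<close>
  belong to \<open>\<mu>\<close> and \<open>\<nu>\<close>. For fixed \<open>k - l\<close> this is a triangular system, so all moments agree; since moments
  determine a measure on the circle (\<open>circle_measure_eqI\<close>), polarization yields the conjugacy of \<open>\<mu>\<close> and \<open>\<nu>\<close>.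

  The analytic part is that the space is invariant under multiplication by \<open>z\<close>, and under division by \<open>z\<close> of
  functions that vanish at 0. The conditions that define it involve different measures for different orders,
  so each order has to be treated by itself. The Dirichlet integral is the increasing limit, as
  \<open>q \<rightarrow> 1\<close>, of integrals with the weight \<open>(1 - t / q) ^ (n - 1)\<close>, \<open>t = (norm z)\<^sup>2 \<le> q\<close>. Up to a factor that
  depends on \<open>n\<close> and \<open>q\<close> only, such an integral of a series with coefficients \<open>a\<^sub>k\<close> is
  \<open>S\<^sub>n(a) = (\<Sum>k l. (min k l choose n) * q ^ max k l * T\<^sub>k\<^sub>l(a\<^sub>k, a\<^sub>l))\<close>. By Pascal's rule, the shift \<open>a'\<close> of \<open>a\<close>
  satisfies \<open>S\<^sub>n(a') = q * (S\<^sub>n(a) + S\<^sub>n\<^sub>-\<^sub>1(a))\<close>. The kernel \<open>\<phi> (min k l) * q ^ max k l\<close> is positive for every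
  nonnegative increasing \<open>\<phi>\<close> (\<open>toeplitz_sum_min_nonneg\<close>). This gives \<open>S\<^sub>n\<^sub>-\<^sub>1(a) \<ge> 0\<close>, hence the division property,
  and also \<open>S\<^sub>n\<^sub>-\<^sub>1(a) \<le> n * S\<^sub>n(a)\<close> if \<open>a\<close> vanishes below \<open>n\<close>, hence the invariance under multiplication. All
  estimates are uniform in \<open>q\<close>.
\<close>

section \<open>Complex Hilbert spaces\<close>

lemma scaleC_zero_left [simp]: "0 *\<^sub>C x = (0::'a::chilbert_space)"
  using scaleC_of_real[of 0 x] by simp

lemma scaleC_one [simp]: "1 *\<^sub>C x = (x::'a::chilbert_space)"
  using scaleC_of_real[of 1 x] by simp

lemma scaleC_minus_one: "(-1) *\<^sub>C x = - (x::'a::chilbert_space)"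
  using scaleC_of_real[of "-1" x] by simp

lemma scaleC_zero_right [simp]: "c *\<^sub>C 0 = (0::'a::chilbert_space)"
  using scaleC_add_right[of c 0 "0::'a"] by simp

lemma scaleR_eq_scaleC: "r *\<^sub>R x = of_real r *\<^sub>C (x::'a::chilbert_space)"
  by (simp add: scaleC_of_real)

lemma cinner_add_right: "cinner x (y + z) = cinner x y + cinner x (z::'a::chilbert_space)"
  by (metis cinner_add_left cinner_commute complex_cnj_add)

lemma cinner_scaleC_right: "cinner x (c *\<^sub>C y) = cnj c * cinner x (y::'a::chilbert_space)"
  by (metis cinner_scaleC_left cinner_commute complex_cnj_mult)

lemma cinner_zero_left [simp]: "cinner 0 (y::'a::chilbert_space) = 0"
  using cinner_scaleC_left[of 0 y y] by simp

lemma cinner_zero_right [simp]: "cinner (y::'a::chilbert_space) 0 = 0"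
  by (metis cinner_commute cinner_zero_left complex_cnj_zero)

lemma cinner_minus_left: "cinner (- x) y = - cinner x (y::'a::chilbert_space)"
  using cinner_scaleC_left[of "-1" x y] by (simp add: scaleC_minus_one)

lemma cinner_diff_left: "cinner (x - z) y = cinner x y - cinner z (y::'a::chilbert_space)"
  using cinner_add_left[of x "- z" y] by (simp add: cinner_minus_left)

lemma cinner_sum_left: "cinner (\<Sum>i\<in>I. f i) (y::'a::chilbert_space) = (\<Sum>i\<in>I. cinner (f i) y)"
  by (induction I rule: infinite_finite_induct) (auto simp: cinner_add_left)

lemma cinner_sum_right: "cinner (y::'a::chilbert_space) (\<Sum>i\<in>I. f i) = (\<Sum>i\<in>I. cinner y (f i))"
  by (induction I rule: infinite_finite_induct) (auto simp: cinner_add_right)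

lemma norm_scaleC: "norm (c *\<^sub>C (x::'a::chilbert_space)) = norm c * norm x"
proof -
  have "complex_of_real ((norm (c *\<^sub>C x))\<^sup>2) = c * cnj c * of_real ((norm x)\<^sup>2)"
    by (simp only: cinner_self[symmetric] cinner_scaleC_left cinner_scaleC_right mult_ac)
  also have "\<dots> = of_real ((norm c * norm x)\<^sup>2)"
    by (simp only: complex_norm_square[symmetric] of_real_mult[symmetric] power_mult_distrib)
  finally have "(norm (c *\<^sub>C x))\<^sup>2 = (norm c * norm x)\<^sup>2" by (simp only: of_real_eq_iff)
  then show ?thesis by (simp add: power2_eq_iff_nonneg)
qed

lemma cinner_eqI: "(\<And>y. cinner x y = cinner z y) \<Longrightarrow> x = (z::'a::chilbert_space)"
  using cinner_self[of "x - z"] by (simp add: cinner_diff_left)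

text \<open>Stated for all types with addition and complex scaling, so as to cover forms on sequences of vectors.\<close>

definition sesquilinear :: "('a::{plus,scaleC} \<Rightarrow> 'a \<Rightarrow> complex) \<Rightarrow> bool" where
  "sesquilinear B \<longleftrightarrow>
    (\<forall>x y z. B (x + y) z = B x z + B y z) \<and> (\<forall>x y z. B x (y + z) = B x y + B x z) \<and>
    (\<forall>c x y. B (c *\<^sub>C x) y = c * B x y) \<and> (\<forall>c x y. B x (c *\<^sub>C y) = cnj c * B x y)"

lemma sesquilinearD:
  assumes "sesquilinear B"
  shows "B (x + y) z = B x z + B y z" "B x (y + z) = B x y + B x z"
    "B (c *\<^sub>C x) y = c * B x y" "B x (c *\<^sub>C y) = cnj c * B x y"
  using assms by (auto simp: sesquilinear_def)

lemma sesquilinear_polarization: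
  assumes "sesquilinear B"
  shows "(\<Sum>k<4. \<i> ^ k * B (x + \<i> ^ k *\<^sub>C y) (x + \<i> ^ k *\<^sub>C y)) / 4 = B x y"
proof -
  note s = sesquilinearD[OF assms]
  have "(\<Sum>k<4. \<i> ^ k * B (x + \<i> ^ k *\<^sub>C y) (x + \<i> ^ k *\<^sub>C y)) = 4 * B x y"
    by (simp only: s) (simp add: eval_nat_numeral algebra_simps)
  then show ?thesis by simp
qed

lemma sesquilinear_cinner: "sesquilinear (cinner :: 'a::chilbert_space \<Rightarrow> _)"
  by (simp add: sesquilinear_def cinner_add_left cinner_add_right cinner_scaleC_left cinner_scaleC_right)

text \<open>Polarization for unit vectors, followed by scaling. With \<open>B = cinner\<close> this serves in place of the
  Cauchy-Schwarz inequality, at the price of the factor \<open>4\<close>.\<close>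

lemma sesquilinear_bound:
  fixes B :: "'a::chilbert_space \<Rightarrow> 'a \<Rightarrow> complex"
  assumes B: "sesquilinear B" and C: "\<And>x. norm (B x x) \<le> C * (norm x)\<^sup>2"
  shows "norm (B x y) \<le> 4 * C * norm x * norm y"
proof (cases "x = 0 \<or> y = 0")
  case True
  have "B 0 y = 0 * B 0 y" "B x 0 = cnj 0 * B x 0"
    using sesquilinearD(3)[OF B, of 0 0 y] sesquilinearD(4)[OF B, of x 0 0] by auto
  with True show ?thesis by auto
next
  case False
  define u where "u = complex_of_real (inverse (norm x)) *\<^sub>C x"
  define v where "v = complex_of_real (inverse (norm y)) *\<^sub>C y"
  have n: "norm u = 1" "norm v = 1" using False by (auto simp: u_def v_def norm_scaleC norm_inverse)
  have "0 \<le> C" using order_trans[OF norm_ge_zero C[of u]] n by simp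
  have one: "norm (\<i> ^ k * B (u + \<i> ^ k *\<^sub>C v) (u + \<i> ^ k *\<^sub>C v)) \<le> C * 4" for k
  proof -
    have "norm (u + \<i> ^ k *\<^sub>C v) \<le> 2"
      using norm_triangle_ineq[of u "\<i> ^ k *\<^sub>C v"] n by (simp add: norm_scaleC norm_power)
    then have "(norm (u + \<i> ^ k *\<^sub>C v))\<^sup>2 \<le> 2\<^sup>2" by (intro power_mono) auto
    then have "C * (norm (u + \<i> ^ k *\<^sub>C v))\<^sup>2 \<le> C * 4" using \<open>0 \<le> C\<close> by (simp add: mult_left_mono)
    with C[of "u + \<i> ^ k *\<^sub>C v"] show ?thesis by (simp add: norm_mult norm_power)
  qed
  have "norm (\<Sum>k<4. \<i> ^ k * B (u + \<i> ^ k *\<^sub>C v) (u + \<i> ^ k *\<^sub>C v)) \<le> (\<Sum>k<(4::nat). C * 4)"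
    by (rule order_trans[OF norm_sum]) (rule sum_mono, rule one)
  then have "norm (B u v) \<le> 4 * C"
    unfolding sesquilinear_polarization[OF B, symmetric, of u v] by (simp add: norm_divide)
  moreover have "norm (B u v) = inverse (norm x) * inverse (norm y) * norm (B x y)"
    by (simp add: u_def v_def sesquilinearD[OF B] norm_mult norm_inverse mult_ac del: of_real_inverse)
  ultimately show ?thesis using False by (simp add: field_simps)
qed

lemma norm_cinner_le: "norm (cinner x y) \<le> 4 * norm x * norm (y::'a::chilbert_space)"
  using sesquilinear_bound[OF sesquilinear_cinner, of 1 x y] by (simp add: cinner_self norm_power)

lemma bounded_bilinear_cinner: "bounded_bilinear (cinner :: 'a::chilbert_space \<Rightarrow> _)"
proof
  show "\<exists>K. \<forall>a b::'a. norm (cinner a b) \<le> norm a * norm b * K"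
    by (rule exI[of _ 4]) (metis norm_cinner_le mult.assoc mult.commute)
qed (auto simp: cinner_add_left cinner_add_right cinner_scaleC_left cinner_scaleC_right
    scaleR_eq_scaleC scaleR_conv_of_real)

lemma bounded_bilinear_scaleC: "bounded_bilinear (scaleC :: complex \<Rightarrow> 'a \<Rightarrow> 'a::chilbert_space)"
proof
  show "\<exists>K. \<forall>a (b::'a). norm (a *\<^sub>C b) \<le> norm a * norm b * K"
    by (rule exI[of _ 1]) (simp add: norm_scaleC)
qed (auto simp: scaleC_add_left scaleC_add_right scaleR_eq_scaleC scaleC_scaleC
    scaleR_conv_of_real mult.commute simp del: of_real_mult)

lemma tendsto_cinner [tendsto_intros]:
  "(f \<longlongrightarrow> c) F \<Longrightarrow> (g \<longlongrightarrow> (x::'a::chilbert_space)) F \<Longrightarrow> ((\<lambda>w. cinner (f w) (g w)) \<longlongrightarrow> cinner c x) F"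
  by (rule bounded_bilinear.tendsto[OF bounded_bilinear_cinner])

lemma norm_add_square:
  "(norm (x + y))\<^sup>2 = (norm x)\<^sup>2 + (norm y)\<^sup>2 + 2 * Re (cinner x (y::'a::chilbert_space))"
proof -
  have "complex_of_real ((norm (x + y))\<^sup>2) =
      of_real ((norm x)\<^sup>2) + of_real ((norm y)\<^sup>2) + (cinner x y + cnj (cinner x y))"
    by (simp only: cinner_self[symmetric] cinner_add_left cinner_add_right
        cinner_commute[of y x, symmetric]) (simp add: algebra_simps)
  also have "\<dots> = of_real ((norm x)\<^sup>2 + (norm y)\<^sup>2 + 2 * Re (cinner x y))"
    by (simp only: complex_add_cnj of_real_add)
  finally show ?thesis by (simp only: of_real_eq_iff)
qed

text \<open>The Riesz representation theorem. The representing vector minimizes \<open>\<Phi>\<close>: a minimizing sequence is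
  Cauchy by the parallelogram law, and at the minimum the derivative of \<open>\<Phi>\<close> in every direction
  vanishes.\<close>

lemma riesz_representation:
  fixes \<phi> :: "'a::chilbert_space \<Rightarrow> complex"
  assumes add: "\<And>x y. \<phi> (x + y) = \<phi> x + \<phi> y" and scale: "\<And>c x. \<phi> (c *\<^sub>C x) = c * \<phi> x"
    and bound: "\<And>x. norm (\<phi> x) \<le> C * norm x"
  shows "\<exists>w. \<forall>x. \<phi> x = cinner x w"
proof -
  define \<Phi> where "\<Phi> y = (norm y)\<^sup>2 - 2 * Re (\<phi> y)" for y
  have bl: "bounded_linear \<phi>"
    by (rule bounded_linear_intro[of _ C])
      (use add scale bound in \<open>auto simp: scaleR_eq_scaleC scaleR_conv_of_real mult.commute\<close>)
  have low: "- C\<^sup>2 \<le> \<Phi> y" for y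
  proof -
    have "Re (\<phi> y) \<le> C * norm y" using bound[of y] complex_Re_le_cmod[of "\<phi> y"] by linarith
    moreover have "0 \<le> (norm y - C)\<^sup>2" by simp
    ultimately show ?thesis by (simp add: \<Phi>_def power2_diff mult_ac)
  qed
  define d where "d = Inf (range \<Phi>)"
  have bdd: "bdd_below (range \<Phi>)" by (rule bdd_belowI2[of _ "- C\<^sup>2"]) (rule low)
  have dle: "d \<le> \<Phi> y" for y unfolding d_def by (rule cInf_lower[OF _ bdd]) auto
  have "\<exists>y. \<Phi> y < d + 1 / real (Suc n)" for n
    using cInf_lessD[of "range \<Phi>" "d + 1 / real (Suc n)"] by (auto simp: d_def)
  then obtain Y where Y: "\<And>n. \<Phi> (Y n) < d + 1 / real (Suc n)" by metis
  have par: "(norm (x - y))\<^sup>2 = 2 * \<Phi> x + 2 * \<Phi> y - 4 * \<Phi> ((1/2) *\<^sub>R (x + y))" for x y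
  proof -
    have "(norm (x - y))\<^sup>2 + (norm (x + y))\<^sup>2 = 2 * (norm x)\<^sup>2 + 2 * (norm y)\<^sup>2"
      using norm_add_square[of x y] norm_add_square[of x "- y"]
      by (simp add: bounded_bilinear.minus_right[OF bounded_bilinear_cinner])
    moreover have "Re (\<phi> ((1/2) *\<^sub>R (x + y))) = (Re (\<phi> x) + Re (\<phi> y)) / 2"
      by (simp add: linear_cmul[OF bounded_linear.linear[OF bl]] add)
    moreover have "4 * (norm ((1/2) *\<^sub>R (x + y)))\<^sup>2 = (norm (x + y))\<^sup>2"
      by (simp add: power_mult_distrib power_divide)
    ultimately show ?thesis by (simp add: \<Phi>_def algebra_simps)
  qed
  have near: "(norm (Y m - Y n))\<^sup>2 \<le> 2 * (1 / real (Suc m)) + 2 * (1 / real (Suc n))" for m n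
    using par[of "Y m" "Y n"] Y[of m] Y[of n] dle[of "(1/2) *\<^sub>R (Y m + Y n)"] by linarith
  have "Cauchy Y"
  proof (rule CauchyI)
    fix e :: real assume e: "0 < e"
    obtain N where N: "1 / real (Suc N) < e\<^sup>2 / 4"
      using nat_approx_posE[of "e\<^sup>2 / 4"] e by auto
    have "norm (Y m - Y n) < e" if "m \<ge> N" "n \<ge> N" for m n
    proof -
      have "1 / real (Suc m) \<le> 1 / real (Suc N)" "1 / real (Suc n) \<le> 1 / real (Suc N)"
        using that by (auto simp: field_simps)
      with near[of m n] N have "(norm (Y m - Y n))\<^sup>2 < e\<^sup>2" by linarith
      then show ?thesis using e by (metis less_imp_le power_less_imp_less_base)
    qed
    then show "\<exists>M. \<forall>m\<ge>M. \<forall>n\<ge>M. norm (Y m - Y n) < e" by blast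
  qed
  then obtain w where w: "Y \<longlonglongrightarrow> w" using Cauchy_convergent convergent_def by blast
  have "(\<lambda>n. \<Phi> (Y n)) \<longlonglongrightarrow> \<Phi> w"
    unfolding \<Phi>_def by (intro tendsto_intros bounded_linear.tendsto[OF bl] w)
  moreover have "(\<lambda>n. d + 1 / real (Suc n)) \<longlonglongrightarrow> d + 0"
    using LIMSEQ_inverse_real_of_nat by (intro tendsto_intros) (simp add: inverse_eq_divide)
  ultimately have "\<Phi> w \<le> d + 0"
    by (rule LIMSEQ_le) (use Y less_imp_le in blast)
  then have min: "\<Phi> w \<le> \<Phi> y" for y using dle[of y] by simp
  have re: "Re (\<phi> x) = Re (cinner x w)" for x
  proof -
    define a where "a = Re (cinner w x) - Re (\<phi> x)"
    have q: "0 \<le> t\<^sup>2 * (norm x)\<^sup>2 + 2 * t * a" for t :: real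
    proof -
      have "\<Phi> (w + t *\<^sub>R x) = \<Phi> w + t\<^sup>2 * (norm x)\<^sup>2 + 2 * t * a"
        by (simp add: \<Phi>_def a_def norm_add_square add power_mult_distrib
            bounded_bilinear.scaleR_right[OF bounded_bilinear_cinner]
            linear_cmul[OF bounded_linear.linear[OF bl]] algebra_simps)
      with min[of "w + t *\<^sub>R x"] show ?thesis by simp
    qed
    have "a = 0"
    proof (rule ccontr)
      assume a: "a \<noteq> 0"
      define s where "s = 1 + (norm x)\<^sup>2"
      have s: "s > 0" "(norm x)\<^sup>2 = s - 1" by (simp_all add: s_def add_pos_nonneg)
      \<comment> \<open>The step \<open>- a / s\<close> is short enough for the linear term to win.\<close>
      have "(- a / s)\<^sup>2 * (norm x)\<^sup>2 + 2 * (- a / s) * a = - (a\<^sup>2 / s\<^sup>2) * (s + 1)"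
        using s by (simp add: power2_eq_square divide_simps) (simp add: algebra_simps)
      moreover have "0 < (a\<^sup>2 / s\<^sup>2) * (s + 1)" using a s by (intro mult_pos_pos divide_pos_pos) auto
      ultimately show False using q[of "- a / s"] by linarith
    qed
    then show ?thesis by (metis a_def cinner_commute cnj.sel(1) diff_eq_eq add_0)
  qed
  have "\<phi> x = cinner x w" for x
  proof (rule complex_eqI)
    show "Im (\<phi> x) = Im (cinner x w)"
      using re[of "\<i> *\<^sub>C x"] by (simp add: scale cinner_scaleC_left)
  qed (rule re)
  then show ?thesis by blast
qed

lemma ex_operator_of_form:
  fixes B :: "'a::chilbert_space \<Rightarrow> 'a \<Rightarrow> complex"
  assumes B: "sesquilinear B" and bound: "\<And>x y. norm (B x y) \<le> C * norm x * norm y"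
  shows "\<exists>!T. bounded_clinear T \<and> (\<forall>x y. cinner (T x) y = B x y)"
proof (rule ex_ex1I)
  have "\<exists>w. \<forall>y. cnj (B x y) = cinner y w" for x
    by (rule riesz_representation[of _ "C * norm x"])
      (use bound in \<open>auto simp: sesquilinearD[OF B]\<close>)
  then obtain T where "\<And>x y. cnj (B x y) = cinner y (T x)" by metis
  then have T: "cinner (T x) y = B x y" for x y by (metis cinner_commute complex_cnj_cnj)
  have add: "T (x + y) = T x + T y" for x y
    by (rule cinner_eqI) (simp add: T cinner_add_left sesquilinearD[OF B])
  have scale: "T (c *\<^sub>C x) = c *\<^sub>C T x" for c x
    by (rule cinner_eqI) (simp add: T cinner_scaleC_left sesquilinearD[OF B])
  have "norm (T x) \<le> norm x * C" for x
  proof -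
    have "(norm (T x))\<^sup>2 = norm (B x (T x))"
      by (simp only: T[symmetric] cinner_self) (simp add: norm_power)
    also have "\<dots> \<le> (norm x * C) * norm (T x)" using bound[of x "T x"] by (simp add: mult_ac)
    finally show ?thesis
    proof (cases "T x = 0")
      case True
      have "0 \<le> norm x * C"
        using order_trans[OF norm_ge_zero bound[of x x]]
        by (cases "x = 0") (simp_all add: mult_ac zero_le_mult_iff mult_le_0_iff)
      with True show ?thesis by simp
    qed (simp add: power2_eq_square)
  qed
  then have "bounded_linear T"
    by (intro bounded_linear_intro[of _ C]) (auto simp: add scale scaleR_eq_scaleC)
  then show "\<exists>T. bounded_clinear T \<and> (\<forall>x y. cinner (T x) y = B x y)"
    using T scale by (auto simp: bounded_clinear_def)
next
  fix T S
  assume "bounded_clinear T \<and> (\<forall>x y. cinner (T x) y = B x y)"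
    and "bounded_clinear S \<and> (\<forall>x y. cinner (S x) y = B x y)"
  then show "T = S" by (intro ext cinner_eqI) auto
qed

section \<open>Integration against semi-spectral measures\<close>

lemma space_circle_borel: "space circle_borel = circle"
  by (simp add: space_restrict_space)

lemma borel_measurable_circle_borel:
  "g \<in> borel_measurable borel \<Longrightarrow> g \<in> borel_measurable circle_borel"
  by (rule measurable_restrict_space1)

lemma measurable_ident_circle:
  assumes "sets m = sets circle_borel" shows "(\<lambda>\<zeta>. \<zeta>) \<in> measurable m borel"
  using borel_measurable_circle_borel[of "\<lambda>\<zeta>. \<zeta>"] by (simp add: measurable_cong_sets[OF assms refl])

text \<open>The approximating sums depend on the integrand only and not on the measure; hence a linear relation
  between the values of several measures passes to their integrals.\<close>

lemma integral_as_limit_of_sums: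
  fixes g :: "'a \<Rightarrow> complex"
  assumes g: "g \<in> borel_measurable M"
  obtains Y :: "nat \<Rightarrow> complex set" and A :: "nat \<Rightarrow> complex \<Rightarrow> 'a set" where
    "\<And>n. finite (Y n)" "\<And>n y. A n y \<in> sets M"
    "\<And>N. finite_measure N \<Longrightarrow> sets N = sets M \<Longrightarrow> integrable N g \<Longrightarrow>
      (\<lambda>n. \<Sum>y\<in>Y n. y * complex_of_real (measure N (A n y))) \<longlonglongrightarrow> integral\<^sup>L N g"
proof -
  obtain s where s: "\<And>i. simple_function M (s i)" "\<And>x. x \<in> space M \<Longrightarrow> (\<lambda>i. s i x) \<longlonglongrightarrow> g x"
    "\<And>i x. x \<in> space M \<Longrightarrow> norm (s i x) \<le> 2 * norm (g x)"
    using borel_measurable_implies_sequence_metric[OF g, of 0] by (auto simp: dist_norm) metis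
  show thesis
  proof (rule that[of "\<lambda>n. s n ` space M" "\<lambda>n y. s n -` {y} \<inter> space M"])
    show "finite (s n ` space M)" for n using s(1) by (simp add: simple_function_def)
    show "s n -` {y} \<inter> space M \<in> sets M" for n y
      using s(1)[of n] by (rule simple_functionD)
  next
    fix N assume N: "finite_measure N" "sets N = sets M" "integrable N g"
    interpret finite_measure N by fact
    have sp: "space N = space M" using sets_eq_imp_space_eq[OF N(2)] .
    have sN: "simple_function N (s i)" for i
      using s(1)[of i] unfolding simple_function_def sp N(2) .
    have "(\<lambda>i. integral\<^sup>L N (s i)) \<longlonglongrightarrow> integral\<^sup>L N g"
    proof (rule integral_dominated_convergence[where w = "\<lambda>x. 2 * norm (g x)"])
      show "g \<in> borel_measurable N" using N(3) by auto
      show "s i \<in> borel_measurable N" for i using sN by (rule borel_measurable_simple_function)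
      show "integrable N (\<lambda>x. 2 * norm (g x))" using N(3) by simp
    qed (use s sp in auto)
    moreover have "integral\<^sup>L N (s i) =
        (\<Sum>y\<in>s i ` space M. y * complex_of_real (measure N (s i -` {y} \<inter> space M)))" for i
    proof -
      have "Bochner_Integration.simple_bochner_integrable N (s i)"
        by (auto simp: simple_bochner_integrable.simps sN emeasure_eq_measure)
      then have "integral\<^sup>L N (s i) = Bochner_Integration.simple_bochner_integral N (s i)"
        by (simp add: simple_bochner_integrable_eq_integral)
      also have "\<dots> = (\<Sum>y\<in>s i ` space M. y * complex_of_real (measure N (s i -` {y} \<inter> space M)))"
        unfolding simple_bochner_integral_def sp
        by (intro sum.cong refl) (auto simp: scaleR_conv_of_real vimage_def Int_def conj_commute mult.commute)
      finally show ?thesis .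
    qed
    ultimately show "(\<lambda>n. \<Sum>y\<in>s n ` space M. y * complex_of_real (measure N (s n -` {y} \<inter> space M)))
        \<longlonglongrightarrow> integral\<^sup>L N g" by simp
  qed
qed

definition quad_measure :: "(complex set \<Rightarrow> 'a::chilbert_space \<Rightarrow> 'a) \<Rightarrow> 'a \<Rightarrow> complex measure" where
  "quad_measure \<mu> x = measure_of circle (sets circle_borel) (\<lambda>A. ennreal (Re (cinner (\<mu> A x) x)))"

lemma sets_quad_measure [simp, measurable_cong]: "sets (quad_measure \<mu> x) = sets circle_borel"
  unfolding quad_measure_def
  by (subst sets_measure_of)
    (metis sets.space_closed space_circle_borel, metis sets.sigma_sets_eq space_circle_borel)

lemma space_quad_measure [simp]: "space (quad_measure \<mu> x) = circle"
  using sets_eq_imp_space_eq[OF sets_quad_measure] space_circle_borel by metis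

lemma semi_spectral_measureD:
  assumes "semi_spectral_measure \<mu>" "A \<in> sets circle_borel"
  shows "bounded_clinear (\<mu> A)" "sesquilinear (\<lambda>x y. cinner (\<mu> A x) y)"
    "cinner (\<mu> A x) x = of_real (Re (cinner (\<mu> A x) x))" "0 \<le> Re (cinner (\<mu> A x) x)"
proof -
  have p: "positive_operator (\<mu> A)" using assms by (simp add: semi_spectral_measure_def)
  then show bc: "bounded_clinear (\<mu> A)" by (simp add: positive_operator_def)
  then have "\<mu> A (x + y) = \<mu> A x + \<mu> A y" "\<mu> A (c *\<^sub>C x) = c *\<^sub>C \<mu> A x" for c x y
    by (auto simp: bounded_clinear_def linear_add bounded_linear.linear)
  then show "sesquilinear (\<lambda>x y. cinner (\<mu> A x) y)"
    by (simp add: sesquilinear_def cinner_add_left cinner_add_right cinner_scaleC_left cinner_scaleC_right)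
  show "cinner (\<mu> A x) x = of_real (Re (cinner (\<mu> A x) x))" "0 \<le> Re (cinner (\<mu> A x) x)"
    using p by (auto simp: positive_operator_def)
qed

lemma emeasure_quad_measure:
  assumes \<mu>: "semi_spectral_measure \<mu>" and A: "A \<in> sets circle_borel"
  shows "emeasure (quad_measure \<mu> x) A = ennreal (Re (cinner (\<mu> A x) x))"
  unfolding quad_measure_def
proof (rule emeasure_measure_of_sigma)
  show "sigma_algebra circle (sets circle_borel)"
    by (metis sets.sigma_algebra_axioms space_circle_borel)
  have "\<mu> ({} \<union> {}) = \<mu> {} + \<mu> {}"
    using \<mu> unfolding semi_spectral_measure_def by (metis Int_empty_left sets.empty_sets)
  then have "\<mu> {} x = 0" by (simp add: fun_eq_iff)
  then show "positive (sets circle_borel) (\<lambda>A. ennreal (Re (cinner (\<mu> A x) x)))"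
    by (simp add: positive_def)
  show "countably_additive (sets circle_borel) (\<lambda>A. ennreal (Re (cinner (\<mu> A x) x)))"
  proof (rule countably_additiveI)
    fix F :: "nat \<Rightarrow> complex set"
    assume F: "range F \<subseteq> sets circle_borel" "disjoint_family F"
    have "(\<lambda>i. cinner (\<mu> (F i) x) x) sums cinner (\<mu> (\<Union>i. F i) x) x"
      using \<mu> F by (auto simp: semi_spectral_measure_def regular_complex_borel_measure_def complex_measure_def)
    then have s: "(\<lambda>i. Re (cinner (\<mu> (F i) x) x)) sums Re (cinner (\<mu> (\<Union>i. F i) x) x)"
      by (rule sums_Re)
    show "(\<Sum>i. ennreal (Re (cinner (\<mu> (F i) x) x))) = ennreal (Re (cinner (\<mu> (\<Union>i. F i) x) x))"
      using s F by (intro suminf_ennreal_eq semi_spectral_measureD(4)[OF \<mu>]) auto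
  qed
qed (fact A)

lemma finite_measure_quad_measure:
  assumes "semi_spectral_measure \<mu>" shows "finite_measure (quad_measure \<mu> x)"
  by (rule finite_measureI)
    (simp add: emeasure_quad_measure[OF assms] sets.top[of circle_borel, unfolded space_circle_borel])

lemma measure_quad_measure:
  assumes "semi_spectral_measure \<mu>" "A \<in> sets circle_borel"
  shows "complex_of_real (measure (quad_measure \<mu> x) A) = cinner (\<mu> A x) x"
  by (simp only: measure_def emeasure_quad_measure[OF assms] enn2real_ennreal[OF semi_spectral_measureD(4)[OF assms]]
      semi_spectral_measureD(3)[OF assms, symmetric])

lemma measure_quad_measure_le:
  assumes "semi_spectral_measure \<mu>"
  obtains C where "0 \<le> C" "\<And>x. measure (quad_measure \<mu> x) circle \<le> C * (norm x)\<^sup>2"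
proof -
  have c: "circle \<in> sets circle_borel" using sets.top[of circle_borel] by (simp add: space_circle_borel)
  have "bounded_linear (\<mu> circle)"
    using semi_spectral_measureD(1)[OF assms c] by (simp add: bounded_clinear_def)
  then obtain K where K: "K > 0" "\<And>x. norm (\<mu> circle x) \<le> norm x * K"
    using bounded_linear.pos_bounded by blast
  have "measure (quad_measure \<mu> x) circle \<le> (4 * K) * (norm x)\<^sup>2" for x
  proof -
    have "measure (quad_measure \<mu> x) circle = norm (cinner (\<mu> circle x) x)"
      unfolding measure_quad_measure[OF assms c, symmetric] by simp
    also have "\<dots> \<le> 4 * norm (\<mu> circle x) * norm x" by (rule norm_cinner_le)
    also have "\<dots> \<le> 4 * (norm x * K) * norm x" using K by (intro mult_mono) auto
    finally show ?thesis by (simp add: power2_eq_square mult_ac)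
  qed
  with K that show thesis by (meson less_imp_le mult_nonneg_nonneg zero_le_numeral)
qed

text \<open>The integral of \<open>g\<close> against the complex measure \<open>\<langle>\<mu>(\<cdot>)x, y\<rangle>\<close>. Polarization reduces it to the positive
  measures \<open>quad_measure \<mu> v\<close>, for which the Lebesgue integral is available.\<close>

definition spectral_form ::
  "(complex set \<Rightarrow> 'a::chilbert_space \<Rightarrow> 'a) \<Rightarrow> (complex \<Rightarrow> complex) \<Rightarrow> 'a \<Rightarrow> 'a \<Rightarrow> complex" where
  "spectral_form \<mu> g x y = (\<Sum>k<4. \<i> ^ k * (LINT \<zeta>|quad_measure \<mu> (x + \<i> ^ k *\<^sub>C y). g \<zeta>)) / 4"

lemma integrable_quad_measure:
  fixes g :: "complex \<Rightarrow> 'b::{banach, second_countable_topology}"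
  assumes "semi_spectral_measure \<mu>" "g \<in> borel_measurable borel" "\<forall>\<zeta>\<in>circle. norm (g \<zeta>) \<le> G"
  shows "integrable (quad_measure \<mu> x) g"
proof -
  interpret finite_measure "quad_measure \<mu> x" by (rule finite_measure_quad_measure) fact
  have "g \<in> borel_measurable (quad_measure \<mu> x)"
    using borel_measurable_circle_borel[OF assms(2)]
    by (simp add: measurable_cong_sets[OF sets_quad_measure refl])
  then show ?thesis
    by (rule integrable_const_bound[rotated, where B = G]) (use assms(3) in auto)
qed

text \<open>Both claims hold for finite sums \<open>\<Sum>c * \<langle>\<mu>(A)x, y\<rangle>\<close> because each \<open>\<mu>(A)\<close> is linear, and one sequence of such
  sums converges for all \<open>x\<close> and \<open>y\<close> at once.\<close>

lemma
  assumes \<mu>: "semi_spectral_measure \<mu>" and g: "g \<in> borel_measurable borel" "\<forall>\<zeta>\<in>circle. norm (g \<zeta>) \<le> G"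
  shows sesquilinear_spectral_form: "sesquilinear (spectral_form \<mu> g)"
    and spectral_form_diag: "spectral_form \<mu> g x x = (LINT \<zeta>|quad_measure \<mu> x. g \<zeta>)"
proof -
  obtain Y A where YA: "\<And>n. finite (Y n)" "\<And>n y. A n y \<in> sets circle_borel"
    "\<And>N. finite_measure N \<Longrightarrow> sets N = sets circle_borel \<Longrightarrow> integrable N g \<Longrightarrow>
      (\<lambda>n. \<Sum>y\<in>Y n. y * complex_of_real (measure N (A n y))) \<longlonglongrightarrow> integral\<^sup>L N g"
    using integral_as_limit_of_sums[OF borel_measurable_circle_borel[OF g(1)]] by blast
  define B where "B n x y = (\<Sum>c\<in>Y n. c * cinner (\<mu> (A n c) x) y)" for n x y
  have sB: "sesquilinear (B n)" for n
    using sesquilinearD[OF semi_spectral_measureD(2)[OF \<mu> YA(2)]]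
    by (simp add: sesquilinear_def B_def distrib_left sum.distrib sum_distrib_left mult_ac)
  have diag: "(\<lambda>n. B n x x) \<longlonglongrightarrow> (LINT \<zeta>|quad_measure \<mu> x. g \<zeta>)" for x
    using YA(3)[OF finite_measure_quad_measure[OF \<mu>] sets_quad_measure integrable_quad_measure[OF \<mu> g]]
    by (simp add: B_def measure_quad_measure[OF \<mu> YA(2)])
  have lim: "(\<lambda>n. B n x y) \<longlonglongrightarrow> spectral_form \<mu> g x y" for x y
    unfolding spectral_form_def sesquilinear_polarization[OF sB, symmetric, of _ x y]
    by (intro tendsto_intros diag) auto
  show "spectral_form \<mu> g x x = (LINT \<zeta>|quad_measure \<mu> x. g \<zeta>)"
    using LIMSEQ_unique[OF lim diag] .
  have "spectral_form \<mu> g (x + y) z = spectral_form \<mu> g x z + spectral_form \<mu> g y z" for x y z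
    by (rule LIMSEQ_unique[OF lim]) (simp add: sesquilinearD[OF sB] tendsto_add lim)
  moreover have "spectral_form \<mu> g z (x + y) = spectral_form \<mu> g z x + spectral_form \<mu> g z y" for x y z
    by (rule LIMSEQ_unique[OF lim]) (simp add: sesquilinearD[OF sB] tendsto_add lim)
  moreover have "spectral_form \<mu> g (c *\<^sub>C x) y = c * spectral_form \<mu> g x y" for c x y
    by (rule LIMSEQ_unique[OF lim]) (simp add: sesquilinearD[OF sB] tendsto_mult_left lim)
  moreover have "spectral_form \<mu> g x (c *\<^sub>C y) = cnj c * spectral_form \<mu> g x y" for c x y
    by (rule LIMSEQ_unique[OF lim]) (simp add: sesquilinearD[OF sB] tendsto_mult_left lim)
  ultimately show "sesquilinear (spectral_form \<mu> g)" by (simp add: sesquilinear_def)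
qed

text \<open>Polarization itself provides a decomposition as in the definition of \<open>complex_measure_integral\<close>. Any other
  decomposition gives the same value, since the approximating sums of both depend on \<open>\<langle>\<mu>(\<cdot>)x, y\<rangle>\<close> only.\<close>

lemma complex_measure_integral_spectral:
  assumes \<mu>: "semi_spectral_measure \<mu>" and g: "g \<in> borel_measurable borel" "\<forall>\<zeta>\<in>circle. norm (g \<zeta>) \<le> G"
  shows "complex_measure_integral circle_borel (\<lambda>A. cinner (\<mu> A x) y) g = spectral_form \<mu> g x y"
proof -
  let ?\<kappa> = "\<lambda>A. cinner (\<mu> A x) y"
  \<comment> \<open>The factor \<open>1/2\<close> scales the measure by \<open>1/4\<close>, as the polarization identity requires.\<close>
  define M where "M k = quad_measure \<mu> (of_real (1/2) *\<^sub>C (x + \<i> ^ k *\<^sub>C y))" for k :: nat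
  note sesq = sesquilinear_spectral_form[OF \<mu> g] and diag = spectral_form_diag[OF \<mu> g]
  have fin: "finite_measure (M k)" "sets (M k) = sets circle_borel" "integrable (M k) g" for k
    unfolding M_def by (rule finite_measure_quad_measure[OF \<mu>], simp, rule integrable_quad_measure[OF \<mu> g])
  have dec: "?\<kappa> A = Complex (measure (M 0) A - measure (M 2) A) (measure (M 1) A - measure (M 3) A)"
    if A: "A \<in> sets circle_borel" for A
  proof -
    note s = semi_spectral_measureD(2)[OF \<mu> A]
    have "complex_of_real (measure (M k) A) =
        cinner (\<mu> A (x + \<i> ^ k *\<^sub>C y)) (x + \<i> ^ k *\<^sub>C y) / 4" for k
      by (simp add: M_def measure_quad_measure[OF \<mu> A] sesquilinearD(3,4)[OF s])
    note mk = this
    have "?\<kappa> A = (\<Sum>k<4. \<i> ^ k * complex_of_real (measure (M k) A))"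
      unfolding mk times_divide_eq_right sum_divide_distrib[symmetric]
      by (rule sesquilinear_polarization[OF s, symmetric])
    also have "\<dots> = Complex (measure (M 0) A - measure (M 2) A) (measure (M 1) A - measure (M 3) A)"
      by (simp add: eval_nat_numeral complex_eq_iff)
    finally show ?thesis .
  qed
  have val: "spectral_form \<mu> g x y =
      integral\<^sup>L (M 0) g - integral\<^sup>L (M 2) g + \<i> * (integral\<^sup>L (M 1) g - integral\<^sup>L (M 3) g)"
  proof -
    have mk: "integral\<^sup>L (M k) g = integral\<^sup>L (quad_measure \<mu> (x + \<i> ^ k *\<^sub>C y)) g / 4" for k
      unfolding M_def diag[symmetric] by (simp add: sesquilinearD(3,4)[OF sesq])
    show ?thesis unfolding spectral_form_def mk
      by (simp add: eval_nat_numeral field_simps)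
  qed
  let ?P = "\<lambda>c. \<exists>M1 M2 M3 M4. (\<forall>N\<in>{M1, M2, M3, M4}. finite_measure N \<and> sets N = sets circle_borel \<and> integrable N g) \<and>
       (\<forall>A\<in>sets circle_borel. ?\<kappa> A = Complex (measure M1 A - measure M2 A) (measure M3 A - measure M4 A)) \<and>
       c = integral\<^sup>L M1 g - integral\<^sup>L M2 g + \<i> * (integral\<^sup>L M3 g - integral\<^sup>L M4 g)"
  show ?thesis unfolding complex_measure_integral_def
  proof (rule the_equality)
    show "?P (spectral_form \<mu> g x y)"
      using fin dec val by (intro exI[of _ "M 0"] exI[of _ "M 2"] exI[of _ "M 1"] exI[of _ "M 3"]) auto
  next
    fix c
    assume "?P c"
    then obtain M1 M2 M3 M4 where M: "\<And>N. N \<in> {M1, M2, M3, M4} \<Longrightarrow> finite_measure N \<and> sets N = sets circle_borel \<and> integrable N g"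
      and dec': "\<And>A. A\<in>sets circle_borel \<Longrightarrow> ?\<kappa> A = Complex (measure M1 A - measure M2 A) (measure M3 A - measure M4 A)"
      and c: "c = integral\<^sup>L M1 g - integral\<^sup>L M2 g + \<i> * (integral\<^sup>L M3 g - integral\<^sup>L M4 g)"
      by blast
    obtain Y A where YA: "\<And>n. finite (Y n)" "\<And>n y. A n y \<in> sets circle_borel"
      "\<And>N. finite_measure N \<Longrightarrow> sets N = sets circle_borel \<Longrightarrow> integrable N g \<Longrightarrow>
        (\<lambda>n. \<Sum>y\<in>Y n. y * complex_of_real (measure N (A n y))) \<longlonglongrightarrow> integral\<^sup>L N g"
      using integral_as_limit_of_sums[OF borel_measurable_circle_borel[OF g(1)]] by blast
    have conv: "(\<lambda>n. \<Sum>c\<in>Y n. c * ?\<kappa> (A n c)) \<longlonglongrightarrow>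
        integral\<^sup>L N1 g - integral\<^sup>L N2 g + \<i> * (integral\<^sup>L N3 g - integral\<^sup>L N4 g)"
      if N: "\<And>N. N \<in> {N1, N2, N3, N4} \<Longrightarrow> finite_measure N \<and> sets N = sets circle_borel \<and> integrable N g"
        and d: "\<And>A. A\<in>sets circle_borel \<Longrightarrow> ?\<kappa> A = Complex (measure N1 A - measure N2 A) (measure N3 A - measure N4 A)"
      for N1 N2 N3 N4
    proof -
      let ?S = "\<lambda>N n. \<Sum>c\<in>Y n. c * complex_of_real (measure N (A n c))"
      have "?S N \<longlonglongrightarrow> integral\<^sup>L N g" if "N \<in> {N1, N2, N3, N4}" for N
        using YA(3) N[OF that] by blast
      then have "(\<lambda>n. ?S N1 n - ?S N2 n + \<i> * (?S N3 n - ?S N4 n)) \<longlonglongrightarrow>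
          integral\<^sup>L N1 g - integral\<^sup>L N2 g + \<i> * (integral\<^sup>L N3 g - integral\<^sup>L N4 g)"
        by (intro tendsto_intros) auto
      moreover have "(\<Sum>c\<in>Y n. c * ?\<kappa> (A n c)) = ?S N1 n - ?S N2 n + \<i> * (?S N3 n - ?S N4 n)" for n
        unfolding sum_subtractf[symmetric] sum_distrib_left sum.distrib[symmetric]
        by (intro sum.cong refl) (simp add: d[OF YA(2)] complex_eq_iff algebra_simps)
      ultimately show ?thesis by simp
    qed
    show "c = spectral_form \<mu> g x y"
      unfolding c val
      by (rule LIMSEQ_unique[OF conv[of M1 M2 M3 M4] conv[of "M 0" "M 2" "M 1" "M 3"]])
        (use M dec' fin dec in auto)
  qed
qed

lemma poisson_kernel_bounds:
  assumes "z \<in> disc" "\<zeta> \<in> circle"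
  shows "0 \<le> poisson_kernel z \<zeta>" "poisson_kernel z \<zeta> \<le> 1 / (1 - norm z)\<^sup>2"
proof -
  have "0 < 1 - norm z" "1 - norm z \<le> norm (z - \<zeta>)"
    using assms norm_triangle_ineq2[of \<zeta> z] by (auto simp: norm_minus_commute)
  then have d: "(1 - norm z)\<^sup>2 \<le> (norm (z - \<zeta>))\<^sup>2" "0 < (1 - norm z)\<^sup>2" by (auto intro: power_mono)
  have n: "(norm z)\<^sup>2 \<le> 1" using assms by (simp add: power_le_one)
  then show "0 \<le> poisson_kernel z \<zeta>" by (simp add: poisson_kernel_def)
  show "poisson_kernel z \<zeta> \<le> 1 / (1 - norm z)\<^sup>2"
    unfolding poisson_kernel_def using d n by (intro frac_le) auto
qed

lemma borel_measurable_poisson_kernel [measurable]: "poisson_kernel z \<in> borel_measurable borel"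
  unfolding poisson_kernel_def by measurable

lemma borel_measurable_poisson_integral:
  assumes "finite_measure m" and m: "sets m = sets circle_borel"
  shows "(\<lambda>z. LINT \<zeta>|m. poisson_kernel z \<zeta>) \<in> borel_measurable borel"
proof -
  interpret finite_measure m by fact
  note [measurable] = measurable_ident_circle[OF m]
  have "(\<lambda>p. poisson_kernel (fst p) (snd p)) \<in> borel_measurable (borel \<Otimes>\<^sub>M m)"
    unfolding poisson_kernel_def by measurable
  then show ?thesis by (intro borel_measurable_lebesgue_integral) (simp add: split_beta')
qed

text \<open>The quadratic form of the Poisson integral, by \<open>poisson_integral_quad\<close> below.\<close>

definition poisson_quad :: "(complex set \<Rightarrow> 'a::chilbert_space \<Rightarrow> 'a) \<Rightarrow> complex \<Rightarrow> 'a \<Rightarrow> real" where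
  "poisson_quad \<mu> z x = (LINT \<zeta>|quad_measure \<mu> x. poisson_kernel z \<zeta>)"

context
  fixes \<mu> :: "complex set \<Rightarrow> 'a::chilbert_space \<Rightarrow> 'a"
  assumes \<mu>: "semi_spectral_measure \<mu>"
begin

lemma norm_poisson_kernel_le:
  "z \<in> disc \<Longrightarrow> \<forall>\<zeta>\<in>circle. norm (complex_of_real (poisson_kernel z \<zeta>)) \<le> 1 / (1 - norm z)\<^sup>2"
  using poisson_kernel_bounds[of z] by simp

lemma poisson_quad_zero [simp]: "poisson_quad \<mu> z 0 = 0"
proof -
  have "emeasure (quad_measure \<mu> 0) circle = 0"
    using emeasure_quad_measure[OF \<mu> sets.top, of 0] by (simp add: space_circle_borel)
  then have "AE \<zeta> in quad_measure \<mu> 0. poisson_kernel z \<zeta> = 0"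
    by (intro AE_I[of _ _ circle]) (use sets.top[of circle_borel] in \<open>auto simp: space_circle_borel\<close>)
  then show ?thesis unfolding poisson_quad_def by (rule integral_eq_zero_AE)
qed

lemma poisson_quad_nonneg: "z \<in> disc \<Longrightarrow> 0 \<le> poisson_quad \<mu> z x"
  unfolding poisson_quad_def by (rule Bochner_Integration.integral_nonneg) (use poisson_kernel_bounds in auto)

lemma poisson_quad_le:
  obtains C where "0 \<le> C" "\<And>z x. z \<in> disc \<Longrightarrow> poisson_quad \<mu> z x \<le> C / (1 - norm z)\<^sup>2 * (norm x)\<^sup>2"
proof -
  obtain C where C: "0 \<le> C" "\<And>x. measure (quad_measure \<mu> x) circle \<le> C * (norm x)\<^sup>2"
    using measure_quad_measure_le[OF \<mu>] by metis
  have "poisson_quad \<mu> z x \<le> C / (1 - norm z)\<^sup>2 * (norm x)\<^sup>2" if z: "z \<in> disc" for z x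
  proof -
    interpret finite_measure "quad_measure \<mu> x" by (rule finite_measure_quad_measure[OF \<mu>])
    have "poisson_quad \<mu> z x \<le> (LINT \<zeta>|quad_measure \<mu> x. 1 / (1 - norm z)\<^sup>2)"
      unfolding poisson_quad_def
    proof (rule integral_mono)
      show "integrable (quad_measure \<mu> x) (poisson_kernel z)"
        by (rule integrable_quad_measure[OF \<mu>, where G = "1 / (1 - norm z)\<^sup>2"])
          (use poisson_kernel_bounds[OF z] in auto)
    qed (use poisson_kernel_bounds z in auto)
    also have "\<dots> \<le> 1 / (1 - norm z)\<^sup>2 * (C * (norm x)\<^sup>2)"
      using C(2)[of x] by (simp add: divide_right_mono)
    finally show ?thesis by (simp add: mult_ac)
  qed
  with C that show thesis by blast
qed

text \<open>The form \<open>\<integral> poisson_kernel z \<zeta> d\<langle>\<mu>(\<cdot>)x, y\<rangle>\<close> is bounded because the kernel is, so it is the form of a unique bounded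
  operator.\<close>

lemma poisson_integral:
  assumes z: "z \<in> disc"
  shows bounded_linear_poisson_integral: "bounded_linear (poisson_integral \<mu> z)"
    and sesquilinear_poisson_integral: "sesquilinear (\<lambda>x y. cinner (poisson_integral \<mu> z x) y)"
    and poisson_integral_quad: "cinner (poisson_integral \<mu> z x) x = of_real (poisson_quad \<mu> z x)"
proof -
  let ?g = "\<lambda>\<zeta>. complex_of_real (poisson_kernel z \<zeta>)"
  have g: "?g \<in> borel_measurable borel" by measurable
  note sesq = sesquilinear_spectral_form[OF \<mu> g norm_poisson_kernel_le[OF z]]
    and diag = spectral_form_diag[OF \<mu> g norm_poisson_kernel_le[OF z]]
    and cmi = complex_measure_integral_spectral[OF \<mu> g norm_poisson_kernel_le[OF z]]
  have dq: "spectral_form \<mu> ?g x x = of_real (poisson_quad \<mu> z x)" for x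
    unfolding diag poisson_quad_def
    by (intro integral_of_real integrable_quad_measure[OF \<mu>, where G = "1 / (1 - norm z)\<^sup>2"])
      (use poisson_kernel_bounds[OF z] in auto)
  obtain C where C: "\<And>x. poisson_quad \<mu> z x \<le> C / (1 - norm z)\<^sup>2 * (norm x)\<^sup>2"
    using poisson_quad_le z by metis
  have "norm (spectral_form \<mu> ?g x y) \<le> (4 * (C / (1 - norm z)\<^sup>2)) * norm x * norm y" for x y
    by (rule sesquilinear_bound[OF sesq]) (simp only: dq norm_of_real abs_of_nonneg[OF poisson_quad_nonneg[OF z]] C)
  from theI'[OF ex_operator_of_form[OF sesq this]]
  have T: "bounded_clinear (poisson_integral \<mu> z) \<and>
      (\<forall>x y. cinner (poisson_integral \<mu> z x) y = spectral_form \<mu> ?g x y)"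
    unfolding poisson_integral_def cmi .
  then show "bounded_linear (poisson_integral \<mu> z)" by (simp add: bounded_clinear_def)
  have P: "cinner (poisson_integral \<mu> z x) y = spectral_form \<mu> ?g x y" for x y
    using T by blast
  show "sesquilinear (\<lambda>x y. cinner (poisson_integral \<mu> z x) y)" using sesq by (simp only: P)
  show "cinner (poisson_integral \<mu> z x) x = of_real (poisson_quad \<mu> z x)" by (simp only: P dq)
qed

lemma borel_measurable_poisson_quad [measurable]: "(\<lambda>z. poisson_quad \<mu> z x) \<in> borel_measurable borel"
  unfolding poisson_quad_def
  by (rule borel_measurable_poisson_integral[OF finite_measure_quad_measure[OF \<mu>] sets_quad_measure])

end

section \<open>Moments of area measure on the disc\<close>

lemma disc_borel [measurable, simp]: "disc \<in> sets borel"
  by (rule borel_open) simp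

lemma borel_measurable_cnj [measurable]: "cnj \<in> borel_measurable borel"
  by (intro borel_measurable_continuous_onI continuous_intros)

lemma distr_lborel_affine:
  fixes a :: "'a::euclidean_space"
  assumes "\<bar>r\<bar> = 1" shows "distr lborel borel (\<lambda>x. a + r *\<^sub>R x) = lborel"
  using lborel_affine[of r a] assms by (simp add: density_1)

lemma nn_integral_lborel_reflect:
  fixes a :: "'a::euclidean_space"
  assumes [measurable]: "f \<in> borel_measurable borel"
  shows "(\<integral>\<^sup>+x. f (a - x) \<partial>lborel) = integral\<^sup>N lborel f"
  using nn_integral_distr[of "\<lambda>x. a + (-1) *\<^sub>R x" lborel borel f] distr_lborel_affine[of "-1" a] by simp

lemma nn_integral_lborel_shift:
  fixes a :: "'a::euclidean_space"
  assumes [measurable]: "f \<in> borel_measurable borel"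
  shows "(\<integral>\<^sup>+x. f (x - a) \<partial>lborel) = integral\<^sup>N lborel f"
  using nn_integral_distr[of "\<lambda>x. - a + 1 *\<^sub>R x" lborel borel f] distr_lborel_affine[of 1 "- a"]
  by (simp add: add.commute[of "- a"])

text \<open>Rotation invariance of Lebesgue measure, by the argument for the uniqueness of Haar measure: the
  convolution of \<open>A\<close> with a disc is evaluated in two ways, and the disc is invariant
  under rotations.\<close>

lemma distr_lborel_rotation:
  fixes c :: complex
  assumes c: "norm c = 1" shows "distr lborel borel (\<lambda>z. c * z) = lborel"
proof (rule measure_eqI)
  fix A assume "A \<in> sets (distr lborel borel (\<lambda>z. c * z))"
  then have A [measurable]: "A \<in> sets borel" by simp
  let ?D = "ball 0 1 :: complex set"
  let ?a = "indicator A :: complex \<Rightarrow> ennreal" and ?d = "indicator ?D :: complex \<Rightarrow> ennreal"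
  define K where "K = emeasure lborel ?D"
  have K: "K \<noteq> 0" "K \<noteq> \<infinity>"
    by (simp_all add: K_def emeasure_ball unit_ball_vol_2 emeasure_lborel_ball_finite less_top[symmetric])
  have cc: "c * (cnj c * y) = y" for y
    using c by (simp add: complex_norm_square[symmetric] mult.assoc[symmetric])
  have "emeasure (distr lborel borel (\<lambda>z. c * z)) A * K = (\<integral>\<^sup>+x. ?a (c * x) * K \<partial>lborel)"
  proof -
    have "emeasure (distr lborel borel (\<lambda>z. c * z)) A = (\<integral>\<^sup>+x. ?a (c * x) \<partial>lborel)"
      by (subst nn_integral_distr[of "\<lambda>z. c * z" lborel borel ?a, symmetric]) simp_all
    then show ?thesis by (simp add: nn_integral_multc)
  qed
  also have "\<dots> = (\<integral>\<^sup>+x. \<integral>\<^sup>+y. ?a (c * x) * ?d (y - c * x) \<partial>lborel \<partial>lborel)"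
  proof (rule nn_integral_cong)
    fix x
    have "(\<integral>\<^sup>+y. ?a (c * x) * ?d (y - c * x) \<partial>lborel) = ?a (c * x) * (\<integral>\<^sup>+y. ?d (y - c * x) \<partial>lborel)"
      using measurable_compose[of "\<lambda>y. y - c * x" borel borel ?d borel]
      by (intro nn_integral_cmult) (simp add: borel_measurable_indicator)
    also have "(\<integral>\<^sup>+y. ?d (y - c * x) \<partial>lborel) = K"
      using nn_integral_lborel_shift[of ?d "c * x"] by (simp add: K_def borel_measurable_indicator)
    finally show "?a (c * x) * K = (\<integral>\<^sup>+y. ?a (c * x) * ?d (y - c * x) \<partial>lborel)" ..
  qed
  also have "\<dots> = (\<integral>\<^sup>+y. \<integral>\<^sup>+x. ?a (c * x) * ?d (y - c * x) \<partial>lborel \<partial>lborel)"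
    by (rule lborel_pair.Fubini'[symmetric]) measurable
  also have "\<dots> = (\<integral>\<^sup>+y. \<integral>\<^sup>+x. ?a (y - c * x) * ?d (c * x) \<partial>lborel \<partial>lborel)"
  proof (rule nn_integral_cong)
    fix y
    have "(\<integral>\<^sup>+x. ?a (c * x) * ?d (y - c * x) \<partial>lborel) =
        (\<integral>\<^sup>+x. ?a (c * (cnj c * y - x)) * ?d (y - c * (cnj c * y - x)) \<partial>lborel)"
      by (rule nn_integral_lborel_reflect[symmetric]) measurable
    then show "(\<integral>\<^sup>+x. ?a (c * x) * ?d (y - c * x) \<partial>lborel) = (\<integral>\<^sup>+x. ?a (y - c * x) * ?d (c * x) \<partial>lborel)"
      by (simp add: right_diff_distrib cc)
  qed
  also have "\<dots> = (\<integral>\<^sup>+x. \<integral>\<^sup>+y. ?a (y - c * x) * ?d (c * x) \<partial>lborel \<partial>lborel)"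
    by (rule lborel_pair.Fubini') measurable
  also have "\<dots> = (\<integral>\<^sup>+x. emeasure lborel A * ?d x \<partial>lborel)"
  proof (intro nn_integral_cong)
    fix x
    have "?d (c * x) = ?d x" using c by (simp add: indicator_def norm_mult)
    then show "(\<integral>\<^sup>+y. ?a (y - c * x) * ?d (c * x) \<partial>lborel) = emeasure lborel A * ?d x"
      by (simp add: nn_integral_multc nn_integral_lborel_shift[of ?a])
  qed
  also have "\<dots> = emeasure lborel A * K" by (simp add: nn_integral_cmult K_def)
  finally have "emeasure (distr lborel borel (\<lambda>z. c * z)) A * K / K = emeasure lborel A * K / K" by simp
  then show "emeasure (distr lborel borel (\<lambda>z. c * z)) A = emeasure lborel A"
    using K by (simp add: mult_divide_eq_ennreal)
qed simp

abbreviation disc_measure :: "complex measure" where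
  "disc_measure \<equiv> uniform_measure lborel disc"

abbreviation unit_interval_measure :: "real measure" where
  "unit_interval_measure \<equiv> uniform_measure lborel {0..1}"

lemma emeasure_disc: "emeasure lborel disc = ennreal pi"
  by (simp add: emeasure_ball unit_ball_vol_2)

lemma prob_space_disc_measure: "emeasure disc_measure (space disc_measure) = 1"
  by (simp add: emeasure_disc divide_ennreal)

lemma finite_measure_disc_measure: "finite_measure disc_measure"
  by (rule finite_measureI) (simp add: emeasure_disc divide_ennreal)

lemma AE_disc_measure: "AE z in disc_measure. z \<in> disc"
  by (rule AE_uniform_measureI) auto

lemma AE_unit_interval: "AE t in unit_interval_measure. t \<in> {0..1}"
  by (rule AE_uniform_measureI) auto

lemma distr_disc_measure_rotation:
  assumes c: "norm c = 1" shows "distr disc_measure borel (\<lambda>z. c * z) = disc_measure"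
proof (rule measure_eqI)
  fix A assume "A \<in> sets (distr disc_measure borel (\<lambda>z. c * z))"
  then have A [measurable]: "A \<in> sets borel" by simp
  have "emeasure (distr disc_measure borel (\<lambda>z. c * z)) A = emeasure lborel (disc \<inter> (\<lambda>z. c * z) -` A) / emeasure lborel disc"
    by (simp add: emeasure_distr measurable_sets_borel[of _ borel])
  also have "disc \<inter> (\<lambda>z. c * z) -` A = (\<lambda>z. c * z) -` (disc \<inter> A)"
    using c by (auto simp: norm_mult)
  also have "emeasure lborel \<dots> = emeasure (distr lborel borel (\<lambda>z. c * z)) (disc \<inter> A)"
    by (simp add: emeasure_distr)
  finally show "emeasure (distr disc_measure borel (\<lambda>z. c * z)) A = emeasure disc_measure A"
    by (simp add: distr_lborel_rotation[OF c])
qed simp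

text \<open>The area of a disc is proportional to the square of its radius.\<close>

lemma distr_disc_measure_norm_square:
  "distr disc_measure borel (\<lambda>z. (norm z)\<^sup>2) = unit_interval_measure"
proof (rule measure_eqI_lessThan)
  fix x :: real
  have "emeasure (distr disc_measure borel (\<lambda>z. (norm z)\<^sup>2)) {x<..} =
      emeasure lborel (disc \<inter> {z. x < (norm z)\<^sup>2}) / ennreal pi"
  proof -
    have [measurable]: "{z::complex. x < (norm z)\<^sup>2} \<in> sets borel" by measurable
    show ?thesis by (simp add: emeasure_distr emeasure_disc vimage_def greaterThan_def)
  qed
  also have "\<dots> = emeasure unit_interval_measure {x<..}"
  proof -
    consider "x < 0" | "0 \<le> x" "x < 1" | "1 \<le> x" by linarith
    then show ?thesis
    proof cases
      case 1
      then have "disc \<inter> {z. x < (norm z)\<^sup>2} = disc" by (auto intro: less_le_trans)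
      moreover have "{0..1} \<inter> {x<..} = {0..1}" using 1 by auto
      ultimately show ?thesis by (simp add: emeasure_disc divide_ennreal)
    next
      case 2
      have eq: "disc \<inter> {z. x < (norm z)\<^sup>2} = disc - cball (0::complex) (sqrt x)"
      proof -
        have "x < (norm z)\<^sup>2 \<longleftrightarrow> \<not> norm z \<le> sqrt x" for z :: complex
          using real_sqrt_less_iff[of x "(norm z)\<^sup>2"] by (simp add: not_le)
        then show ?thesis by (simp add: set_eq_iff)
      qed
      have sub: "cball (0::complex) (sqrt x) \<subseteq> disc" using 2 real_sqrt_lt_1_iff[THEN iffD2, of x] by (auto simp del: real_sqrt_lt_1_iff)
      have "emeasure lborel (disc - cball (0::complex) (sqrt x)) / ennreal pi = (ennreal pi - ennreal (pi * x)) / ennreal pi"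
        using 2 by (subst emeasure_Diff[OF _ _ _ sub])
          (auto simp: emeasure_disc emeasure_cball unit_ball_vol_2 top_unique)
      also have "ennreal pi - ennreal (pi * x) = ennreal (pi * (1 - x))" using 2 by (simp add: ennreal_minus algebra_simps)
      also have "\<dots> / ennreal pi = ennreal (1 - x)"
        using divide_ennreal[of "pi * (1 - x)" pi] 2 by simp
      finally have L: "emeasure lborel (disc - cball (0::complex) (sqrt x)) / ennreal pi = ennreal (1 - x)" .
      have "{0..1} \<inter> {x<..} = {x<..1}" using 2 by auto
      then have "emeasure unit_interval_measure {x<..} = ennreal (1 - x) / ennreal 1"
        using 2 by (simp del: ennreal_1)
      also have "\<dots> = ennreal (1 - x)" using divide_ennreal[of "1 - x" 1] 2 by (simp del: ennreal_1)
      finally show ?thesis unfolding eq L ..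
    next
      case 3
      have "disc \<inter> {z. x < (norm z)\<^sup>2} = {}"
      proof -
        have "\<not> x < (norm z)\<^sup>2" if "z \<in> disc" for z :: complex
          using that 3 power_le_one[of "norm z" 2] by auto
        then show ?thesis by blast
      qed
      moreover have "{0..1} \<inter> {x<..} = {}" using 3 by auto
      ultimately show ?thesis by simp
    qed
  qed
  finally show "emeasure (distr disc_measure borel (\<lambda>z. (norm z)\<^sup>2)) {x<..} = emeasure unit_interval_measure {x<..}" .
  interpret finite_measure "distr disc_measure borel (\<lambda>z. (norm z)\<^sup>2)"
    by (rule finite_measure.finite_measure_distr[OF finite_measure_disc_measure]) measurable
  show "emeasure (distr disc_measure borel (\<lambda>z. (norm z)\<^sup>2)) {x<..} < \<infinity>"
    unfolding infinity_ennreal_def less_top[symmetric] by (rule emeasure_finite[unfolded infinity_ennreal_def])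
qed auto

text \<open>Radial weights are functions of \<open>(norm z)\<^sup>2\<close>, whose distribution is uniform.\<close>

definition weight_moment :: "(real \<Rightarrow> real) \<Rightarrow> nat \<Rightarrow> real" where
  "weight_moment w k = (LINT t|unit_interval_measure. t ^ k * w t)"

text \<open>Rotation invariance kills the mixed moments.\<close>

lemma disc_moment:
  assumes [measurable]: "w \<in> borel_measurable borel"
  shows "(LINT z|disc_measure. z ^ a * cnj z ^ b * of_real (w ((norm z)\<^sup>2))) =
    (if a = b then of_real (weight_moment w a) else 0)"
proof (cases "a = b")
  case True
  have "z ^ a * cnj z ^ a * of_real (w ((norm z)\<^sup>2)) = complex_of_real (((norm z)\<^sup>2) ^ a * w ((norm z)\<^sup>2))" for z
    by (simp only: power_mult_distrib[symmetric] complex_norm_square[symmetric] of_real_mult of_real_power)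
  then have "(LINT z|disc_measure. z ^ a * cnj z ^ b * of_real (w ((norm z)\<^sup>2))) =
      of_real (LINT z|disc_measure. ((norm z)\<^sup>2) ^ a * w ((norm z)\<^sup>2))"
    unfolding True[symmetric] by (simp only: integral_complex_of_real)
  also have "(LINT z|disc_measure. ((norm z)\<^sup>2) ^ a * w ((norm z)\<^sup>2)) =
      (LINT t|distr disc_measure borel (\<lambda>z. (norm z)\<^sup>2). t ^ a * w t)"
    by (rule integral_distr[symmetric]) measurable
  finally show ?thesis using True by (simp add: distr_disc_measure_norm_square weight_moment_def)
next
  case False
  \<comment> \<open>The rotation by \<open>c\<close> multiplies the integrand by \<open>-1\<close>.\<close>
  define c where "c = cis (pi / (real a - real b))"
  let ?f = "\<lambda>z. z ^ a * cnj z ^ b * of_real (w ((norm z)\<^sup>2)) :: complex"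
  have nc: "norm c = 1" by (simp add: c_def)
  have pw: "cis t ^ n = cis (real n * t)" for t n by (rule Complex.DeMoivre)
  have "cnj c = cis (- (pi / (real a - real b)))" by (simp add: c_def cis_cnj)
  then have "c ^ a * cnj c ^ b = cis (real a * (pi / (real a - real b)) + real b * (- (pi / (real a - real b))))"
    by (simp only: c_def pw cis_mult)
  also have "real a * (pi / (real a - real b)) + real b * (- (pi / (real a - real b))) =
      (real a - real b) * (pi / (real a - real b))" by (simp only: left_diff_distrib)
  also have "\<dots> = pi" using False by simp
  finally have c: "c ^ a * cnj c ^ b = -1" by simp
  have "integral\<^sup>L disc_measure ?f = integral\<^sup>L (distr disc_measure borel (\<lambda>z. c * z)) ?f"
    by (simp only: distr_disc_measure_rotation[OF nc])
  also have "\<dots> = (LINT z|disc_measure. ?f (c * z))" by (rule integral_distr) measurable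
  also have "\<dots> = (LINT z|disc_measure. (c ^ a * cnj c ^ b) * ?f z)"
    using nc by (simp add: power_mult_distrib norm_mult mult_ac)
  finally show ?thesis using False by (simp add: c)
qed

section \<open>Moments of Poisson integrals\<close>

text \<open>With \<open>s = z * cnj \<zeta>\<close> the kernel equals \<open>1 / (1 - s) + 1 / (1 - cnj s) - 1\<close>, a sum of two geometric series; the
  case distinction at \<open>j = 0\<close> avoids counting the constant term twice.\<close>

lemma poisson_kernel_sums:
  assumes z: "z \<in> disc" and \<zeta>: "\<zeta> \<in> circle"
  shows "(\<lambda>j. z ^ j * cnj \<zeta> ^ j + cnj z ^ j * \<zeta> ^ j - (if j = 0 then 1 else 0)) sums of_real (poisson_kernel z \<zeta>)"
proof -
  define s where "s = z * cnj \<zeta>"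
  have ns: "norm s < 1" using z \<zeta> by (simp add: s_def norm_mult)
  have "(\<lambda>j. s ^ j + cnj s ^ j - (if j = 0 then 1 else 0)) sums (1 / (1 - s) + 1 / (1 - cnj s) - 1)"
    using ns by (intro sums_add sums_diff geometric_sums sums_single[of 0 "\<lambda>_. 1"]) auto
  moreover have "1 / (1 - s) + 1 / (1 - cnj s) - 1 = of_real (poisson_kernel z \<zeta>)"
  proof -
    have one: "cnj \<zeta> * \<zeta> = 1" using \<zeta> complex_norm_square[of \<zeta>] by (simp add: mult.commute)
    have ne: "1 - s \<noteq> 0" "1 - cnj s \<noteq> 0" using ns by auto
    have "1 / (1 - s) + 1 / (1 - cnj s) - 1 = (1 - s * cnj s) / ((1 - s) * (1 - cnj s))"
      using ne by (simp add: divide_simps) (simp add: algebra_simps)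
    also have "s * cnj s = of_real ((norm z)\<^sup>2)"
      using \<zeta> by (simp add: s_def complex_norm_square[symmetric] norm_mult del: complex_cnj_mult)
    also have "(1 - s) * (1 - cnj s) = of_real ((norm (z - \<zeta>))\<^sup>2)"
    proof -
      have "(norm (1 - s)) = norm (cnj \<zeta> * (\<zeta> - z))"
        by (simp add: right_diff_distrib one s_def mult.commute[of z])
      also have "\<dots> = norm (z - \<zeta>)" using \<zeta> by (simp add: norm_mult norm_minus_commute)
      finally show ?thesis using complex_norm_square[of "1 - s"] by simp
    qed
    finally show ?thesis by (simp add: poisson_kernel_def)
  qed
  ultimately show ?thesis by (simp add: s_def power_mult_distrib)
qed

lemma poisson_integral_sums:
  assumes m: "finite_measure m" "sets m = sets circle_borel" and z: "z \<in> disc"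
  defines "C \<equiv> \<lambda>j. LINT \<zeta>|m. \<zeta> ^ j"
  shows "(\<lambda>j. z ^ j * cnj (C j) + cnj z ^ j * C j - (if j = 0 then C 0 else 0))
    sums of_real (LINT \<zeta>|m. poisson_kernel z \<zeta>)"
proof -
  interpret finite_measure m by fact
  have sp: "space m = circle" using sets_eq_imp_space_eq[OF m(2)] by (simp add: space_circle_borel)
  note [measurable] = measurable_ident_circle[OF m(2)]
  have ip: "integrable m (\<lambda>\<zeta>. \<zeta> ^ j)" for j
    by (rule integrable_const_bound[where B = 1]) (auto simp: sp norm_power)
  have ic: "integrable m (\<lambda>\<zeta>. cnj \<zeta> ^ j)" for j
    by (rule integrable_const_bound[where B = 1]) (auto simp: sp norm_power)
  define f where "f j \<zeta> = z ^ j * cnj \<zeta> ^ j + cnj z ^ j * \<zeta> ^ j - (if j = 0 then 1 else 0)" for j \<zeta>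
  have fi: "integrable m (f j)" for j
    unfolding f_def by (intro Bochner_Integration.integrable_diff Bochner_Integration.integrable_add
        integrable_mult_right ip ic) simp
  have fb: "norm (f j \<zeta>) \<le> 3 * norm z ^ j" if "\<zeta> \<in> circle" for j \<zeta>
  proof -
    have "norm (f j \<zeta>) \<le> norm (z ^ j * cnj \<zeta> ^ j) + norm (cnj z ^ j * \<zeta> ^ j) + norm (if j = 0 then 1 else 0 :: complex)"
      unfolding f_def by (rule order_trans[OF norm_triangle_ineq4]) (simp add: norm_triangle_ineq)
    also have "\<dots> \<le> 3 * norm z ^ j" using that by (simp add: norm_mult norm_power)
    finally show ?thesis .
  qed
  have gs: "summable (\<lambda>j. 3 * norm z ^ j)" using z by (intro summable_mult summable_geometric) simp
  have "(\<lambda>j. integral\<^sup>L m (f j)) sums (LINT \<zeta>|m. (\<Sum>j. f j \<zeta>))"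
  proof (rule sums_integral[OF fi])
    show "AE \<zeta> in m. summable (\<lambda>j. norm (f j \<zeta>))"
      by (rule AE_I2, rule summable_comparison_test'[OF gs]) (use fb sp in auto)
    show "summable (\<lambda>j. LINT \<zeta>|m. norm (f j \<zeta>))"
    proof (rule summable_comparison_test'[where N = 0])
      show "summable (\<lambda>j. measure m circle * (3 * norm z ^ j))" by (rule summable_mult[OF gs])
      fix j
      have "(LINT \<zeta>|m. norm (f j \<zeta>)) \<le> (LINT \<zeta>|m. 3 * norm z ^ j)"
        by (rule integral_mono) (use fi fb sp in auto)
      then show "norm (LINT \<zeta>|m. norm (f j \<zeta>)) \<le> measure m circle * (3 * norm z ^ j)"
        by (simp add: sp)
    qed
  qed
  also have "(LINT \<zeta>|m. (\<Sum>j. f j \<zeta>)) = (LINT \<zeta>|m. of_real (poisson_kernel z \<zeta>))"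
    by (rule Bochner_Integration.integral_cong) (use poisson_kernel_sums[OF z, THEN sums_unique, symmetric] sp in \<open>auto simp: f_def\<close>)
  also have "\<dots> = of_real (LINT \<zeta>|m. poisson_kernel z \<zeta>)"
  proof (rule integral_of_real, rule integrable_const_bound[where B = "1 / (1 - norm z)\<^sup>2"])
    show "poisson_kernel z \<in> borel_measurable m" unfolding poisson_kernel_def by measurable
  qed (use poisson_kernel_bounds[OF z] sp in auto)
  finally have sums: "(\<lambda>j. integral\<^sup>L m (f j)) sums of_real (LINT \<zeta>|m. poisson_kernel z \<zeta>)" .
  have "integral\<^sup>L m (f j) = z ^ j * cnj (C j) + cnj z ^ j * C j - (if j = 0 then C 0 else 0)" for j
  proof -
    have "(LINT \<zeta>|m. cnj \<zeta> ^ j) = cnj (C j)"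
      unfolding C_def by (simp only: complex_cnj_power[symmetric] Bochner_Integration.integral_cnj)
    then show ?thesis unfolding f_def
      using ip ic by (auto simp: C_def)
  qed
  with sums show ?thesis by simp
qed

lemma circle_integral_monomial:
  assumes sp: "space m = circle"
  shows "(LINT \<zeta>|m. \<zeta> ^ a * cnj \<zeta> ^ b) =
    (if b \<le> a then LINT \<zeta>|m. \<zeta> ^ (a - b) else cnj (LINT \<zeta>|m. \<zeta> ^ (b - a)))"
proof -
  have one: "\<zeta> ^ k * cnj \<zeta> ^ k = 1" if "\<zeta> \<in> circle" for \<zeta> k
    using that complex_norm_square[of \<zeta>] by (simp add: power_mult_distrib[symmetric])
  show ?thesis
  proof (cases "b \<le> a")
    case True
    then obtain d where d: "a = d + b" by (metis add.commute le_Suc_ex)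
    show ?thesis unfolding d
      by (simp, intro Bochner_Integration.integral_cong) (auto simp: sp power_add mult.assoc one)
  next
    case False
    then obtain d where d: "b = a + d" by (metis le_Suc_ex nat_le_linear)
    have "cnj (LINT \<zeta>|m. \<zeta> ^ d) = (LINT \<zeta>|m. cnj \<zeta> ^ d)" by (simp only: complex_cnj_power[symmetric] Bochner_Integration.integral_cnj)
    also have "\<dots> = (LINT \<zeta>|m. \<zeta> ^ a * cnj \<zeta> ^ (a + d))"
      by (intro Bochner_Integration.integral_cong) (auto simp: sp power_add mult.assoc[symmetric] one)
    finally show ?thesis using False d by simp
  qed
qed

text \<open>Because \<open>z\<^sup>a * cnj z\<^sup>b\<close> is orthogonal under radial weights to all but one term of the
  expansion of the Poisson kernel, its integral against a Poisson integral is one Fourier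
  coefficient of the boundary measure.\<close>

lemma poisson_disc_moment:
  assumes m: "finite_measure m" "sets m = sets circle_borel"
    and w [measurable]: "w \<in> borel_measurable borel" and wb: "\<And>t. 0 \<le> t \<Longrightarrow> \<bar>w t\<bar> \<le> W"
    and q: "0 \<le> q" "q < 1" "\<And>t. q < t \<Longrightarrow> w t = 0"
  shows "(LINT z|disc_measure. z ^ a * cnj z ^ b * of_real ((LINT \<zeta>|m. poisson_kernel z \<zeta>) * w ((norm z)\<^sup>2))) =
    (LINT \<zeta>|m. \<zeta> ^ a * cnj \<zeta> ^ b) * of_real (weight_moment w (max a b))"
proof -
  interpret finite_measure m by fact
  have sp: "space m = circle" using sets_eq_imp_space_eq[OF m(2)] by (simp add: space_circle_borel)
  interpret u: finite_measure disc_measure by (rule finite_measure_disc_measure)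
  define C where "C j = (LINT \<zeta>|m. \<zeta> ^ j)" for j :: nat
  define c0 where "c0 = measure m circle"
  have Cb: "norm (C j) \<le> c0" for j
  proof -
    note [measurable] = measurable_ident_circle[OF m(2)]
    have "norm (C j) \<le> (LINT \<zeta>|m. norm (\<zeta> ^ j))" unfolding C_def by (rule integral_norm_bound)
    also have "\<dots> = (LINT \<zeta>|m. 1)"
      by (rule Bochner_Integration.integral_cong) (auto simp: sp norm_power)
    finally show ?thesis by (simp add: c0_def sp)
  qed
  have W0: "0 \<le> W" using wb[of 0] by simp
  have c00: "0 \<le> c0" by (simp add: c0_def)
  define r where "r = sqrt q"
  have r: "0 \<le> r" "r < 1" using q by (auto simp: r_def)
  define T where "T j z = z ^ j * cnj (C j) + cnj z ^ j * C j - (if j = 0 then C 0 else 0)" for j z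
  define h where "h j z = z ^ a * cnj z ^ b * of_real (w ((norm z)\<^sup>2)) * T j z" for j z
  have hm [measurable]: "h j \<in> borel_measurable borel" for j
    unfolding h_def T_def by measurable
  have hb: "norm (h j z) \<le> W * (3 * c0 * r ^ j)" if z: "z \<in> disc" for j z
  proof (cases "q < (norm z)\<^sup>2")
    case True
    then show ?thesis using q W0 c00 r by (simp add: h_def)
  next
    case False
    have zr: "norm z \<le> r" using False real_le_rsqrt by (simp add: r_def)
    have z1: "norm z \<le> 1" using z by simp
    have "norm (T j z) \<le> norm (z ^ j * cnj (C j)) + norm (cnj z ^ j * C j) + norm (if j = 0 then C 0 else 0)"
      unfolding T_def by (rule order_trans[OF norm_triangle_ineq4]) (simp add: norm_triangle_ineq)
    also have "\<dots> \<le> r ^ j * c0 + r ^ j * c0 + r ^ j * c0"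
      using zr r Cb c00 by (intro add_mono) (auto simp: norm_mult norm_power intro!: mult_mono power_mono)
    finally have T: "norm (T j z) \<le> 3 * c0 * r ^ j" by simp
    have "norm (z ^ a * cnj z ^ b * of_real (w ((norm z)\<^sup>2))) \<le> 1 * W"
      using z1 wb[of "(norm z)\<^sup>2"] W0
      by (simp only: norm_mult norm_power complex_mod_cnj norm_of_real)
        (intro mult_mono mult_le_one power_le_one, auto)
    then have "norm (h j z) \<le> (1 * W) * (3 * c0 * r ^ j)"
      unfolding h_def norm_mult[of _ "T j z"] using T W0 by (intro mult_mono) auto
    then show ?thesis by simp
  qed
  have hi: "integrable disc_measure (h j)" for j
    by (rule u.integrable_const_bound[where B = "W * (3 * c0 * r ^ j)"])
      (use hb AE_disc_measure in \<open>auto elim!: eventually_mono\<close>)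
  have gs: "summable (\<lambda>j. W * (3 * c0 * r ^ j))" using r by (intro summable_mult summable_geometric) simp
  have "(\<lambda>j. integral\<^sup>L disc_measure (h j)) sums (LINT z|disc_measure. (\<Sum>j. h j z))"
  proof (rule sums_integral[OF hi])
    show "AE z in disc_measure. summable (\<lambda>j. norm (h j z))"
      using AE_disc_measure
    proof eventually_elim
      case (elim z) show ?case
        by (rule summable_comparison_test'[OF gs]) (use hb[OF elim] in auto)
    qed
    show "summable (\<lambda>j. LINT z|disc_measure. norm (h j z))"
    proof (rule summable_comparison_test'[OF gs])
      fix j
      have "(LINT z|disc_measure. norm (h j z)) \<le> (LINT z|disc_measure. W * (3 * c0 * r ^ j))"
        by (rule integral_mono_AE) (use hi hb AE_disc_measure in \<open>auto elim!: eventually_mono\<close>)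
      also have "\<dots> = W * (3 * c0 * r ^ j)"
        using prob_space_disc_measure by (simp add: measure_def)
      finally show "norm (LINT z|disc_measure. norm (h j z)) \<le> W * (3 * c0 * r ^ j)" by simp
    qed
  qed
  also have "(LINT z|disc_measure. (\<Sum>j. h j z)) =
      (LINT z|disc_measure. z ^ a * cnj z ^ b * of_real ((LINT \<zeta>|m. poisson_kernel z \<zeta>) * w ((norm z)\<^sup>2)))"
  proof (rule integral_cong_AE)
    show "(\<lambda>z. z ^ a * cnj z ^ b * of_real ((LINT \<zeta>|m. poisson_kernel z \<zeta>) * w ((norm z)\<^sup>2))) \<in> borel_measurable disc_measure"
    proof -
      note [measurable] = borel_measurable_poisson_integral[OF m]
      show ?thesis by measurable
    qed
    show "AE z in disc_measure. (\<Sum>j. h j z) =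
        z ^ a * cnj z ^ b * of_real ((LINT \<zeta>|m. poisson_kernel z \<zeta>) * w ((norm z)\<^sup>2))"
      using AE_disc_measure
    proof eventually_elim
      case (elim z)
      have "(\<lambda>j. h j z) sums (z ^ a * cnj z ^ b * of_real (w ((norm z)\<^sup>2)) * of_real (LINT \<zeta>|m. poisson_kernel z \<zeta>))"
        unfolding h_def T_def C_def by (rule sums_mult[OF poisson_integral_sums[OF m elim]])
      then show ?case by (simp add: sums_unique[symmetric] mult_ac)
    qed
  qed measurable
  finally have sums: "(\<lambda>j. integral\<^sup>L disc_measure (h j)) sums
      (LINT z|disc_measure. z ^ a * cnj z ^ b * of_real ((LINT \<zeta>|m. poisson_kernel z \<zeta>) * w ((norm z)\<^sup>2)))" .
  have val: "integral\<^sup>L disc_measure (h j) =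
      (if a + j = b then of_real (weight_moment w b) else 0) * cnj (C j) +
      (if a = b + j then of_real (weight_moment w a) else 0) * C j -
      (if j = 0 then (if a = b then of_real (weight_moment w a) else 0) * C 0 else 0)" for j
  proof -
    let ?g = "\<lambda>a b z. z ^ a * cnj z ^ b * complex_of_real (w ((norm z)\<^sup>2))"
    have gi: "integrable disc_measure (?g a b)" for a b
    proof (rule u.integrable_const_bound[where B = W])
      show "AE z in disc_measure. norm (?g a b z) \<le> W"
        using AE_disc_measure
      proof eventually_elim
        case (elim z)
        then have "norm (?g a b z) \<le> 1 * W"
          using wb[of "(norm z)\<^sup>2"] W0
          by (simp only: norm_mult norm_power complex_mod_cnj norm_of_real)
            (intro mult_mono mult_le_one power_le_one, auto)
        then show ?case by simp
      qed
    qed measurable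
    have "h j = (\<lambda>z. ?g (a + j) b z * cnj (C j) + ?g a (b + j) z * C j - (if j = 0 then ?g a b z * C 0 else 0))"
      by (auto simp: fun_eq_iff h_def T_def power_add algebra_simps)
    then have "integral\<^sup>L disc_measure (h j) = integral\<^sup>L disc_measure (?g (a + j) b) * cnj (C j) +
        integral\<^sup>L disc_measure (?g a (b + j)) * C j - (if j = 0 then integral\<^sup>L disc_measure (?g a b) * C 0 else 0)"
      using gi by (cases "j = 0") simp_all
    then show ?thesis by (simp only: disc_moment[OF w]) auto
  qed
  have C0: "cnj (C 0) = C 0" by (simp add: C_def)
  have single: "integral\<^sup>L disc_measure (h j) =
      (if j = (if b \<le> a then a - b else b - a)
       then (\<lambda>j. of_real (weight_moment w (max a b)) * (if b \<le> a then C j else cnj (C j))) j else 0)" for j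
    unfolding val using C0 by (auto simp: max_def)
  have "(LINT z|disc_measure. z ^ a * cnj z ^ b * of_real ((LINT \<zeta>|m. poisson_kernel z \<zeta>) * w ((norm z)\<^sup>2))) =
      of_real (weight_moment w (max a b)) * (if b \<le> a then C (a - b) else cnj (C (b - a)))"
    using sums_unique2[OF sums sums_single[of "if b \<le> a then a - b else b - a"
        "\<lambda>j. of_real (weight_moment w (max a b)) * (if b \<le> a then C j else cnj (C j))", folded single]]
    by simp
  also have "(if b \<le> a then C (a - b) else cnj (C (b - a))) = (LINT \<zeta>|m. \<zeta> ^ a * cnj \<zeta> ^ b)"
    unfolding C_def by (rule circle_integral_monomial[OF sp, symmetric])
  finally show ?thesis by (simp add: mult.commute)
qed

section \<open>Vector-valued power series on the disc\<close>

definition disc_summable :: "(nat \<Rightarrow> 'a::chilbert_space) \<Rightarrow> bool" where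
  "disc_summable a \<longleftrightarrow> (\<forall>r. 0 \<le> r \<longrightarrow> r < 1 \<longrightarrow> summable (\<lambda>j. norm (a j) * r ^ j))"

definition disc_series :: "(nat \<Rightarrow> 'a::chilbert_space) \<Rightarrow> complex \<Rightarrow> 'a" where
  "disc_series a z = (if z \<in> disc then (\<Sum>j. z ^ j *\<^sub>C a j) else 0)"

definition coeff_deriv :: "(nat \<Rightarrow> 'a::chilbert_space) \<Rightarrow> nat \<Rightarrow> 'a" where
  "coeff_deriv a j = of_nat (Suc j) *\<^sub>C a (Suc j)"

definition coeff_shift :: "(nat \<Rightarrow> 'a::chilbert_space) \<Rightarrow> nat \<Rightarrow> 'a" where
  "coeff_shift a j = (case j of 0 \<Rightarrow> 0 | Suc i \<Rightarrow> a i)"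

lemma disc_summableD: "disc_summable a \<Longrightarrow> 0 \<le> r \<Longrightarrow> r < 1 \<Longrightarrow> summable (\<lambda>j. norm (a j) * r ^ j)"
  by (simp add: disc_summable_def)

lemma disc_series_summable:
  assumes "disc_summable a" "z \<in> disc"
  shows "summable (\<lambda>j. norm (z ^ j *\<^sub>C a j))" "(\<lambda>j. z ^ j *\<^sub>C a j) sums disc_series a z"
proof -
  show s: "summable (\<lambda>j. norm (z ^ j *\<^sub>C a j))"
    using disc_summableD[OF assms(1), of "norm z"] assms(2) by (simp add: norm_scaleC norm_power mult.commute)
  show "(\<lambda>j. z ^ j *\<^sub>C a j) sums disc_series a z"
    using summable_sums[OF summable_norm_cancel[OF s]] assms(2) by (simp add: disc_series_def)
qed

lemma disc_summable_bounded:
  assumes "\<And>j. norm (a j) \<le> K" shows "disc_summable a"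
  unfolding disc_summable_def
proof (intro allI impI)
  fix r :: real assume r: "0 \<le> r" "r < 1"
  have "summable (\<lambda>j. K * r ^ j)" using r by (intro summable_mult summable_geometric) simp
  then show "summable (\<lambda>j. norm (a j) * r ^ j)"
    by (rule summable_comparison_test'[where N = 0]) (use assms r in \<open>simp add: abs_mult mult_right_mono\<close>)
qed

lemma disc_summable_add: "disc_summable a \<Longrightarrow> disc_summable b \<Longrightarrow> disc_summable (a + b)"
  unfolding disc_summable_def
proof (intro allI impI)
  fix r :: real
  assume a: "\<forall>r. 0 \<le> r \<longrightarrow> r < 1 \<longrightarrow> summable (\<lambda>j. norm (a j) * r ^ j)"
    "\<forall>r. 0 \<le> r \<longrightarrow> r < 1 \<longrightarrow> summable (\<lambda>j. norm (b j) * r ^ j)" and r: "0 \<le> r" "r < 1"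
  then have "summable (\<lambda>j. norm (a j) * r ^ j + norm (b j) * r ^ j)" by (intro summable_add) auto
  then show "summable (\<lambda>j. norm ((a + b) j) * r ^ j)"
  proof (rule summable_comparison_test'[where N = 0])
    fix j
    have "norm (a j + b j) * r ^ j \<le> (norm (a j) + norm (b j)) * r ^ j"
      using r by (intro mult_right_mono norm_triangle_ineq) auto
    then show "norm (norm ((a + b) j) * r ^ j) \<le> norm (a j) * r ^ j + norm (b j) * r ^ j"
      using r by (simp add: distrib_right)
  qed
qed

lemma disc_summable_scaleC: "disc_summable a \<Longrightarrow> disc_summable (c *\<^sub>C a)"
  by (simp add: disc_summable_def scaleC_fun_def norm_scaleC mult.assoc summable_mult)

lemma disc_summable_deriv:
  assumes "disc_summable a" shows "disc_summable (coeff_deriv a)"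
  unfolding disc_summable_def
proof (intro allI impI)
  fix r :: real assume r: "0 \<le> r" "r < 1"
  define c where "c j = norm (a j)" for j
  have "summable (\<lambda>j. diffs c j * r ^ j)"
  proof (rule termdiff_converges[where K = 1])
    fix x :: real assume "norm x < 1"
    then have "summable (\<lambda>j. norm (a j) * \<bar>x\<bar> ^ j)" using disc_summableD[OF assms, of "\<bar>x\<bar>"] by simp
    then show "summable (\<lambda>j. c j * x ^ j)"
      by (intro summable_norm_cancel[of "\<lambda>j. c j * x ^ j"]) (simp add: c_def abs_mult power_abs)
  qed (use r in simp)
  then show "summable (\<lambda>j. norm (coeff_deriv a j) * r ^ j)"
    by (simp add: coeff_deriv_def diffs_def c_def norm_scaleC del: of_nat_Suc)
qed

lemma disc_summable_deriv_pow: "disc_summable a \<Longrightarrow> disc_summable ((coeff_deriv ^^ n) a)"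
  by (induction n) (auto intro: disc_summable_deriv)

lemma coeff_deriv_pow: "(coeff_deriv ^^ n) a j = of_real (fact (j + n) / fact j) *\<^sub>C a (j + n)"
proof (induction n arbitrary: j)
  case (Suc n)
  have "(coeff_deriv ^^ Suc n) a j = of_nat (Suc j) *\<^sub>C (coeff_deriv ^^ n) a (Suc j)"
    by (simp add: coeff_deriv_def[of "(coeff_deriv ^^ n) a"])
  also have "\<dots> = (of_nat (Suc j) * of_real (fact (Suc j + n) / fact (Suc j))) *\<^sub>C a (Suc j + n)"
    by (simp only: Suc scaleC_scaleC)
  also have "of_nat (Suc j) * of_real (fact (Suc j + n) / fact (Suc j)) = complex_of_real (fact (j + Suc n) / fact j)"
    by (simp add: fact_Suc[of j] del: fact_Suc of_nat_Suc)
  finally show ?case by simp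
qed simp

lemma has_cderiv_unique: "has_cderiv f d z \<Longrightarrow> has_cderiv f e z \<Longrightarrow> d = e"
  unfolding has_cderiv_def using has_derivative_unique[of f "\<lambda>h. h *\<^sub>C d" z "\<lambda>h. h *\<^sub>C e"]
  by (metis scaleC_one)

lemma cderiv_eqI: "has_cderiv f d z \<Longrightarrow> cderiv f z = d"
  unfolding cderiv_def using has_cderiv_unique by blast

lemma has_cderiv_cong:
  assumes "\<And>w. w \<in> disc \<Longrightarrow> f w = g w" "z \<in> disc" "has_cderiv g d z"
  shows "has_cderiv f d z"
  using has_derivative_transform_within_open[of g "\<lambda>h. h *\<^sub>C d" z UNIV disc f] assms
  by (simp add: has_cderiv_def)

text \<open>On a smaller disc the remainder is bounded independently of the point; this is the uniformity that
  termwise differentiation needs.\<close>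

lemma disc_series_tail:
  assumes "disc_summable b" "x \<in> disc" "norm x \<le> r" "r < 1"
  shows "norm (disc_series b x - (\<Sum>i<N. x ^ i *\<^sub>C b i)) \<le> (\<Sum>i. norm (b (i + N)) * r ^ (i + N))"
proof -
  note s = disc_series_summable[OF assms(1,2)]
  have r0: "0 \<le> r" using assms(3) norm_ge_zero[of x] by linarith
  note t = disc_summableD[OF assms(1) r0 assms(4)]
  have "disc_series b x - (\<Sum>i<N. x ^ i *\<^sub>C b i) = (\<Sum>i. x ^ (i + N) *\<^sub>C b (i + N))"
    using suminf_minus_initial_segment[OF sums_summable[OF s(2)], of N] sums_unique[OF s(2)] by simp
  also have "norm \<dots> \<le> (\<Sum>i. norm (x ^ (i + N) *\<^sub>C b (i + N)))"
    by (rule summable_norm) (use s(1) in \<open>simp add: summable_iff_shift[of "\<lambda>j. norm (x ^ j *\<^sub>C b j)"]\<close>)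
  also have "\<dots> \<le> (\<Sum>i. norm (b (i + N)) * r ^ (i + N))"
  proof (rule suminf_le)
    show "norm (x ^ (i + N) *\<^sub>C b (i + N)) \<le> norm (b (i + N)) * r ^ (i + N)" for i
      using power_mono[OF assms(3), of "i + N"]
      by (simp add: norm_scaleC norm_power mult.commute[of "norm x ^ (i + N)"] mult_left_mono)
    show "summable (\<lambda>i. norm (x ^ (i + N) *\<^sub>C b (i + N)))"
      using s(1) by (simp add: summable_iff_shift[of "\<lambda>j. norm (x ^ j *\<^sub>C b j)"])
    show "summable (\<lambda>i. norm (b (i + N)) * r ^ (i + N))"
      using t by (simp add: summable_iff_shift[of "\<lambda>j. norm (b j) * r ^ j"])
  qed
  finally show ?thesis .
qed

lemma has_cderiv_disc_series:
  assumes a: "disc_summable a" and z: "z \<in> disc"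
  shows "has_cderiv (disc_series a) (disc_series (coeff_deriv a) z) z"
proof -
  \<comment> \<open>A smaller disc that still contains \<open>z\<close> in its interior.\<close>
  define r where "r = (1 + norm z) / 2"
  have r: "norm z < r" "r < 1" "0 \<le> r" using z by (auto simp: r_def)
  have sub: "ball 0 r \<subseteq> disc" using r by auto
  note b = disc_summable_deriv[OF a]
  let ?f' = "\<lambda>n x h. (of_nat n * x ^ (n - 1) * h) *\<^sub>C a n"
  have "\<exists>g. \<forall>x\<in>ball 0 r. (\<lambda>n. x ^ n *\<^sub>C a n) sums g x \<and>
      (g has_derivative (\<lambda>h. h *\<^sub>C disc_series (coeff_deriv a) x)) (at x within ball 0 r)"
  proof (rule has_derivative_series)
    show "((\<lambda>x. x ^ n *\<^sub>C a n) has_derivative ?f' n x) (at x within ball 0 r)" for n x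
    proof -
      have "((\<lambda>x::complex. x ^ n) has_derivative (\<lambda>h. of_nat n * x ^ (n - 1) * h)) (at x within ball 0 r)"
        by (rule has_derivative_eq_rhs, rule has_derivative_power[OF has_derivative_ident]) (auto simp: mult_ac)
      then show ?thesis
        by (rule bounded_linear.has_derivative[OF bounded_bilinear.bounded_linear_left[OF bounded_bilinear_scaleC]])
    qed
    fix e :: real assume e: "0 < e"
    have "(\<lambda>N. \<Sum>i. norm (coeff_deriv a (i + N)) * r ^ (i + N)) \<longlonglongrightarrow> 0"
      by (rule suminf_exist_split2[OF disc_summableD[OF b r(3,2)]])
    then have "\<forall>\<^sub>F N in sequentially. (\<Sum>i. norm (coeff_deriv a (i + N)) * r ^ (i + N)) < e"
      using e by (rule order_tendstoD)
    then have "\<forall>\<^sub>F N in sequentially. \<forall>x\<in>ball 0 r. \<forall>h.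
        norm ((\<Sum>i<Suc N. ?f' i x h) - h *\<^sub>C disc_series (coeff_deriv a) x) \<le> e * norm h"
    proof eventually_elim
      case (elim N)
      show ?case
      proof (intro ballI allI)
        fix x h assume x: "x \<in> ball (0::complex) r"
        have "(\<Sum>i<Suc N. ?f' i x h) = (\<Sum>i<N. ?f' (Suc i) x h)"
          by (subst sum.lessThan_Suc_shift) simp
        also have "\<dots> = h *\<^sub>C (\<Sum>i<N. x ^ i *\<^sub>C coeff_deriv a i)"
          by (simp only: bounded_bilinear.sum_right[OF bounded_bilinear_scaleC])
            (simp add: coeff_deriv_def scaleC_scaleC mult_ac)
        finally have "(\<Sum>i<Suc N. ?f' i x h) - h *\<^sub>C disc_series (coeff_deriv a) x =
            - (h *\<^sub>C (disc_series (coeff_deriv a) x - (\<Sum>i<N. x ^ i *\<^sub>C coeff_deriv a i)))"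
          by (simp add: bounded_bilinear.diff_right[OF bounded_bilinear_scaleC])
        then have "norm ((\<Sum>i<Suc N. ?f' i x h) - h *\<^sub>C disc_series (coeff_deriv a) x) =
            norm h * norm (disc_series (coeff_deriv a) x - (\<Sum>i<N. x ^ i *\<^sub>C coeff_deriv a i))"
          by (simp add: norm_scaleC)
        also have "\<dots> \<le> norm h * e"
          using disc_series_tail[OF b _ _ r(2), of x N] x sub elim by (intro mult_left_mono) auto
        finally show "norm ((\<Sum>i<Suc N. ?f' i x h) - h *\<^sub>C disc_series (coeff_deriv a) x) \<le> e * norm h"
          by (simp add: mult.commute)
      qed
    qed
    then show "\<forall>\<^sub>F n in sequentially. \<forall>x\<in>ball 0 r. \<forall>h.
        norm (sum (\<lambda>i. ?f' i x h) {..<n} - h *\<^sub>C disc_series (coeff_deriv a) x) \<le> e * norm h"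
      by (subst (asm) eventually_sequentially_Suc)
  next
    show "z \<in> ball 0 r" "(\<lambda>n. z ^ n *\<^sub>C a n) sums disc_series a z"
      using r disc_series_summable(2)[OF a z] by auto
  qed auto
  then obtain g where g: "\<And>x. x \<in> ball 0 r \<Longrightarrow> (\<lambda>n. x ^ n *\<^sub>C a n) sums g x"
    "\<And>x. x \<in> ball 0 r \<Longrightarrow> (g has_derivative (\<lambda>h. h *\<^sub>C disc_series (coeff_deriv a) x)) (at x within ball 0 r)"
    by blast
  have eq: "g x = disc_series a x" if "x \<in> ball 0 r" for x
    using sums_unique2[OF g(1)[OF that] disc_series_summable(2)[OF a]] that sub by auto
  have zb: "z \<in> ball 0 r" using r by simp
  have "(g has_derivative (\<lambda>h. h *\<^sub>C disc_series (coeff_deriv a) z)) (at z)"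
    using g(2)[OF zb] by (simp add: at_within_open[OF zb])
  then show ?thesis
    unfolding has_cderiv_def by (rule has_derivative_transform_within_open[OF _ open_ball zb eq])
qed

lemma cderiv_pow_disc_series:
  assumes a: "disc_summable a"
  shows "z \<in> disc \<Longrightarrow> (cderiv ^^ n) (disc_series a) z = disc_series ((coeff_deriv ^^ n) a) z"
proof (induction n arbitrary: z)
  case (Suc n)
  have "has_cderiv ((cderiv ^^ n) (disc_series a)) (disc_series (coeff_deriv ((coeff_deriv ^^ n) a)) z) z"
    by (rule has_cderiv_cong[OF Suc.IH Suc.prems has_cderiv_disc_series[OF disc_summable_deriv_pow[OF a] Suc.prems]])
  then show ?case by (simp add: cderiv_eqI)
qed simp

lemma disc_series_holomorphic: "disc_summable a \<Longrightarrow> disc_series a \<in> holomorphic_disc"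
  unfolding holomorphic_disc_def
  by (rule CollectI, intro conjI ballI allI impI, rule exI, erule (1) has_cderiv_disc_series)
    (simp add: disc_series_def)

lemma has_power_series_disc_summable:
  assumes "has_power_series f a" shows "disc_summable a"
  unfolding disc_summable_def
proof (intro allI impI)
  fix r :: real assume r: "0 \<le> r" "r < 1"
  define s where "s = (1 + r) / 2"
  have s: "r < s" "s < 1" "0 < s" using r by (auto simp: s_def)
  have "summable (\<lambda>j. complex_of_real s ^ j *\<^sub>C a j)"
    using assms s unfolding has_power_series_def by (auto intro: sums_summable)
  then have "Bseq (\<lambda>j. complex_of_real s ^ j *\<^sub>C a j)"
    by (intro convergent_imp_Bseq) (auto dest: summable_LIMSEQ_zero simp: convergent_def)
  then obtain K where K: "\<And>j. norm (complex_of_real s ^ j *\<^sub>C a j) \<le> K" by (auto simp: Bseq_def)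
  have "summable (\<lambda>j. K * (r / s) ^ j)" using r s by (intro summable_mult summable_geometric) simp
  then show "summable (\<lambda>j. norm (a j) * r ^ j)"
  proof (rule summable_comparison_test'[where N = 0])
    fix j
    have "norm (a j) * r ^ j = (s ^ j * norm (a j)) * (r / s) ^ j" using s by (simp add: power_divide)
    also have "\<dots> \<le> K * (r / s) ^ j"
      using K[of j] r s by (intro mult_right_mono) (auto simp: norm_scaleC norm_power)
    finally show "norm (norm (a j) * r ^ j) \<le> K * (r / s) ^ j" using r by simp
  qed
qed

lemma has_power_series_disc_series: "disc_summable a \<Longrightarrow> has_power_series (disc_series a) a"
  using disc_series_summable(2) by (auto simp: has_power_series_def)

lemma disc_series_0 [simp]: "disc_series a 0 = a 0"
  using powser_sums_zero_iff[where 'a = real] sums_single[of 0 a]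
  by (auto simp: disc_series_def power_0_left if_distrib[of "\<lambda>c. c *\<^sub>C _"] intro!: sums_unique[symmetric] cong: if_cong)

text \<open>The coefficients are the Taylor coefficients at 0.\<close>

lemma has_power_series_unique:
  assumes "has_power_series f a" "has_power_series f b" shows "a = b"
proof
  fix n
  note s = assms[THEN has_power_series_disc_summable]
  have "disc_series a = disc_series b"
    using assms by (auto simp: disc_series_def has_power_series_def fun_eq_iff dest!: sums_unique)
      (metis dist_norm mem_ball sums_unique assms has_power_series_def dist_0_norm)
  then have "(cderiv ^^ n) (disc_series a) 0 = (cderiv ^^ n) (disc_series b) 0" by simp
  then have "(coeff_deriv ^^ n) a 0 = (coeff_deriv ^^ n) b 0"
    by (simp add: cderiv_pow_disc_series[OF s(1)] cderiv_pow_disc_series[OF s(2)])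
  then have "complex_of_real (1 / fact n) *\<^sub>C of_real (fact n) *\<^sub>C a n = complex_of_real (1 / fact n) *\<^sub>C of_real (fact n) *\<^sub>C b n"
    by (simp add: coeff_deriv_pow)
  then show "a n = b n" by (simp add: scaleC_scaleC)
qed

lemma disc_series_add:
  assumes "disc_summable a" "disc_summable b" shows "disc_series (a + b) = disc_series a + disc_series b"
proof
  fix z show "disc_series (a + b) z = (disc_series a + disc_series b) z"
  proof (cases "z \<in> disc")
    case True
    show ?thesis
      using sums_add[OF disc_series_summable(2)[OF assms(1) True] disc_series_summable(2)[OF assms(2) True]]
        disc_series_summable(2)[OF disc_summable_add[OF assms] True]
      by (simp add: scaleC_add_right sums_unique2)
  qed (simp add: disc_series_def)
qed

lemma disc_series_scaleC:
  assumes "disc_summable a" shows "disc_series (c *\<^sub>C a) = c *\<^sub>C disc_series a"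
proof
  fix z show "disc_series (c *\<^sub>C a) z = (c *\<^sub>C disc_series a) z"
  proof (cases "z \<in> disc")
    case True
    have "(\<lambda>j. c *\<^sub>C z ^ j *\<^sub>C a j) sums (c *\<^sub>C disc_series a z)"
      by (rule bounded_linear.sums[OF bounded_bilinear.bounded_linear_right[OF bounded_bilinear_scaleC]
          disc_series_summable(2)[OF assms True]])
    then show ?thesis
      using disc_series_summable(2)[OF disc_summable_scaleC[OF assms, of c] True]
      by (simp add: scaleC_fun_def scaleC_scaleC mult.commute[of c] sums_unique2)
  qed (simp add: disc_series_def scaleC_fun_def)
qed

lemma disc_series_shift:
  assumes "disc_summable a" shows "M_z (disc_series a) = disc_series (coeff_shift a)"
proof
  fix z show "M_z (disc_series a) z = disc_series (coeff_shift a) z"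
  proof (cases "z \<in> disc")
    case True
    have "(\<lambda>j. z *\<^sub>C z ^ j *\<^sub>C a j) sums (z *\<^sub>C disc_series a z)"
      by (rule bounded_linear.sums[OF bounded_bilinear.bounded_linear_right[OF bounded_bilinear_scaleC]
          disc_series_summable(2)[OF assms True]])
    then have "(\<lambda>j. z ^ Suc j *\<^sub>C coeff_shift a (Suc j)) sums (z *\<^sub>C disc_series a z)"
      by (simp add: coeff_shift_def scaleC_scaleC)
    then have "(\<lambda>j. z ^ j *\<^sub>C coeff_shift a j) sums (z *\<^sub>C disc_series a z)"
      by (subst (asm) sums_Suc_iff) (simp add: coeff_shift_def)
    then show ?thesis using True by (simp add: M_z_def disc_series_def sums_unique)
  qed (simp add: disc_series_def M_z_def)
qed

lemma disc_series_clinear: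
  assumes "disc_summable a" and V: "bounded_clinear V"
  shows "disc_summable (V \<circ> a)" "disc_series (V \<circ> a) = V \<circ> disc_series a"
proof -
  have bl: "bounded_linear V" using V by (simp add: bounded_clinear_def)
  show s: "disc_summable (V \<circ> a)"
    unfolding disc_summable_def
  proof (intro allI impI)
    fix r :: real assume r: "0 \<le> r" "r < 1"
    obtain K where K: "\<And>x. norm (V x) \<le> norm x * K" using bounded_linear.bounded[OF bl] by blast
    have "summable (\<lambda>j. K * (norm (a j) * r ^ j))" by (rule summable_mult[OF disc_summableD[OF assms(1) r]])
    then show "summable (\<lambda>j. norm ((V \<circ> a) j) * r ^ j)"
    proof (rule summable_comparison_test'[where N = 0])
      fix j
      have "norm (V (a j)) * r ^ j \<le> (norm (a j) * K) * r ^ j" using r K by (intro mult_right_mono) auto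
      then show "norm (norm ((V \<circ> a) j) * r ^ j) \<le> K * (norm (a j) * r ^ j)" using r by (simp add: mult_ac)
    qed
  qed
  show "disc_series (V \<circ> a) = V \<circ> disc_series a"
  proof
    fix z show "disc_series (V \<circ> a) z = (V \<circ> disc_series a) z"
    proof (cases "z \<in> disc")
      case True
      show ?thesis
        using bounded_linear.sums[OF bl disc_series_summable(2)[OF assms(1) True]] V
          disc_series_summable(2)[OF s True]
        by (simp add: bounded_clinear_def sums_unique2)
    qed (simp add: disc_series_def linear_0[OF bounded_linear.linear[OF bl]])
  qed
qed

section \<open>The Hardy space\<close>

definition square_summable :: "(nat \<Rightarrow> 'a::chilbert_space) \<Rightarrow> bool" where
  "square_summable a \<longleftrightarrow> summable (\<lambda>j. (norm (a j))\<^sup>2)"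

lemma square_summable_disc:
  assumes "square_summable a" shows "disc_summable a"
proof -
  have "Bseq (\<lambda>j. (norm (a j))\<^sup>2)"
    using assms unfolding square_summable_def
    by (intro convergent_imp_Bseq) (auto dest: summable_LIMSEQ_zero simp: convergent_def)
  then obtain K where K: "\<And>j. (norm (a j))\<^sup>2 \<le> K" by (auto simp: Bseq_def)
  have "norm (a j) \<le> 1 + K" for j
    using K[of j] zero_le_power2[of "norm (a j) - 1"] by (simp add: power2_diff) (smt (verit) zero_le_power2)
  then show ?thesis by (rule disc_summable_bounded)
qed

lemma hardy_space_eq: "hardy_space = disc_series ` Collect square_summable"
proof (intro equalityI subsetI)
  fix f :: "complex \<Rightarrow> 'a" assume "f \<in> hardy_space"
  then obtain a where a: "f \<in> holomorphic_disc" "has_power_series f a" "square_summable a"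
    by (auto simp: hardy_space_def square_summable_def)
  have "f = disc_series a"
    using a by (auto simp: fun_eq_iff disc_series_def holomorphic_disc_def has_power_series_def sums_unique)
  with a show "f \<in> disc_series ` Collect square_summable" by auto
next
  fix f :: "complex \<Rightarrow> 'a" assume "f \<in> disc_series ` Collect square_summable"
  then obtain a where "f = disc_series a" "square_summable a" by auto
  moreover from this have "disc_summable a" by (simp add: square_summable_disc)
  ultimately show "f \<in> hardy_space"
    using disc_series_holomorphic[of a] has_power_series_disc_series[of a]
    by (auto simp: hardy_space_def square_summable_def)
qed

lemma hardy_norm_sq_disc_series:
  assumes "disc_summable a" shows "hardy_norm_sq (disc_series a) = (\<Sum>j. (norm (a j))\<^sup>2)"
proof -
  have "(THE b. has_power_series (disc_series a) b) = a"
    using has_power_series_disc_series[OF assms] has_power_series_unique by blast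
  then show ?thesis by (simp add: hardy_norm_sq_def)
qed

lemma square_summable_add:
  assumes "square_summable a" "square_summable b" shows "square_summable (a + b)"
  unfolding square_summable_def
proof (rule summable_comparison_test'[where N = 0])
  show "summable (\<lambda>j. 2 * (norm (a j))\<^sup>2 + 2 * (norm (b j))\<^sup>2)"
    using assms by (intro summable_add summable_mult) (auto simp: square_summable_def)
  fix j
  have "(norm (a j + b j))\<^sup>2 \<le> (norm (a j) + norm (b j))\<^sup>2" by (intro power_mono norm_triangle_ineq) simp
  also have "\<dots> \<le> 2 * (norm (a j))\<^sup>2 + 2 * (norm (b j))\<^sup>2"
    using zero_le_power2[of "norm (a j) - norm (b j)"] by (simp add: power2_sum power2_diff)
  finally show "norm ((norm ((a + b) j))\<^sup>2) \<le> 2 * (norm (a j))\<^sup>2 + 2 * (norm (b j))\<^sup>2" by simp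
qed

lemma square_summable_scaleC: "square_summable a \<Longrightarrow> square_summable (c *\<^sub>C a)"
  by (simp add: square_summable_def scaleC_fun_def norm_scaleC power_mult_distrib summable_mult)

lemma square_summable_shift: "square_summable (coeff_shift a) \<longleftrightarrow> square_summable a"
  unfolding square_summable_def by (subst summable_Suc_iff[symmetric]) (simp add: coeff_shift_def)

lemma square_summable_finite: "(\<And>j. K \<le> j \<Longrightarrow> a j = 0) \<Longrightarrow> square_summable a"
  unfolding square_summable_def by (rule summable_finite[of "{..<K}"]) (auto simp: not_less)

section \<open>Radially weighted Dirichlet integrals as Toeplitz sums\<close>

text \<open>Weights that vanish near the circle, where the Poisson kernel is unbounded.\<close>

definition cutoff_weight :: "(real \<Rightarrow> real) \<Rightarrow> real \<Rightarrow> bool" where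
  "cutoff_weight w q \<longleftrightarrow> w \<in> borel_measurable borel \<and> 0 \<le> q \<and> q < 1 \<and>
    (\<forall>t\<ge>0. 0 \<le> w t \<and> w t \<le> 1) \<and> (\<forall>t>q. w t = 0)"

definition circle_moment :: "(complex set \<Rightarrow> 'a::chilbert_space \<Rightarrow> 'a) \<Rightarrow> nat \<Rightarrow> nat \<Rightarrow> 'a \<Rightarrow> 'a \<Rightarrow> complex" where
  "circle_moment \<mu> k l = spectral_form \<mu> (\<lambda>\<zeta>. \<zeta> ^ k * cnj \<zeta> ^ l)"

text \<open>On the disc this is the sesquilinear form of the Poisson integral; being given by polarization, it is
  measurable on the whole plane.\<close>

definition poisson_form :: "(complex set \<Rightarrow> 'a::chilbert_space \<Rightarrow> 'a) \<Rightarrow> complex \<Rightarrow> 'a \<Rightarrow> 'a \<Rightarrow> complex" where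
  "poisson_form \<mu> z x y = (\<Sum>j<4. \<i> ^ j * of_real (poisson_quad \<mu> z (x + \<i> ^ j *\<^sub>C y))) / 4"

definition toeplitz_sum ::
  "(complex set \<Rightarrow> 'a::chilbert_space \<Rightarrow> 'a) \<Rightarrow> (nat \<Rightarrow> nat \<Rightarrow> real) \<Rightarrow> nat \<Rightarrow> (nat \<Rightarrow> 'a) \<Rightarrow> complex" where
  "toeplitz_sum \<mu> c K a = (\<Sum>k<K. \<Sum>l<K. of_real (c k l) * circle_moment \<mu> k l (a k) (a l))"

definition radial_integral ::
  "(complex set \<Rightarrow> 'a::chilbert_space \<Rightarrow> 'a) \<Rightarrow> (real \<Rightarrow> real) \<Rightarrow> (nat \<Rightarrow> 'a) \<Rightarrow> real" where
  "radial_integral \<mu> w b = (LINT z|disc_measure. poisson_quad \<mu> z (disc_series b z) * w ((norm z)\<^sup>2))"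

definition truncate :: "nat \<Rightarrow> (nat \<Rightarrow> 'a::zero) \<Rightarrow> nat \<Rightarrow> 'a" where
  "truncate K a j = (if j < K then a j else 0)"

lemma disc_summable_finite:
  assumes "\<And>j. K \<le> j \<Longrightarrow> a j = 0" shows "disc_summable a"
  unfolding disc_summable_def
  by (intro allI impI summable_finite[of "{..<K}"]) (use assms in \<open>auto simp: not_less\<close>)

lemma disc_series_finite:
  assumes "\<And>j. K \<le> j \<Longrightarrow> a j = 0" and z: "z \<in> disc"
  shows "disc_series a z = (\<Sum>j<K. z ^ j *\<^sub>C a j)"
  using z unfolding disc_series_def
  by (simp, intro suminf_finite) (use assms in \<open>auto simp: not_less\<close>)

lemma disc_summable_truncate: "disc_summable (truncate K a)"
  by (rule disc_summable_finite[of K]) (simp add: truncate_def)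

context
  fixes \<mu> :: "complex set \<Rightarrow> 'a::chilbert_space \<Rightarrow> 'a"
  assumes \<mu>: "semi_spectral_measure \<mu>"
begin

lemma poisson_quad_scaleC:
  assumes "z \<in> disc" shows "poisson_quad \<mu> z (c *\<^sub>C x) = (norm c)\<^sup>2 * poisson_quad \<mu> z x"
proof -
  have "complex_of_real (poisson_quad \<mu> z (c *\<^sub>C x)) = of_real ((norm c)\<^sup>2 * poisson_quad \<mu> z x)"
    unfolding poisson_integral_quad[OF \<mu> assms, symmetric]
      sesquilinearD(3,4)[OF sesquilinear_poisson_integral[OF \<mu> assms]]
    by (simp only: poisson_integral_quad[OF \<mu> assms] complex_norm_square of_real_mult mult_ac)
  then show ?thesis by (simp only: of_real_eq_iff)
qed

lemma poisson_quad_add_le: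
  assumes z: "z \<in> disc" shows "poisson_quad \<mu> z (x + y) \<le> 2 * poisson_quad \<mu> z x + 2 * poisson_quad \<mu> z y"
proof -
  note s = sesquilinearD[OF sesquilinear_poisson_integral[OF \<mu> z]]
  have "complex_of_real (poisson_quad \<mu> z (x + y)) + of_real (poisson_quad \<mu> z (x + (-1) *\<^sub>C y)) = 2 * of_real (poisson_quad \<mu> z x) + 2 * of_real (poisson_quad \<mu> z y)"
    unfolding poisson_integral_quad[OF \<mu> z, symmetric] s by simp
  then have "complex_of_real (poisson_quad \<mu> z (x + y) + poisson_quad \<mu> z (x + (-1) *\<^sub>C y)) = of_real (2 * poisson_quad \<mu> z x + 2 * poisson_quad \<mu> z y)"
    by simp
  then have "poisson_quad \<mu> z (x + y) + poisson_quad \<mu> z (x + (-1) *\<^sub>C y) = 2 * poisson_quad \<mu> z x + 2 * poisson_quad \<mu> z y"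
    by (simp only: of_real_eq_iff)
  moreover have "0 \<le> poisson_quad \<mu> z (x + (-1) *\<^sub>C y)" by (rule poisson_quad_nonneg[OF \<mu> z])
  ultimately show ?thesis by linarith
qed

lemma poisson_quad_tendsto:
  assumes z: "z \<in> disc" and f: "f \<longlonglongrightarrow> x" shows "(\<lambda>n. poisson_quad \<mu> z (f n)) \<longlonglongrightarrow> poisson_quad \<mu> z x"
proof -
  have "(\<lambda>n. Re (cinner (poisson_integral \<mu> z (f n)) (f n))) \<longlonglongrightarrow> Re (cinner (poisson_integral \<mu> z x) x)"
    by (intro tendsto_intros f bounded_linear.tendsto[OF bounded_linear_poisson_integral[OF \<mu> z]])
  then show ?thesis by (simp add: poisson_integral_quad[OF \<mu> z])
qed

lemma poisson_form_eq:
  assumes z: "z \<in> disc" shows "poisson_form \<mu> z x y = cinner (poisson_integral \<mu> z x) y"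
  unfolding poisson_form_def poisson_integral_quad[OF \<mu> z, symmetric]
  by (rule sesquilinear_polarization[OF sesquilinear_poisson_integral[OF \<mu> z]])

lemma borel_measurable_poisson_form [measurable]: "(\<lambda>z. poisson_form \<mu> z x y) \<in> borel_measurable borel"
proof -
  note [measurable] = borel_measurable_poisson_quad[OF \<mu>]
  show ?thesis unfolding poisson_form_def by measurable
qed

lemma poisson_quad_polynomial:
  assumes z: "z \<in> disc"
  shows "of_real (poisson_quad \<mu> z (\<Sum>k<K. z ^ k *\<^sub>C b k)) =
    (\<Sum>k<K. \<Sum>l<K. z ^ k * cnj z ^ l * poisson_form \<mu> z (b k) (b l))"
proof -
  have "poisson_integral \<mu> z (\<Sum>k<K. z ^ k *\<^sub>C b k) = (\<Sum>k<K. poisson_integral \<mu> z (z ^ k *\<^sub>C b k))"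
    by (rule linear_sum[OF bounded_linear.linear[OF bounded_linear_poisson_integral[OF \<mu> z]]])
  then show ?thesis
    unfolding poisson_integral_quad[OF \<mu> z, symmetric] poisson_form_eq[OF z]
    by (simp add: cinner_sum_left cinner_sum_right sesquilinearD(3,4)[OF sesquilinear_poisson_integral[OF \<mu> z]]
        sum_distrib_left mult_ac) (rule sum.swap)
qed

lemma borel_measurable_poisson_polynomial:
  "(\<lambda>z. poisson_quad \<mu> z (\<Sum>k<K. z ^ k *\<^sub>C b k) * indicator disc z) \<in> borel_measurable borel"
proof -
  have "(\<lambda>z. Re (\<Sum>k<K. \<Sum>l<K. z ^ k * cnj z ^ l * poisson_form \<mu> z (b k) (b l)) * indicator disc z)
      \<in> borel_measurable borel"
    by measurable
  also have "(\<lambda>z. Re (\<Sum>k<K. \<Sum>l<K. z ^ k * cnj z ^ l * poisson_form \<mu> z (b k) (b l)) * indicator disc z) =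
      (\<lambda>z. poisson_quad \<mu> z (\<Sum>k<K. z ^ k *\<^sub>C b k) * indicator disc z)"
  proof
    fix z
    show "Re (\<Sum>k<K. \<Sum>l<K. z ^ k * cnj z ^ l * poisson_form \<mu> z (b k) (b l)) * indicator disc z =
      poisson_quad \<mu> z (\<Sum>k<K. z ^ k *\<^sub>C b k) * indicator disc z"
    proof (cases "z \<in> disc")
      case True show ?thesis by (simp only: poisson_quad_polynomial[OF True, symmetric] Re_complex_of_real)
    qed simp
  qed
  finally show ?thesis .
qed

text \<open>Measurability passes from \<open>z \<mapsto> poisson_quad \<mu> z x\<close> with fixed \<open>x\<close> to polynomials in place of \<open>x\<close> by expanding
  the quadratic form, and to power series as pointwise limits of polynomials.\<close>

lemma borel_measurable_poisson_series:
  assumes "disc_summable b"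
  shows "(\<lambda>z. poisson_quad \<mu> z (disc_series b z)) \<in> borel_measurable borel"
proof -
  have "(\<lambda>z. poisson_quad \<mu> z (disc_series b z) * indicator disc z) \<in> borel_measurable borel"
  proof (rule borel_measurable_LIMSEQ_real)
    show "(\<lambda>z. poisson_quad \<mu> z (\<Sum>k<K. z ^ k *\<^sub>C b k) * indicator disc z) \<in> borel_measurable borel" for K
      by (rule borel_measurable_poisson_polynomial)
    fix z
    show "(\<lambda>K. poisson_quad \<mu> z (\<Sum>k<K. z ^ k *\<^sub>C b k) * indicator disc z) \<longlonglongrightarrow> poisson_quad \<mu> z (disc_series b z) * indicator disc z"
    proof (cases "z \<in> disc")
      case True
      have "(\<lambda>K. \<Sum>k<K. z ^ k *\<^sub>C b k) \<longlonglongrightarrow> disc_series b z"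
        using disc_series_summable(2)[OF assms True] by (simp add: sums_def)
      from poisson_quad_tendsto[OF True this] show ?thesis using True by simp
    qed simp
  qed
  also have "(\<lambda>z. poisson_quad \<mu> z (disc_series b z) * indicator disc z) = (\<lambda>z. poisson_quad \<mu> z (disc_series b z))"
    by (auto simp: fun_eq_iff indicator_def disc_series_def poisson_quad_zero[OF \<mu>])
  finally show ?thesis .
qed

text \<open>Below the cutoff the integrand is bounded by the absolute sum of the power series.\<close>

lemma radial_integrand_bound:
  assumes b: "disc_summable b" and w: "cutoff_weight w q"
  obtains B where "\<And>a z. z \<in> disc \<Longrightarrow> (\<And>j. norm (a j) \<le> norm (b j)) \<Longrightarrow>
    norm (poisson_quad \<mu> z (disc_series a z) * w ((norm z)\<^sup>2)) \<le> B"
proof -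
  obtain C where C: "0 \<le> C" "\<And>z x. z \<in> disc \<Longrightarrow> poisson_quad \<mu> z x \<le> C / (1 - norm z)\<^sup>2 * (norm x)\<^sup>2"
    using poisson_quad_le[OF \<mu>] by metis
  define r where "r = sqrt q"
  have r: "0 \<le> r" "r < 1" using w by (auto simp: r_def cutoff_weight_def)
  define S where "S = (\<Sum>j. norm (b j) * r ^ j)"
  have sS: "summable (\<lambda>j. norm (b j) * r ^ j)" by (rule disc_summableD[OF b r])
  have S0: "0 \<le> S" unfolding S_def by (rule suminf_nonneg[OF sS]) (use r in simp)
  have "norm (poisson_quad \<mu> z (disc_series a z) * w ((norm z)\<^sup>2)) \<le> C / (1 - r)\<^sup>2 * S\<^sup>2"
    if z: "z \<in> disc" and a: "\<And>j. norm (a j) \<le> norm (b j)" for a z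
  proof (cases "q < (norm z)\<^sup>2")
    case True
    then show ?thesis using w C S0 by (simp add: cutoff_weight_def)
  next
    case False
    then have zr: "norm z \<le> r" using real_le_rsqrt by (simp add: r_def)
    have "norm (disc_series a z) \<le> S"
    proof -
      have le: "norm (z ^ j *\<^sub>C a j) \<le> norm (b j) * r ^ j" for j
        using a[of j] power_mono[OF zr, of j] r
        by (simp add: norm_scaleC norm_power mult.commute[of "norm z ^ j"] mult_mono)
      have "summable (\<lambda>j. norm (z ^ j *\<^sub>C a j))"
        by (rule summable_comparison_test'[OF sS, where N = 0]) (use le in simp)
      then show ?thesis
        using z unfolding S_def disc_series_def
        by (simp, intro order_trans[OF summable_norm] suminf_le le sS)
    qed
    then have n2: "(norm (disc_series a z))\<^sup>2 \<le> S\<^sup>2" by (intro power_mono) auto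
    have d: "C / (1 - norm z)\<^sup>2 \<le> C / (1 - r)\<^sup>2"
      using zr r C(1) by (intro divide_left_mono power_mono mult_pos_pos) auto
    have "poisson_quad \<mu> z (disc_series a z) \<le> C / (1 - norm z)\<^sup>2 * (norm (disc_series a z))\<^sup>2" by (rule C(2)[OF z])
    also have "\<dots> \<le> C / (1 - r)\<^sup>2 * S\<^sup>2" using d n2 C(1) by (intro mult_mono) auto
    finally have "poisson_quad \<mu> z (disc_series a z) \<le> C / (1 - r)\<^sup>2 * S\<^sup>2" .
    moreover have "0 \<le> w ((norm z)\<^sup>2)" "w ((norm z)\<^sup>2) \<le> 1" using w by (auto simp: cutoff_weight_def)
    ultimately have "poisson_quad \<mu> z (disc_series a z) * w ((norm z)\<^sup>2) \<le> (C / (1 - r)\<^sup>2 * S\<^sup>2) * 1"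
      using poisson_quad_nonneg[OF \<mu> z] C(1) by (intro mult_mono) auto
    then show ?thesis
      using poisson_quad_nonneg[OF \<mu> z] \<open>0 \<le> w ((norm z)\<^sup>2)\<close> by (simp add: abs_mult)
  qed
  then show thesis using that by blast
qed

lemma borel_measurable_radial_integrand:
  assumes "disc_summable b" "cutoff_weight w q"
  shows "(\<lambda>z. poisson_quad \<mu> z (disc_series b z) * w ((norm z)\<^sup>2)) \<in> borel_measurable borel"
proof -
  note [measurable] = borel_measurable_poisson_series[OF assms(1)]
  have [measurable]: "w \<in> borel_measurable borel" using assms(2) by (simp add: cutoff_weight_def)
  show ?thesis by measurable
qed

lemma integrable_radial_integrand:
  assumes b: "disc_summable b" and w: "cutoff_weight w q"
  shows "integrable disc_measure (\<lambda>z. poisson_quad \<mu> z (disc_series b z) * w ((norm z)\<^sup>2))"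
proof -
  interpret finite_measure disc_measure by (rule finite_measure_disc_measure)
  obtain B where B: "\<And>z. z \<in> disc \<Longrightarrow> norm (poisson_quad \<mu> z (disc_series b z) * w ((norm z)\<^sup>2)) \<le> B"
    using radial_integrand_bound[OF b w] by (metis order_refl)
  show ?thesis
    by (rule integrable_const_bound[where B = B])
      (use AE_disc_measure B borel_measurable_radial_integrand[OF b w] in \<open>auto elim!: eventually_mono\<close>)
qed

lemma radial_integral_truncate:
  assumes b: "disc_summable b" and w: "cutoff_weight w q"
  shows "(\<lambda>K. radial_integral \<mu> w (truncate K b)) \<longlonglongrightarrow> radial_integral \<mu> w b"
proof -
  interpret finite_measure disc_measure by (rule finite_measure_disc_measure)
  obtain B where B: "\<And>a z. z \<in> disc \<Longrightarrow> (\<And>j. norm (a j) \<le> norm (b j)) \<Longrightarrow>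
      norm (poisson_quad \<mu> z (disc_series a z) * w ((norm z)\<^sup>2)) \<le> B"
    using radial_integrand_bound[OF b w] by blast
  show ?thesis unfolding radial_integral_def
  proof (rule integral_dominated_convergence[where w = "\<lambda>_. B"])
    show "AE z in disc_measure. (\<lambda>K. poisson_quad \<mu> z (disc_series (truncate K b) z) * w ((norm z)\<^sup>2))
        \<longlonglongrightarrow> poisson_quad \<mu> z (disc_series b z) * w ((norm z)\<^sup>2)"
      using AE_disc_measure
    proof eventually_elim
      case (elim z)
      have "disc_series (truncate K b) z = (\<Sum>k<K. z ^ k *\<^sub>C b k)" for K
        by (subst disc_series_finite[of K, OF _ elim]) (auto simp: truncate_def)
      then have "(\<lambda>K. disc_series (truncate K b) z) \<longlonglongrightarrow> disc_series b z"
        using disc_series_summable(2)[OF b elim] by (simp add: sums_def)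
      then show ?case by (intro tendsto_intros poisson_quad_tendsto[OF elim])
    qed
    show "AE z in disc_measure. norm (poisson_quad \<mu> z (disc_series (truncate K b) z) * w ((norm z)\<^sup>2)) \<le> B" for K
      using AE_disc_measure by eventually_elim (rule B, auto simp: truncate_def)
    show "(\<lambda>z. poisson_quad \<mu> z (disc_series b z) * w ((norm z)\<^sup>2)) \<in> borel_measurable disc_measure"
      using borel_measurable_radial_integrand[OF b w] by simp
    show "(\<lambda>z. poisson_quad \<mu> z (disc_series (truncate K b) z) * w ((norm z)\<^sup>2)) \<in> borel_measurable disc_measure" for K
      using borel_measurable_radial_integrand[OF disc_summable_truncate w] by simp
  qed simp
qed

lemma norm_monomial_circle: "\<forall>\<zeta>\<in>circle. norm (\<zeta> ^ k * cnj \<zeta> ^ l) \<le> 1"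
  by (simp add: norm_mult norm_power)

lemma borel_measurable_monomial: "(\<lambda>\<zeta>. \<zeta> ^ k * cnj \<zeta> ^ l) \<in> borel_measurable borel"
  by measurable

lemma sesquilinear_circle_moment: "sesquilinear (circle_moment \<mu> k l)"
  unfolding circle_moment_def
  by (rule sesquilinear_spectral_form[OF \<mu> borel_measurable_monomial norm_monomial_circle])

lemma circle_moment_zero [simp]: "circle_moment \<mu> k l 0 y = 0" "circle_moment \<mu> k l x 0 = 0"
  using sesquilinearD(3)[OF sesquilinear_circle_moment, of k l 0 0 y]
    sesquilinearD(4)[OF sesquilinear_circle_moment, of k l x 0 0] by auto

lemma circle_moment_diag: "circle_moment \<mu> k l x x = (LINT \<zeta>|quad_measure \<mu> x. \<zeta> ^ k * cnj \<zeta> ^ l)"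
  unfolding circle_moment_def
  by (rule spectral_form_diag[OF \<mu> borel_measurable_monomial norm_monomial_circle])

lemma circle_moment_shift: "circle_moment \<mu> (k + n) (l + n) x y = circle_moment \<mu> k l x y"
proof -
  have "\<zeta> ^ (k + n) * cnj \<zeta> ^ (l + n) = \<zeta> ^ k * cnj \<zeta> ^ l" if "\<zeta> \<in> circle" for \<zeta>
  proof -
    have "(\<zeta> * cnj \<zeta>) ^ n = 1" using that complex_norm_square[of \<zeta>] by simp
    then show ?thesis by (simp add: power_add power_mult_distrib mult_ac)
  qed
  then have "(LINT \<zeta>|quad_measure \<mu> v. \<zeta> ^ (k + n) * cnj \<zeta> ^ (l + n)) = (LINT \<zeta>|quad_measure \<mu> v. \<zeta> ^ k * cnj \<zeta> ^ l)" for v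
    by (intro Bochner_Integration.integral_cong) auto
  then show ?thesis unfolding circle_moment_def spectral_form_def by simp
qed

lemma poisson_form_moment:
  fixes k l :: nat and x y :: 'a
  assumes w: "cutoff_weight w q"
  defines "g \<equiv> \<lambda>z. z ^ k * cnj z ^ l * poisson_form \<mu> z x y * of_real (w ((norm z)\<^sup>2))"
  shows "integrable disc_measure g"
    and "integral\<^sup>L disc_measure g = of_real (weight_moment w (max k l)) * circle_moment \<mu> k l x y"
proof -
  interpret finite_measure disc_measure by (rule finite_measure_disc_measure)
  have wm [measurable]: "w \<in> borel_measurable borel" using w by (simp add: cutoff_weight_def)
  note [measurable] = borel_measurable_poisson_quad[OF \<mu>]
  \<comment> \<open>The summands of the polarization formula, for which the moments are known.\<close>
  define h where "h v z = z ^ k * cnj z ^ l * complex_of_real (poisson_quad \<mu> z v * w ((norm z)\<^sup>2))" for v z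
  have hm [measurable]: "h v \<in> borel_measurable borel" for v unfolding h_def by measurable
  have hi: "integrable disc_measure (h v)" for v
  proof -
    define b where "b j = (if j = 0 then v else 0)" for j :: nat
    have b: "disc_summable b" by (rule disc_summable_finite[of 1]) (simp add: b_def)
    have bz: "disc_series b z = v" if "z \<in> disc" for z
      by (subst disc_series_finite[of 1, OF _ that]) (auto simp: b_def)
    obtain B where B: "\<And>z. z \<in> disc \<Longrightarrow> norm (poisson_quad \<mu> z (disc_series b z) * w ((norm z)\<^sup>2)) \<le> B"
      using radial_integrand_bound[OF b w] by (metis order_refl)
    have "norm (h v z) \<le> B" if z: "z \<in> disc" for z
    proof -
      have "norm (h v z) = norm (z ^ k * cnj z ^ l) * norm (poisson_quad \<mu> z v * w ((norm z)\<^sup>2))"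
        by (simp only: h_def norm_mult norm_of_real real_norm_def)
      also have "\<dots> \<le> 1 * norm (poisson_quad \<mu> z v * w ((norm z)\<^sup>2))"
        using z by (intro mult_right_mono) (auto simp: norm_mult norm_power intro!: mult_le_one power_le_one)
      finally show ?thesis using B[OF z] bz[OF z] by simp
    qed
    then show ?thesis
      by (intro integrable_const_bound[where B = B]) (use AE_disc_measure in \<open>auto elim!: eventually_mono\<close>)
  qed
  have hv: "integral\<^sup>L disc_measure (h v) =
      (LINT \<zeta>|quad_measure \<mu> v. \<zeta> ^ k * cnj \<zeta> ^ l) * of_real (weight_moment w (max k l))" for v
    unfolding h_def poisson_quad_def
    by (rule poisson_disc_moment[OF finite_measure_quad_measure[OF \<mu>] sets_quad_measure wm, where W = 1 and q = q])
      (use w in \<open>auto simp: cutoff_weight_def\<close>)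
  have g: "g = (\<lambda>z. (\<Sum>j<4. \<i> ^ j * h (x + \<i> ^ j *\<^sub>C y) z) / 4)"
    unfolding g_def h_def poisson_form_def
    by (simp add: fun_eq_iff sum_distrib_left sum_distrib_right mult_ac)
  show "integrable disc_measure g" unfolding g using hi by simp
  show "integral\<^sup>L disc_measure g = of_real (weight_moment w (max k l)) * circle_moment \<mu> k l x y"
    unfolding g circle_moment_def spectral_form_def using hi
    by (simp add: hv sum_distrib_left mult_ac)
qed

text \<open>A finitely supported sequence is integrated term by term.\<close>

lemma radial_integral_finite:
  assumes b: "\<And>j. K \<le> j \<Longrightarrow> b j = 0" and w: "cutoff_weight w q"
  shows "of_real (radial_integral \<mu> w b) = toeplitz_sum \<mu> (\<lambda>k l. weight_moment w (max k l)) K b"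
proof -
  let ?g = "\<lambda>k l z. z ^ k * cnj z ^ l * poisson_form \<mu> z (b k) (b l) * complex_of_real (w ((norm z)\<^sup>2))"
  have wm [measurable]: "w \<in> borel_measurable borel" using w by (simp add: cutoff_weight_def)
  have "complex_of_real (radial_integral \<mu> w b) =
      (LINT z|disc_measure. complex_of_real (poisson_quad \<mu> z (disc_series b z) * w ((norm z)\<^sup>2)))"
    unfolding radial_integral_def by (rule integral_complex_of_real[symmetric])
  also have "\<dots> = (LINT z|disc_measure. (\<Sum>k<K. \<Sum>l<K. ?g k l z))"
  proof (rule integral_cong_AE)
    show "(\<lambda>z. complex_of_real (poisson_quad \<mu> z (disc_series b z) * w ((norm z)\<^sup>2))) \<in> borel_measurable disc_measure"
    proof -
      have "disc_summable b" by (rule disc_summable_finite[of K]) (rule b)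
      note [measurable] = borel_measurable_poisson_series[OF this]
      show ?thesis by measurable
    qed
    show "AE z in disc_measure. complex_of_real (poisson_quad \<mu> z (disc_series b z) * w ((norm z)\<^sup>2)) = (\<Sum>k<K. \<Sum>l<K. ?g k l z)"
      using AE_disc_measure
    proof eventually_elim
      case (elim z)
      show ?case
        by (simp only: disc_series_finite[OF b elim] of_real_mult poisson_quad_polynomial[OF elim] sum_distrib_right)
    qed
  qed measurable
  also have "\<dots> = (\<Sum>k<K. \<Sum>l<K. integral\<^sup>L disc_measure (?g k l))"
    by (simp add: poisson_form_moment(1)[OF w])
  also have "\<dots> = toeplitz_sum \<mu> (\<lambda>k l. weight_moment w (max k l)) K b"
    unfolding toeplitz_sum_def poisson_form_moment(2)[OF w] ..
  finally show ?thesis .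
qed

end

section \<open>Moments of the weights \<open>(1 - t / q) ^ (n - 1)\<close>\<close>

text \<open>These weights increase to the weight \<open>(1 - t) ^ (n - 1)\<close> of the Dirichlet integral as \<open>q\<close> tends to 1,
  and unlike its plain truncations they have moments in closed form.\<close>

definition dirichlet_weight :: "nat \<Rightarrow> real \<Rightarrow> real \<Rightarrow> real" where
  "dirichlet_weight n q t = (if t \<le> q then (1 - t / q) ^ (n - 1) else 0)"

lemma dirichlet_weight_bounds:
  assumes "0 < q" "0 \<le> t" shows "0 \<le> dirichlet_weight n q t" "dirichlet_weight n q t \<le> 1"
proof -
  have "0 \<le> t / q" using assms by simp
  moreover have "t / q \<le> 1" if "t \<le> q" using that assms by simp
  ultimately show "0 \<le> dirichlet_weight n q t" "dirichlet_weight n q t \<le> 1"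
    unfolding dirichlet_weight_def by (simp_all add: power_le_one)
qed

lemma cutoff_weight_dirichlet:
  assumes "0 < q" "q < 1" shows "cutoff_weight (dirichlet_weight n q) q"
  unfolding cutoff_weight_def
proof (intro conjI allI impI)
  show "dirichlet_weight n q \<in> borel_measurable borel"
    unfolding dirichlet_weight_def by measurable
  show "dirichlet_weight n q t = 0" if "q < t" for t using that by (simp add: dirichlet_weight_def)
qed (use assms dirichlet_weight_bounds in simp_all)

lemma dirichlet_weight_mono:
  assumes "0 < q" "q \<le> q'" "0 \<le> t" shows "dirichlet_weight n q t \<le> dirichlet_weight n q' t"
proof (cases "t \<le> q")
  case True
  have "t / q' \<le> t / q" using assms by (simp add: divide_left_mono)
  moreover have "t / q \<le> 1" using True assms by simp
  ultimately have "(1 - t / q) ^ (n - 1) \<le> (1 - t / q') ^ (n - 1)" by (intro power_mono) simp_all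
  then show ?thesis using True assms by (simp add: dirichlet_weight_def)
next
  case False
  then show ?thesis using dirichlet_weight_bounds(1)[of q' t n] assms by (simp add: dirichlet_weight_def)
qed

text \<open>A scaled Beta integral with integer parameters.\<close>

lemma has_integral_beta:
  fixes q :: real
  assumes q: "0 < q"
  shows "((\<lambda>t. t ^ M * (1 - t / q) ^ n) has_integral q ^ (M + 1) * fact M * fact n / fact (M + n + 1)) {0..q}"
proof (induction n arbitrary: M)
  case 0
  have "((\<lambda>t. t ^ M) has_integral (q ^ Suc M / real (Suc M) - 0 ^ Suc M / real (Suc M))) {0..q}"
  proof (rule fundamental_theorem_of_calculus)
    fix t :: real
    have "((\<lambda>t. t ^ Suc M / real (Suc M)) has_real_derivative (real (Suc M) * t ^ M) / real (Suc M)) (at t within {0..q})"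
      using DERIV_cdivide[OF DERIV_pow[of "Suc M" t "{0..q}"], of "real (Suc M)"] by simp
    then show "((\<lambda>t. t ^ Suc M / real (Suc M)) has_vector_derivative t ^ M) (at t within {0..q})"
      by (simp add: has_real_derivative_iff_has_vector_derivative del: of_nat_Suc)
  qed (use q in simp)
  moreover have "q ^ (M + 1) * fact M * fact 0 / fact (M + 0 + 1) = q ^ Suc M / real (Suc M) - 0 ^ Suc M / real (Suc M)"
    by (simp del: of_nat_Suc)
  ultimately show ?case by (simp only: power_0 mult_1_right)
next
  case (Suc n)
  \<comment> \<open>Integration by parts.\<close>
  have "((\<lambda>t. real (M + 1) * (t ^ M * (1 - t / q) ^ Suc n) - (real (n + 1) / q) * (t ^ (M + 1) * (1 - t / q) ^ n))
      has_integral (q ^ (M + 1) * (1 - q / q) ^ Suc n - 0 ^ (M + 1) * (1 - 0 / q) ^ Suc n)) {0..q}"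
  proof (rule fundamental_theorem_of_calculus)
    fix t :: real
    have "((\<lambda>t. t ^ (M + 1) * (1 - t / q) ^ Suc n) has_real_derivative
        real (M + 1) * (t ^ M * (1 - t / q) ^ Suc n) - (real (n + 1) / q) * (t ^ (M + 1) * (1 - t / q) ^ n)) (at t within {0..q})"
    proof -
      have 1: "((\<lambda>t. t ^ (M + 1)) has_real_derivative real (M + 1) * t ^ M) (at t within {0..q})"
        using DERIV_pow[of "M + 1" t "{0..q}"] by simp
      have "((\<lambda>t. 1 - t / q) has_real_derivative 0 - 1 / q) (at t within {0..q})"
        by (intro DERIV_diff DERIV_const DERIV_cdivide DERIV_ident)
      from DERIV_mult[OF 1 DERIV_power[OF this, of "Suc n"]] show ?thesis
        by (rule DERIV_cong) (simp add: mult_ac del: power_Suc of_nat_Suc)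
    qed
    then show "((\<lambda>t. t ^ (M + 1) * (1 - t / q) ^ Suc n) has_vector_derivative
        real (M + 1) * (t ^ M * (1 - t / q) ^ Suc n) - (real (n + 1) / q) * (t ^ (M + 1) * (1 - t / q) ^ n)) (at t within {0..q})"
      by (simp only: has_real_derivative_iff_has_vector_derivative)
  qed (use q in simp)
  from has_integral_add[OF this has_integral_mult_right[OF Suc.IH[of "M + 1"], of "real (n + 1) / q"]]
  have "((\<lambda>t. real (M + 1) * (t ^ M * (1 - t / q) ^ Suc n)) has_integral
      (real (n + 1) / q) * (q ^ (M + 1 + 1) * fact (M + 1) * fact n / fact (M + 1 + n + 1))) {0..q}"
    using q by simp
  from has_integral_mult_right[OF this, of "1 / real (M + 1)"]
  have "((\<lambda>t. t ^ M * (1 - t / q) ^ Suc n) has_integral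
      1 / real (M + 1) * ((real (n + 1) / q) * (q ^ (M + 1 + 1) * fact (M + 1) * fact n / fact (M + 1 + n + 1)))) {0..q}"
    by (simp del: of_nat_Suc of_nat_add)
  also have "1 / real (M + 1) * ((real (n + 1) / q) * (q ^ (M + 1 + 1) * fact (M + 1) * fact n / fact (M + 1 + n + 1))) =
      q ^ (M + 1) * fact M * fact (Suc n) / fact (M + Suc n + 1)"
  proof -
    have f: "fact (M + 1) = real (M + 1) * fact M" "fact (Suc n) = real (n + 1) * fact n"
      "fact (M + 1 + n + 1) = (fact (M + Suc n + 1) :: real)" by simp_all
    have "real (M + 1) \<noteq> 0" by simp
    then show ?thesis
      unfolding f using q by (simp add: power_add del: fact_Suc of_nat_add of_nat_Suc)
  qed
  finally show ?case .
qed

lemma weight_moment_dirichlet: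
  assumes q: "0 < q" "q < 1"
  shows "weight_moment (dirichlet_weight n q) M = q ^ (M + 1) * fact M * fact (n - 1) / fact (M + (n - 1) + 1)"
    (is "_ = ?v")
proof -
  let ?f = "\<lambda>t. t ^ M * dirichlet_weight n q t"
  have [measurable]: "dirichlet_weight n q \<in> borel_measurable borel"
    using cutoff_weight_dirichlet[OF q] by (simp add: cutoff_weight_def)
  have nn: "0 \<le> ?f t" if "t \<in> {0..1}" for t
    using that cutoff_weight_dirichlet[OF q] by (auto simp: cutoff_weight_def)
  have "((\<lambda>t. if t \<in> {0..q} then t ^ M * (1 - t / q) ^ (n - 1) else 0) has_integral ?v) {0..1}"
    using has_integral_beta[OF q(1), of M "n - 1"] q by (subst has_integral_restrict) auto
  then have hi: "(?f has_integral ?v) {0..1}"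
    by (rule has_integral_eq[rotated]) (auto simp: dirichlet_weight_def)
  have "(\<integral>\<^sup>+t. ennreal (?f t) \<partial>unit_interval_measure) = (\<integral>\<^sup>+t. ennreal (?f t) * indicator {0..1} t \<partial>lborel) / ennreal 1"
    by (subst nn_integral_uniform_measure) simp_all
  also have "\<dots> = ennreal ?v / ennreal 1"
    by (simp only: nn_integral_has_integral_lebesgue'[OF nn hi])
  also have "\<dots> = ennreal ?v"
    by (subst divide_ennreal) (use q in simp_all)
  finally have "(\<integral>\<^sup>+t. ennreal (?f t) \<partial>unit_interval_measure) = ennreal ?v" .
  moreover have "AE t in unit_interval_measure. 0 \<le> ?f t"
    using AE_unit_interval by eventually_elim (rule nn)
  ultimately have "has_bochner_integral unit_interval_measure ?f ?v"
    using q by (intro has_bochner_integral_nn_integral) auto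
  then show ?thesis unfolding weight_moment_def by (simp add: has_bochner_integral_integral_eq)
qed

section \<open>Positivity of Toeplitz sums\<close>

lemma Re_toeplitz_sum:
  "Re (toeplitz_sum \<mu> c K a) = (\<Sum>k<K. \<Sum>l<K. c k l * Re (circle_moment \<mu> k l (a k) (a l)))"
  by (simp add: toeplitz_sum_def)

lemma toeplitz_sum_cong:
  "(\<And>k l. k < K \<Longrightarrow> l < K \<Longrightarrow> c k l = d k l) \<Longrightarrow> (\<And>k. k < K \<Longrightarrow> a k = b k) \<Longrightarrow>
    toeplitz_sum \<mu> c K a = toeplitz_sum \<mu> d K b"
  unfolding toeplitz_sum_def by (intro sum.cong refl) auto

text \<open>The kernel of the Dirichlet integral of order \<open>n\<close> with the weight \<open>(1 - t / q) ^ (n - 1)\<close>, up to a constant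
  factor (\<open>cutoff_dirichlet_finite\<close>).\<close>

definition binom_kernel :: "nat \<Rightarrow> real \<Rightarrow> nat \<Rightarrow> nat \<Rightarrow> real" where
  "binom_kernel n q k l = of_nat (min k l choose n) * q ^ max k l"

lemma sum_lessThan_shift:
  fixes f :: "nat \<Rightarrow> 'b::comm_monoid_add"
  assumes "\<And>k. k < n \<Longrightarrow> f k = 0" shows "(\<Sum>k<K + n. f k) = (\<Sum>k<K. f (k + n))"
proof -
  have "(\<Sum>k<K + n. f k) = (\<Sum>k\<in>{n..<K + n}. f k)"
    by (rule sum.mono_neutral_right) (use assms in auto)
  also have "\<dots> = (\<Sum>k<K. f (k + n))"
    using sum.shift_bounds_nat_ivl[of f 0 n K] by (simp add: lessThan_atLeast0)
  finally show ?thesis .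
qed

lemma coeff_deriv_pow_truncate: "(coeff_deriv ^^ n) (truncate (K + n) a) = truncate K ((coeff_deriv ^^ n) a)"
  by (auto simp: fun_eq_iff coeff_deriv_pow truncate_def)

context
  fixes \<mu> :: "complex set \<Rightarrow> 'a::chilbert_space \<Rightarrow> 'a"
  assumes \<mu>: "semi_spectral_measure \<mu>"
begin

lemma radial_integral_nonneg:
  assumes "cutoff_weight w q" shows "0 \<le> radial_integral \<mu> w b"
  unfolding radial_integral_def
proof (rule integral_nonneg_AE)
  show "AE z in disc_measure. 0 \<le> poisson_quad \<mu> z (disc_series b z) * w ((norm z)\<^sup>2)"
    using AE_disc_measure
    by eventually_elim (use assms poisson_quad_nonneg[OF \<mu>] in \<open>auto simp: cutoff_weight_def\<close>)
qed

text \<open>The sum with the kernel \<open>q ^ (max k l + 1) / (max k l + 1)\<close> is an integral over the disc of radius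
  \<open>sqrt q\<close>, so it increases with \<open>q\<close>; the claim is that its derivative is nonnegative.\<close>

lemma toeplitz_sum_power_nonneg:
  assumes q: "0 < q" "q < 1"
  shows "0 \<le> Re (toeplitz_sum \<mu> (\<lambda>k l. q ^ max k l) K b)"
proof -
  define b' where "b' = truncate K b"
  define m where "m k l = Re (circle_moment \<mu> k l (b' k) (b' l))" for k l
  define H where "H q = (\<Sum>k<K. \<Sum>l<K. (q ^ (max k l + 1) / real (max k l + 1)) * m k l)" for q
  have b': "disc_summable b'" unfolding b'_def by (rule disc_summable_truncate)
  have HJ: "H p = radial_integral \<mu> (dirichlet_weight 1 p) b'" if p: "0 < p" "p < 1" for p
  proof -
    have "Re (complex_of_real (radial_integral \<mu> (dirichlet_weight 1 p) b')) =
        (\<Sum>k<K. \<Sum>l<K. weight_moment (dirichlet_weight 1 p) (max k l) * m k l)"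
      by (subst radial_integral_finite[OF \<mu> _ cutoff_weight_dirichlet[OF p], of K])
        (auto simp: b'_def truncate_def Re_toeplitz_sum m_def)
    then show ?thesis
      by (simp add: H_def weight_moment_dirichlet[OF p] field_simps del: of_nat_Suc)
  qed
  have mono: "H p \<le> H p'" if p: "0 < p" "p \<le> p'" "p' < 1" for p p'
  proof -
    have w: "cutoff_weight (dirichlet_weight 1 p) p" "cutoff_weight (dirichlet_weight 1 p') p'"
      using p by (auto intro: cutoff_weight_dirichlet)
    have "radial_integral \<mu> (dirichlet_weight 1 p) b' \<le> radial_integral \<mu> (dirichlet_weight 1 p') b'"
      unfolding radial_integral_def
    proof (rule integral_mono_AE[OF integrable_radial_integrand[OF \<mu> b' w(1)] integrable_radial_integrand[OF \<mu> b' w(2)]])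
      show "AE z in disc_measure. poisson_quad \<mu> z (disc_series b' z) * dirichlet_weight 1 p ((norm z)\<^sup>2)
          \<le> poisson_quad \<mu> z (disc_series b' z) * dirichlet_weight 1 p' ((norm z)\<^sup>2)"
        using AE_disc_measure
        by eventually_elim (use p poisson_quad_nonneg[OF \<mu>] in \<open>auto intro!: mult_left_mono dirichlet_weight_mono\<close>)
    qed
    then show ?thesis using HJ[of p] HJ[of p'] p by simp
  qed
  have der: "(H has_real_derivative (\<Sum>k<K. \<Sum>l<K. q ^ max k l * m k l)) (at q)"
    unfolding H_def
  proof (intro DERIV_sum)
    fix k l
    show "((\<lambda>q. q ^ (max k l + 1) / real (max k l + 1) * m k l) has_real_derivative q ^ max k l * m k l) (at q)"
    proof -
      have "((\<lambda>q. q ^ (max k l + 1)) has_real_derivative real (max k l + 1) * q ^ max k l) (at q)"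
        using DERIV_pow[of "max k l + 1" q UNIV] by simp
      from DERIV_cmult_right[OF DERIV_cdivide[OF this, of "real (max k l + 1)"], of "m k l"]
      show ?thesis by (simp del: of_nat_Suc of_nat_add)
    qed
  qed
  have "0 \<le> (\<Sum>k<K. \<Sum>l<K. q ^ max k l * m k l)"
  proof (rule ccontr)
    assume "\<not> ?thesis"
    then obtain d where d: "d > 0" "\<And>h. 0 < h \<Longrightarrow> h < d \<Longrightarrow> H (q + h) < H q"
      using DERIV_neg_dec_right[OF der] by (meson not_le)
    \<comment> \<open>A step that stays in the range of the derivative estimate and below 1.\<close>
    define h where "h = min (d / 2) ((1 - q) / 2)"
    have "0 < h" "h < d" "q + h < 1" using d q by (auto simp: h_def min_def field_simps)
    with d(2)[of h] mono[of q "q + h"] q show False by simp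
  qed
  also have "\<dots> = Re (toeplitz_sum \<mu> (\<lambda>k l. q ^ max k l) K b')" by (simp add: Re_toeplitz_sum m_def)
  also have "toeplitz_sum \<mu> (\<lambda>k l. q ^ max k l) K b' = toeplitz_sum \<mu> (\<lambda>k l. q ^ max k l) K b"
    by (rule toeplitz_sum_cong) (auto simp: b'_def truncate_def)
  finally show ?thesis .
qed

text \<open>A monotone function of \<open>min k l\<close> is a nonnegative combination of the indicator functions of
  \<open>p \<le> k \<and> p \<le> l\<close>, and each of these restricts the sum to a tail of the sequence.\<close>

lemma toeplitz_sum_min_nonneg:
  assumes q: "0 < q" "q < 1" and mono: "mono \<phi>" and nn: "0 \<le> \<phi> (0::nat)"
  shows "0 \<le> Re (toeplitz_sum \<mu> (\<lambda>k l. \<phi> (min k l) * q ^ max k l) K b)"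
proof -
  define \<Delta> where "\<Delta> p = (case p of 0 \<Rightarrow> \<phi> 0 | Suc i \<Rightarrow> \<phi> p - \<phi> i)" for p
  have \<Delta>0: "0 \<le> \<Delta> p" for p using mono nn by (auto simp: \<Delta>_def mono_def split: nat.split)
  have tel: "(\<Sum>p\<le>m. \<Delta> p) = \<phi> m" for m
    by (induction m) (auto simp: \<Delta>_def)
  have \<phi>: "\<phi> (min k l) = (\<Sum>p<K. \<Delta> p * (if p \<le> k \<and> p \<le> l then 1 else 0))" if "k < K" "l < K" for k l
  proof -
    have "(\<Sum>p<K. \<Delta> p * (if p \<le> k \<and> p \<le> l then 1 else 0)) = (\<Sum>p\<le>min k l. \<Delta> p)"
      by (rule sum.mono_neutral_cong_right) (use that in auto)
    then show ?thesis by (simp add: tel)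
  qed
  define tail where "tail p k = (if p \<le> k then b k else 0)" for p k
  define R where "R k l = q ^ max k l * Re (circle_moment \<mu> k l (b k) (b l))" for k l
  have tail: "Re (toeplitz_sum \<mu> (\<lambda>k l. q ^ max k l) K (tail p)) =
      (\<Sum>k<K. \<Sum>l<K. (if p \<le> k \<and> p \<le> l then 1 else 0) * R k l)" for p
    unfolding Re_toeplitz_sum R_def tail_def
    by (intro sum.cong refl) (auto simp: circle_moment_zero[OF \<mu>])
  have "Re (toeplitz_sum \<mu> (\<lambda>k l. \<phi> (min k l) * q ^ max k l) K b) =
      (\<Sum>k<K. \<Sum>l<K. \<Sum>p<K. \<Delta> p * ((if p \<le> k \<and> p \<le> l then 1 else 0) * R k l))"
    unfolding Re_toeplitz_sum
    by (intro sum.cong refl) (simp only: \<phi> lessThan_iff R_def sum_distrib_right mult.assoc)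
  also have "\<dots> = (\<Sum>k<K. \<Sum>p<K. \<Sum>l<K. \<Delta> p * ((if p \<le> k \<and> p \<le> l then 1 else 0) * R k l))"
    by (rule sum.cong[OF refl], rule sum.swap)
  also have "\<dots> = (\<Sum>p<K. \<Sum>k<K. \<Sum>l<K. \<Delta> p * ((if p \<le> k \<and> p \<le> l then 1 else 0) * R k l))"
    by (rule sum.swap)
  also have "\<dots> = (\<Sum>p<K. \<Delta> p * Re (toeplitz_sum \<mu> (\<lambda>k l. q ^ max k l) K (tail p)))"
    unfolding tail sum_distrib_left ..
  also have "0 \<le> \<dots>" by (intro sum_nonneg mult_nonneg_nonneg \<Delta>0 toeplitz_sum_power_nonneg[OF q])
  finally show ?thesis .
qed

lemma toeplitz_binom_nonneg:
  assumes "0 < q" "q < 1" shows "0 \<le> Re (toeplitz_sum \<mu> (binom_kernel n q) K b)"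
  unfolding binom_kernel_def
  by (rule toeplitz_sum_min_nonneg[OF assms]) (auto simp: mono_def intro: binomial_right_mono)

text \<open>The function \<open>n * (k choose n) - (k choose (n - 1)) = (k choose (n - 1)) * (k - n)\<close> increases
  for \<open>k \<ge> n\<close>; truncated subtraction extends it to a monotone function.\<close>

lemma toeplitz_binom_le:
  assumes q: "0 < q" "q < 1" and n: "1 \<le> n" and b: "\<And>k. k < n \<Longrightarrow> b k = 0"
  shows "Re (toeplitz_sum \<mu> (binom_kernel (n - 1) q) K b) \<le> n * Re (toeplitz_sum \<mu> (binom_kernel n q) K b)"
proof -
  define \<phi> where "\<phi> k = real ((k choose (n - 1)) * (k - n))" for k
  have "mono \<phi>"
    unfolding \<phi>_def mono_def by (auto intro!: mult_mono binomial_right_mono simp del: of_nat_mult)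
  then have "0 \<le> Re (toeplitz_sum \<mu> (\<lambda>k l. \<phi> (min k l) * q ^ max k l) K b)"
    by (rule toeplitz_sum_min_nonneg[OF q]) (simp add: \<phi>_def)
  also have "\<dots> = (\<Sum>k<K. \<Sum>l<K. n * (binom_kernel n q k l * Re (circle_moment \<mu> k l (b k) (b l))) -
      binom_kernel (n - 1) q k l * Re (circle_moment \<mu> k l (b k) (b l)))"
    unfolding Re_toeplitz_sum
  proof (intro sum.cong refl)
    fix k l
    show "\<phi> (min k l) * q ^ max k l * Re (circle_moment \<mu> k l (b k) (b l)) =
      n * (binom_kernel n q k l * Re (circle_moment \<mu> k l (b k) (b l))) -
      binom_kernel (n - 1) q k l * Re (circle_moment \<mu> k l (b k) (b l))"
    proof (cases "n \<le> min k l")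
      case True
      define M where "M = min k l"
      have "n * (M choose n) = (M - (n - 1)) * (M choose (n - 1))"
        using binomial_absorb_comp[of M "n - 1"] binomial_absorption[of "n - 1" "M - 1"] n True
          times_binomial_minus1_eq[of n M] binomial_absorb_comp[of M "n - 1"]
        by (simp add: M_def)
      also have "M - (n - 1) = M - n + 1" using True[folded M_def] n by linarith
      finally have "real (n * (M choose n)) = real ((M - n + 1) * (M choose (n - 1)))" by (rule arg_cong)
      then have "real n * real (M choose n) = (real M - real n + 1) * real (M choose (n - 1))"
        using True by (simp add: M_def of_nat_diff algebra_simps)
      then have \<phi>M: "\<phi> M = n * real (M choose n) - real (M choose (n - 1))"
        using True by (simp add: \<phi>_def M_def of_nat_diff algebra_simps)
      show ?thesis unfolding binom_kernel_def M_def[symmetric] \<phi>M by (simp add: algebra_simps)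
    next
      case False
      then have "b k = 0 \<or> b l = 0" using b by (auto simp: min_def split: if_splits)
      then show ?thesis by (auto simp: circle_moment_zero[OF \<mu>])
    qed
  qed
  also have "\<dots> = n * Re (toeplitz_sum \<mu> (binom_kernel n q) K b) - Re (toeplitz_sum \<mu> (binom_kernel (n - 1) q) K b)"
    unfolding Re_toeplitz_sum by (simp add: sum_subtractf sum_distrib_left)
  finally show ?thesis by simp
qed

text \<open>Pascal's rule.\<close>

lemma toeplitz_binom_shift:
  assumes n: "1 \<le> n"
  shows "toeplitz_sum \<mu> (binom_kernel n q) (Suc K) (coeff_shift b) =
    of_real q * (toeplitz_sum \<mu> (binom_kernel n q) K b + toeplitz_sum \<mu> (binom_kernel (n - 1) q) K b)"
proof -
  have "toeplitz_sum \<mu> (binom_kernel n q) (Suc K) (coeff_shift b) =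
      (\<Sum>k<K. \<Sum>l<K. of_real (binom_kernel n q (Suc k) (Suc l)) * circle_moment \<mu> k l (b k) (b l))"
    unfolding toeplitz_sum_def
    by (simp only: sum.lessThan_Suc_shift coeff_shift_def nat.case circle_moment_zero[OF \<mu>] mult_zero_right
        sum.neutral_const add_0 circle_moment_shift[OF \<mu>, of _ 1, unfolded Suc_eq_plus1[symmetric]])
  also have "\<dots> = (\<Sum>k<K. \<Sum>l<K. of_real q * (of_real (binom_kernel n q k l) * circle_moment \<mu> k l (b k) (b l) +
      of_real (binom_kernel (n - 1) q k l) * circle_moment \<mu> k l (b k) (b l)))"
  proof (intro sum.cong refl)
    fix k l
    have "binom_kernel n q (Suc k) (Suc l) = q * (binom_kernel n q k l + binom_kernel (n - 1) q k l)"
      using n by (cases n) (simp_all add: binom_kernel_def algebra_simps)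
    then show "of_real (binom_kernel n q (Suc k) (Suc l)) * circle_moment \<mu> k l (b k) (b l) =
      of_real q * (of_real (binom_kernel n q k l) * circle_moment \<mu> k l (b k) (b l) +
      of_real (binom_kernel (n - 1) q k l) * circle_moment \<mu> k l (b k) (b l))"
      by (simp add: algebra_simps)
  qed
  also have "\<dots> = of_real q * (toeplitz_sum \<mu> (binom_kernel n q) K b + toeplitz_sum \<mu> (binom_kernel (n - 1) q) K b)"
    unfolding toeplitz_sum_def by (simp only: sum_distrib_left sum.distrib distrib_left)
  finally show ?thesis .
qed

end

section \<open>Dirichlet integrals of power series\<close>

definition cutoff_dirichlet ::
  "(complex set \<Rightarrow> 'a::chilbert_space \<Rightarrow> 'a) \<Rightarrow> nat \<Rightarrow> real \<Rightarrow> (nat \<Rightarrow> 'a) \<Rightarrow> real" where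
  "cutoff_dirichlet \<mu> n q a =
    radial_integral \<mu> (dirichlet_weight n q) ((coeff_deriv ^^ n) a) / (fact n * fact (n - 1))"

text \<open>A sequence that increases to 1; the lower bound \<open>1 / 2\<close> is used for a uniform estimate.\<close>

definition cutoff :: "nat \<Rightarrow> real" where
  "cutoff i = 1 - 1 / real (i + 2)"

lemma cutoff_bounds: "1 / 2 \<le> cutoff i" "0 < cutoff i" "cutoff i < 1"
  by (auto simp: cutoff_def field_simps)

lemma cutoff_mono: "i \<le> j \<Longrightarrow> cutoff i \<le> cutoff j"
  by (auto simp: cutoff_def field_simps)

lemma cutoff_tendsto: "cutoff \<longlonglongrightarrow> 1"
proof -
  have "(\<lambda>i. 1 - inverse (real (Suc (Suc i)))) \<longlonglongrightarrow> 1 - 0"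
    by (intro tendsto_intros LIMSEQ_Suc[OF LIMSEQ_inverse_real_of_nat])
  then show ?thesis by (simp add: cutoff_def[abs_def] inverse_eq_divide)
qed

lemma coeff_shift_finite: "\<forall>j\<ge>K. a j = 0 \<Longrightarrow> \<forall>j\<ge>Suc K. coeff_shift a j = 0"
  by (auto simp: coeff_shift_def split: nat.split)

lemma coeff_shift_add: "coeff_shift (a + b) = coeff_shift a + coeff_shift b"
  by (auto simp: fun_eq_iff coeff_shift_def split: nat.split)

lemma disc_summable_shift:
  assumes "disc_summable a" shows "disc_summable (coeff_shift a)"
  unfolding disc_summable_def
proof (intro allI impI)
  fix r :: real assume r: "0 \<le> r" "r < 1"
  have "summable (\<lambda>j. r * (norm (a j) * r ^ j))" by (rule summable_mult[OF disc_summableD[OF assms r]])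
  then show "summable (\<lambda>j. norm (coeff_shift a j) * r ^ j)"
    by (subst summable_Suc_iff[symmetric]) (simp add: coeff_shift_def mult_ac)
qed

lemma coeff_deriv_pow_add: "(coeff_deriv ^^ n) (a + b) = (coeff_deriv ^^ n) a + (coeff_deriv ^^ n) b"
  by (simp add: fun_eq_iff coeff_deriv_pow scaleC_add_right)

lemma coeff_deriv_pow_scaleC: "(coeff_deriv ^^ n) (c *\<^sub>C a) = c *\<^sub>C (coeff_deriv ^^ n) a"
  by (simp add: fun_eq_iff coeff_deriv_pow scaleC_fun_def scaleC_scaleC mult.commute)

context
  fixes \<mu> :: "complex set \<Rightarrow> 'a::chilbert_space \<Rightarrow> 'a"
  assumes \<mu>: "semi_spectral_measure \<mu>"
begin

lemma cutoff_dirichlet_nonneg: "0 < q \<Longrightarrow> q < 1 \<Longrightarrow> 0 \<le> cutoff_dirichlet \<mu> n q a"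
  unfolding cutoff_dirichlet_def using radial_integral_nonneg[OF \<mu> cutoff_weight_dirichlet] by simp

lemma toeplitz_sum_extend:
  assumes "\<forall>j\<ge>K. a j = 0"
  shows "toeplitz_sum \<mu> c (K + n) a = toeplitz_sum \<mu> c K a"
proof -
  have "toeplitz_sum \<mu> c (K + n) a = (\<Sum>k<K + n. \<Sum>l<K. of_real (c k l) * circle_moment \<mu> k l (a k) (a l))"
    unfolding toeplitz_sum_def
    by (rule sum.cong[OF refl], rule sum.mono_neutral_right) (use assms circle_moment_zero[OF \<mu>] in auto)
  also have "\<dots> = toeplitz_sum \<mu> c K a"
    unfolding toeplitz_sum_def
    by (rule sum.mono_neutral_right) (use assms circle_moment_zero[OF \<mu>] in auto)
  finally show ?thesis .
qed

text \<open>Differentiation multiplies the coefficients by \<open>fact (k + n) / fact k\<close> and \<open>fact (l + n) / fact l\<close>; the factor that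
  belongs to \<open>max k l\<close> cancels against the moment of the weight, and the one that belongs to \<open>min k l\<close> gives the
  binomial coefficient.\<close>

lemma cutoff_dirichlet_finite:
  assumes a: "\<forall>j\<ge>K. a j = 0" and q: "0 < q" "q < 1" and n: "1 \<le> n"
  shows "q ^ (n - 1) * cutoff_dirichlet \<mu> n q a = Re (toeplitz_sum \<mu> (binom_kernel n q) K a)"
proof -
  let ?b = "(coeff_deriv ^^ n) a"
  let ?m = "\<lambda>k l. Re (circle_moment \<mu> k l (a (k + n)) (a (l + n)))"
  define c where "c k = (fact (k + n) / fact k :: real)" for k
  have b: "?b k = of_real (c k) *\<^sub>C a (k + n)" for k by (simp add: coeff_deriv_pow c_def)
  have fin: "?b j = 0" if "K \<le> j" for j using a that by (simp add: b)
  have "complex_of_real (radial_integral \<mu> (dirichlet_weight n q) ?b) =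
      toeplitz_sum \<mu> (\<lambda>k l. weight_moment (dirichlet_weight n q) (max k l)) K ?b"
    by (rule radial_integral_finite[OF \<mu> _ cutoff_weight_dirichlet[OF q]]) (rule fin)
  then have "radial_integral \<mu> (dirichlet_weight n q) ?b =
      Re (toeplitz_sum \<mu> (\<lambda>k l. weight_moment (dirichlet_weight n q) (max k l)) K ?b)"
    by (metis Re_complex_of_real)
  also have "\<dots> = (\<Sum>k<K. \<Sum>l<K. weight_moment (dirichlet_weight n q) (max k l) * (c k * c l * ?m k l))"
    unfolding Re_toeplitz_sum b sesquilinearD(3,4)[OF sesquilinear_circle_moment[OF \<mu>]]
    by (simp add: mult_ac)
  finally have "q ^ (n - 1) * cutoff_dirichlet \<mu> n q a =
      (\<Sum>k<K. \<Sum>l<K. q ^ (n - 1) * (weight_moment (dirichlet_weight n q) (max k l) * (c k * c l * ?m k l)) / (fact n * fact (n - 1)))"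
    unfolding cutoff_dirichlet_def by (simp add: sum_distrib_left sum_divide_distrib)
  also have "\<dots> = (\<Sum>k<K. \<Sum>l<K. binom_kernel n q (k + n) (l + n) * ?m k l)"
  proof (intro sum.cong refl)
    fix k l :: nat
    define M where "M = max k l"
    define L where "L = min k l"
    have cc: "c k * c l = c M * c L" by (simp add: M_def L_def max_def min_def)
    have ch: "real (L + n choose n) = fact (L + n) / (fact n * fact L)"
      using binomial_fact[of n "L + n", where 'a = real] by simp
    have w: "weight_moment (dirichlet_weight n q) M = q ^ (M + 1) * fact M * fact (n - 1) / fact (M + n)"
      using n by (simp add: weight_moment_dirichlet[OF q] del: fact_Suc)
    have qp: "q ^ (n - 1) * q ^ (M + 1) = q ^ (M + n)" 
      unfolding power_add[symmetric] by (rule arg_cong[where f = "power q"]) (use n in simp)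
    have "q ^ (n - 1) * (weight_moment (dirichlet_weight n q) M * (c M * c L)) / (fact n * fact (n - 1)) =
        (q ^ (n - 1) * q ^ (M + 1)) * (fact (L + n) / (fact n * fact L))"
      unfolding w c_def by (simp add: field_simps del: fact_Suc power_Suc)
    also have "\<dots> = binom_kernel n q (k + n) (l + n)"
      unfolding qp ch[symmetric]
      by (simp add: binom_kernel_def M_def L_def max_add_distrib_left min_add_distrib_left)
    finally have "q ^ (n - 1) * (weight_moment (dirichlet_weight n q) M * (c k * c l)) / (fact n * fact (n - 1)) =
        binom_kernel n q (k + n) (l + n)" by (simp only: cc)
    from arg_cong[OF this, of "\<lambda>x. x * ?m k l"]
    show "q ^ (n - 1) * (weight_moment (dirichlet_weight n q) (max k l) * (c k * c l * ?m k l)) / (fact n * fact (n - 1)) =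
        binom_kernel n q (k + n) (l + n) * ?m k l"
      unfolding M_def by (simp only: times_divide_eq_left mult.assoc)
  qed
  also have "\<dots> = (\<Sum>k<K. \<Sum>l<K + n. binom_kernel n q (k + n) l * Re (circle_moment \<mu> (k + n) l (a (k + n)) (a l)))"
    by (rule sum.cong[OF refl], subst sum_lessThan_shift)
      (auto simp: binom_kernel_def circle_moment_shift[OF \<mu>])
  also have "\<dots> = Re (toeplitz_sum \<mu> (binom_kernel n q) (K + n) a)"
    unfolding Re_toeplitz_sum
    by (rule sum_lessThan_shift[symmetric]) (auto simp: binom_kernel_def intro!: sum.neutral)
  finally show ?thesis by (simp only: toeplitz_sum_extend[OF a])
qed

lemma toeplitz_sum_tendsto:
  assumes a: "disc_summable a" and q: "0 < q" "q < 1" and n: "1 \<le> n"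
  shows "(\<lambda>K. Re (toeplitz_sum \<mu> (binom_kernel n q) K a)) \<longlonglongrightarrow> q ^ (n - 1) * cutoff_dirichlet \<mu> n q a"
proof -
  have "(\<lambda>K. radial_integral \<mu> (dirichlet_weight n q) (truncate K ((coeff_deriv ^^ n) a)))
      \<longlonglongrightarrow> radial_integral \<mu> (dirichlet_weight n q) ((coeff_deriv ^^ n) a)"
    by (rule radial_integral_truncate[OF \<mu> disc_summable_deriv_pow[OF a] cutoff_weight_dirichlet[OF q]])
  then have "(\<lambda>K. q ^ (n - 1) * cutoff_dirichlet \<mu> n q (truncate (K + n) a)) \<longlonglongrightarrow> q ^ (n - 1) * cutoff_dirichlet \<mu> n q a"
    unfolding cutoff_dirichlet_def coeff_deriv_pow_truncate by (intro tendsto_intros) auto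
  moreover have "q ^ (n - 1) * cutoff_dirichlet \<mu> n q (truncate K a) = Re (toeplitz_sum \<mu> (binom_kernel n q) K a)" for K
  proof -
    have "toeplitz_sum \<mu> (binom_kernel n q) K (truncate K a) = toeplitz_sum \<mu> (binom_kernel n q) K a"
      by (rule toeplitz_sum_cong) (auto simp: truncate_def)
    then show ?thesis by (subst cutoff_dirichlet_finite[OF _ q n, of K]) (auto simp: truncate_def)
  qed
  ultimately show ?thesis by (simp add: LIMSEQ_offset)
qed

lemma cutoff_dirichlet_le_shift:
  assumes a: "disc_summable a" and q: "0 < q" "q < 1" and n: "1 \<le> n"
  shows "q * cutoff_dirichlet \<mu> n q a \<le> cutoff_dirichlet \<mu> n q (coeff_shift a)"
proof -
  have "q * (q ^ (n - 1) * cutoff_dirichlet \<mu> n q a) \<le> q ^ (n - 1) * cutoff_dirichlet \<mu> n q (coeff_shift a)"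
  proof (rule LIMSEQ_le)
    show "(\<lambda>K. q * Re (toeplitz_sum \<mu> (binom_kernel n q) K a)) \<longlonglongrightarrow> q * (q ^ (n - 1) * cutoff_dirichlet \<mu> n q a)"
      by (intro tendsto_intros toeplitz_sum_tendsto[OF a q n])
    show "(\<lambda>K. Re (toeplitz_sum \<mu> (binom_kernel n q) (Suc K) (coeff_shift a))) \<longlonglongrightarrow> q ^ (n - 1) * cutoff_dirichlet \<mu> n q (coeff_shift a)"
      by (rule LIMSEQ_Suc[OF toeplitz_sum_tendsto[OF disc_summable_shift[OF a] q n]])
    have "q * Re (toeplitz_sum \<mu> (binom_kernel n q) K a) \<le> Re (toeplitz_sum \<mu> (binom_kernel n q) (Suc K) (coeff_shift a))" for K
      using toeplitz_binom_nonneg[OF \<mu> q, of "n - 1" K a] q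
      by (simp add: toeplitz_binom_shift[OF \<mu> n])
    then show "\<exists>N. \<forall>K\<ge>N. q * Re (toeplitz_sum \<mu> (binom_kernel n q) K a) \<le> Re (toeplitz_sum \<mu> (binom_kernel n q) (Suc K) (coeff_shift a))"
      by blast
  qed
  then have "q ^ (n - 1) * (q * cutoff_dirichlet \<mu> n q a) \<le> q ^ (n - 1) * cutoff_dirichlet \<mu> n q (coeff_shift a)"
    by (simp only: mult_ac)
  then show ?thesis using q by simp
qed

lemma cutoff_dirichlet_shift_le:
  assumes a: "disc_summable a" "\<forall>k<n. a k = 0" and q: "0 < q" "q < 1" and n: "1 \<le> n"
  shows "cutoff_dirichlet \<mu> n q (coeff_shift a) \<le> (n + 1) * cutoff_dirichlet \<mu> n q a"
proof -
  have "q ^ (n - 1) * cutoff_dirichlet \<mu> n q (coeff_shift a) \<le> q * ((n + 1) * (q ^ (n - 1) * cutoff_dirichlet \<mu> n q a))"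
  proof (rule LIMSEQ_le)
    show "(\<lambda>K. q * ((n + 1) * Re (toeplitz_sum \<mu> (binom_kernel n q) K a))) \<longlonglongrightarrow> q * ((n + 1) * (q ^ (n - 1) * cutoff_dirichlet \<mu> n q a))"
      by (intro tendsto_intros toeplitz_sum_tendsto[OF a(1) q n])
    show "(\<lambda>K. Re (toeplitz_sum \<mu> (binom_kernel n q) (Suc K) (coeff_shift a))) \<longlonglongrightarrow> q ^ (n - 1) * cutoff_dirichlet \<mu> n q (coeff_shift a)"
      by (rule LIMSEQ_Suc[OF toeplitz_sum_tendsto[OF disc_summable_shift[OF a(1)] q n]])
    have "Re (toeplitz_sum \<mu> (binom_kernel n q) (Suc K) (coeff_shift a)) \<le> q * ((n + 1) * Re (toeplitz_sum \<mu> (binom_kernel n q) K a))" for K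
      using toeplitz_binom_le[OF \<mu> q n, of a K] a(2) q
      by (simp add: toeplitz_binom_shift[OF \<mu> n] algebra_simps)
    then show "\<exists>N. \<forall>K\<ge>N. Re (toeplitz_sum \<mu> (binom_kernel n q) (Suc K) (coeff_shift a)) \<le> q * ((n + 1) * Re (toeplitz_sum \<mu> (binom_kernel n q) K a))"
      by blast
  qed
  then have "q ^ (n - 1) * cutoff_dirichlet \<mu> n q (coeff_shift a) \<le> q ^ (n - 1) * (q * ((n + 1) * cutoff_dirichlet \<mu> n q a))"
    by (simp only: mult_ac)
  then have "cutoff_dirichlet \<mu> n q (coeff_shift a) \<le> q * ((n + 1) * cutoff_dirichlet \<mu> n q a)" using q by simp
  also have "\<dots> \<le> 1 * ((n + 1) * cutoff_dirichlet \<mu> n q a)"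
    using q cutoff_dirichlet_nonneg[OF q] by (intro mult_right_mono) auto
  finally show ?thesis by (simp add: add.commute)
qed

lemma dirichlet_integral_disc_series:
  assumes a: "disc_summable a"
  shows "dirichlet_integral \<mu> n (disc_series a) = ennreal (1 / (fact n * fact (n - 1))) *
    (\<integral>\<^sup>+ z. ennreal (poisson_quad \<mu> z (disc_series ((coeff_deriv ^^ n) a) z) * (1 - (norm z)\<^sup>2) ^ (n - 1)) \<partial>disc_measure)"
  unfolding dirichlet_integral_def
proof (intro arg_cong2[where f = "(*)"] refl nn_integral_cong_AE)
  show "AE z in disc_measure. ennreal (Re (cinner (poisson_integral \<mu> z ((cderiv ^^ n) (disc_series a) z)) ((cderiv ^^ n) (disc_series a) z)) *
      (1 - (norm z)\<^sup>2) ^ (n - 1)) =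
      ennreal (poisson_quad \<mu> z (disc_series ((coeff_deriv ^^ n) a) z) * (1 - (norm z)\<^sup>2) ^ (n - 1))"
    using AE_disc_measure
    by eventually_elim (simp only: cderiv_pow_disc_series[OF a] poisson_integral_quad[OF \<mu>] Re_complex_of_real)
qed

text \<open>Monotone convergence: the weights increase to the full weight.\<close>

lemma dirichlet_integral_SUP:
  assumes a: "disc_summable a"
  shows "incseq (\<lambda>i. ennreal (cutoff_dirichlet \<mu> n (cutoff i) a))"
    and "dirichlet_integral \<mu> n (disc_series a) = (SUP i. ennreal (cutoff_dirichlet \<mu> n (cutoff i) a))"
proof -
  let ?b = "(coeff_deriv ^^ n) a"
  let ?W = "\<lambda>z. poisson_quad \<mu> z (disc_series ?b z)"
  note b = disc_summable_deriv_pow[OF a, of n]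
  define f where "f i z = ennreal (?W z * dirichlet_weight n (cutoff i) ((norm z)\<^sup>2))" for i z
  have W0: "0 \<le> ?W z" for z
    by (cases "z \<in> disc") (simp_all add: poisson_quad_nonneg[OF \<mu>] disc_series_def poisson_quad_zero[OF \<mu>])
  have w: "cutoff_weight (dirichlet_weight n (cutoff i)) (cutoff i)" for i
    by (rule cutoff_weight_dirichlet[OF cutoff_bounds(2,3)])
  have inc: "incseq f"
    unfolding incseq_def le_fun_def f_def
    by (intro allI impI ennreal_leI mult_left_mono dirichlet_weight_mono cutoff_mono cutoff_bounds W0) auto
  have J: "integral\<^sup>N disc_measure (f i) = ennreal (radial_integral \<mu> (dirichlet_weight n (cutoff i)) ?b)" for i
    unfolding f_def radial_integral_def
    by (rule nn_integral_eq_integral[OF integrable_radial_integrand[OF \<mu> b w]])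
      (use W0 dirichlet_weight_bounds(1)[OF cutoff_bounds(2)] in auto)
  have lim: "(SUP i. f i z) = ennreal (?W z * (1 - (norm z)\<^sup>2) ^ (n - 1))" if z: "z \<in> disc" for z
  proof (rule LIMSEQ_unique[OF LIMSEQ_SUP])
    show "incseq (\<lambda>i. f i z)" using inc by (simp add: incseq_def le_fun_def)
    have t: "(norm z)\<^sup>2 < 1" using z by (simp add: power_less_one_iff)
    have ev: "\<forall>\<^sub>F i in sequentially. (norm z)\<^sup>2 < cutoff i"
      using cutoff_tendsto t by (rule order_tendstoD)
    have "(\<lambda>i. ?W z * (1 - (norm z)\<^sup>2 / cutoff i) ^ (n - 1)) \<longlonglongrightarrow> ?W z * (1 - (norm z)\<^sup>2 / 1) ^ (n - 1)"
      by (intro tendsto_intros cutoff_tendsto) simp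
    then have "(\<lambda>i. ?W z * dirichlet_weight n (cutoff i) ((norm z)\<^sup>2)) \<longlonglongrightarrow> ?W z * (1 - (norm z)\<^sup>2 / 1) ^ (n - 1)"
      by (rule Lim_transform_eventually) (use ev in \<open>eventually_elim, simp add: dirichlet_weight_def\<close>)
    then show "(\<lambda>i. f i z) \<longlonglongrightarrow> ennreal (?W z * (1 - (norm z)\<^sup>2) ^ (n - 1))"
      unfolding f_def by (intro tendsto_ennrealI) simp
  qed
  have "(\<integral>\<^sup>+ z. ennreal (?W z * (1 - (norm z)\<^sup>2) ^ (n - 1)) \<partial>disc_measure) = (\<integral>\<^sup>+ z. (SUP i. f i z) \<partial>disc_measure)"
    by (rule nn_integral_cong_AE) (use AE_disc_measure in \<open>eventually_elim, simp add: lim\<close>)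
  also have "\<dots> = (SUP i. integral\<^sup>N disc_measure (f i))"
  proof (rule nn_integral_monotone_convergence_SUP[OF inc])
    show "f i \<in> borel_measurable disc_measure" for i
      using borel_measurable_radial_integrand[OF \<mu> b w, of i] unfolding f_def by simp
  qed
  finally have eq: "(\<integral>\<^sup>+ z. ennreal (?W z * (1 - (norm z)\<^sup>2) ^ (n - 1)) \<partial>disc_measure) = (SUP i. integral\<^sup>N disc_measure (f i))" .
  have c: "ennreal (1 / (fact n * fact (n - 1))) * integral\<^sup>N disc_measure (f i) = ennreal (cutoff_dirichlet \<mu> n (cutoff i) a)" for i
    unfolding J cutoff_dirichlet_def using radial_integral_nonneg[OF \<mu> w]
    by (subst ennreal_mult[symmetric]) auto
  show "incseq (\<lambda>i. ennreal (cutoff_dirichlet \<mu> n (cutoff i) a))"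
    unfolding c[symmetric] using inc
    by (auto simp: incseq_def intro!: mult_left_mono nn_integral_mono) (auto simp: le_fun_def)
  show "dirichlet_integral \<mu> n (disc_series a) = (SUP i. ennreal (cutoff_dirichlet \<mu> n (cutoff i) a))"
    unfolding dirichlet_integral_disc_series[OF a] eq SUP_mult_left_ennreal c ..
qed

text \<open>The next two estimates express boundedness of division and multiplication by \<open>z\<close>, respectively. The
  constant 2 comes from \<open>q \<ge> 1 / 2\<close>.\<close>

lemma dirichlet_integral_le_shift:
  assumes a: "disc_summable a" and n: "1 \<le> n"
  shows "dirichlet_integral \<mu> n (disc_series a) \<le> 2 * dirichlet_integral \<mu> n (disc_series (coeff_shift a))"
  unfolding dirichlet_integral_SUP(2)[OF a]
proof (rule SUP_least)
  fix i
  have "cutoff_dirichlet \<mu> n (cutoff i) a \<le> 2 * (cutoff i * cutoff_dirichlet \<mu> n (cutoff i) a)"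
    using mult_right_mono[OF cutoff_bounds(1)[of i] cutoff_dirichlet_nonneg[OF cutoff_bounds(2,3)[of i], of n a]] by simp
  also have "\<dots> \<le> 2 * cutoff_dirichlet \<mu> n (cutoff i) (coeff_shift a)"
    using cutoff_dirichlet_le_shift[OF a cutoff_bounds(2,3) n] by simp
  finally have "ennreal (cutoff_dirichlet \<mu> n (cutoff i) a) \<le> 2 * ennreal (cutoff_dirichlet \<mu> n (cutoff i) (coeff_shift a))"
    by (metis ennreal_leI ennreal_mult' ennreal_numeral zero_le_numeral)
  also have "\<dots> \<le> 2 * dirichlet_integral \<mu> n (disc_series (coeff_shift a))"
    unfolding dirichlet_integral_SUP(2)[OF disc_summable_shift[OF a]] by (intro mult_left_mono SUP_upper) auto
  finally show "ennreal (cutoff_dirichlet \<mu> n (cutoff i) a) \<le> 2 * dirichlet_integral \<mu> n (disc_series (coeff_shift a))" .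
qed

lemma dirichlet_integral_shift_le:
  assumes a: "disc_summable a" "\<forall>k<n. a k = 0" and n: "1 \<le> n"
  shows "dirichlet_integral \<mu> n (disc_series (coeff_shift a)) \<le> ennreal (n + 1) * dirichlet_integral \<mu> n (disc_series a)"
  unfolding dirichlet_integral_SUP(2)[OF disc_summable_shift[OF a(1)]]
proof (rule SUP_least)
  fix i
  have "ennreal (cutoff_dirichlet \<mu> n (cutoff i) (coeff_shift a)) \<le> ennreal ((n + 1) * cutoff_dirichlet \<mu> n (cutoff i) a)"
    using ennreal_leI[OF cutoff_dirichlet_shift_le[OF a cutoff_bounds(2,3)[of i] n]] by (simp only: of_nat_add of_nat_1)
  also have "\<dots> = ennreal (n + 1) * ennreal (cutoff_dirichlet \<mu> n (cutoff i) a)"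
    by (rule ennreal_mult) (auto intro: cutoff_dirichlet_nonneg cutoff_bounds)
  also have "\<dots> \<le> ennreal (n + 1) * dirichlet_integral \<mu> n (disc_series a)"
    unfolding dirichlet_integral_SUP(2)[OF a(1)] by (intro mult_left_mono SUP_upper) auto
  finally show "ennreal (cutoff_dirichlet \<mu> n (cutoff i) (coeff_shift a)) \<le> ennreal (n + 1) * dirichlet_integral \<mu> n (disc_series a)" .
qed

text \<open>For a polynomial the cut-off integrals are given by finite sums that are continuous in \<open>q\<close>, so the limit is
  their value at \<open>q = 1\<close>.\<close>

lemma dirichlet_integral_finite:
  assumes a: "\<forall>j\<ge>K. a j = 0" and n: "1 \<le> n"
  shows "dirichlet_integral \<mu> n (disc_series a) = ennreal (Re (toeplitz_sum \<mu> (binom_kernel n 1) K a))"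
    and "0 \<le> Re (toeplitz_sum \<mu> (binom_kernel n 1) K a)"
proof -
  have s: "disc_summable a" by (rule disc_summable_finite[of K]) (use a in simp)
  have eq: "cutoff_dirichlet \<mu> n (cutoff i) a = Re (toeplitz_sum \<mu> (binom_kernel n (cutoff i)) K a) / cutoff i ^ (n - 1)" for i
    using cutoff_dirichlet_finite[OF a cutoff_bounds(2,3) n, of i] cutoff_bounds(2)[of i] by (simp add: field_simps)
  have lim: "(\<lambda>i. cutoff_dirichlet \<mu> n (cutoff i) a) \<longlonglongrightarrow> Re (toeplitz_sum \<mu> (binom_kernel n 1) K a) / 1 ^ (n - 1)"
    unfolding eq Re_toeplitz_sum binom_kernel_def by (intro tendsto_intros cutoff_tendsto) simp
  show "dirichlet_integral \<mu> n (disc_series a) = ennreal (Re (toeplitz_sum \<mu> (binom_kernel n 1) K a))"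
    unfolding dirichlet_integral_SUP(2)[OF s]
    by (rule LIMSEQ_unique[OF LIMSEQ_SUP[OF dirichlet_integral_SUP(1)[OF s]]])
      (use tendsto_ennrealI[OF lim] in simp)
  show "0 \<le> Re (toeplitz_sum \<mu> (binom_kernel n 1) K a)"
    using LIMSEQ_le_const[OF lim, of 0] cutoff_dirichlet_nonneg[OF cutoff_bounds(2,3)] by auto
qed

lemma dirichlet_integral_add_le:
  assumes a: "disc_summable a" and b: "disc_summable b"
  shows "dirichlet_integral \<mu> n (disc_series (a + b)) \<le>
    2 * dirichlet_integral \<mu> n (disc_series a) + 2 * dirichlet_integral \<mu> n (disc_series b)"
proof -
  define w where "w z = (1 - (norm z)\<^sup>2) ^ (n - 1)" for z :: complex
  let ?W = "\<lambda>a z. poisson_quad \<mu> z (disc_series ((coeff_deriv ^^ n) a) z)"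
  have m: "(\<lambda>z. ennreal (?W c z * w z)) \<in> borel_measurable disc_measure" if "disc_summable c" for c
  proof -
    note [measurable] = borel_measurable_poisson_series[OF \<mu> disc_summable_deriv_pow[OF that, of n]]
    show ?thesis unfolding w_def by measurable
  qed
  have "(\<integral>\<^sup>+ z. ennreal (?W (a + b) z * w z) \<partial>disc_measure) \<le>
      (\<integral>\<^sup>+ z. 2 * ennreal (?W a z * w z) + 2 * ennreal (?W b z * w z) \<partial>disc_measure)"
  proof (rule nn_integral_mono_AE)
    show "AE z in disc_measure. ennreal (?W (a + b) z * w z) \<le> 2 * ennreal (?W a z * w z) + 2 * ennreal (?W b z * w z)"
      using AE_disc_measure
    proof eventually_elim
      case (elim z)
      have w0: "0 \<le> w z" using elim by (auto simp: w_def power_le_one intro!: zero_le_power)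
      have "?W (a + b) z \<le> 2 * ?W a z + 2 * ?W b z"
        unfolding coeff_deriv_pow_add disc_series_add[OF disc_summable_deriv_pow[OF a] disc_summable_deriv_pow[OF b]] plus_fun_apply
        by (rule poisson_quad_add_le[OF \<mu> elim])
      then have "?W (a + b) z * w z \<le> (2 * ?W a z + 2 * ?W b z) * w z" using w0 by (rule mult_right_mono)
      then have "?W (a + b) z * w z \<le> 2 * (?W a z * w z) + 2 * (?W b z * w z)" by (simp add: algebra_simps)
      then have "ennreal (?W (a + b) z * w z) \<le> ennreal (2 * (?W a z * w z) + 2 * (?W b z * w z))" by (rule ennreal_leI)
      then show ?case
        using w0 poisson_quad_nonneg[OF \<mu> elim] by (simp add: ennreal_plus ennreal_mult')
    qed
  qed
  also have "\<dots> = 2 * (\<integral>\<^sup>+ z. ennreal (?W a z * w z) \<partial>disc_measure) + 2 * (\<integral>\<^sup>+ z. ennreal (?W b z * w z) \<partial>disc_measure)"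
    using m[OF a] m[OF b] by (simp add: nn_integral_add nn_integral_cmult)
  finally show ?thesis
    unfolding dirichlet_integral_disc_series[OF disc_summable_add[OF a b]] dirichlet_integral_disc_series[OF a]
      dirichlet_integral_disc_series[OF b] w_def[symmetric]
    by (rule order_trans[OF mult_left_mono]) (auto simp: distrib_left mult_ac)
qed

lemma dirichlet_integral_scaleC:
  assumes a: "disc_summable a"
  shows "dirichlet_integral \<mu> n (disc_series (c *\<^sub>C a)) = ennreal ((norm c)\<^sup>2) * dirichlet_integral \<mu> n (disc_series a)"
proof -
  define w where "w z = (1 - (norm z)\<^sup>2) ^ (n - 1)" for z :: complex
  let ?W = "\<lambda>a z. poisson_quad \<mu> z (disc_series ((coeff_deriv ^^ n) a) z)"
  note [measurable] = borel_measurable_poisson_series[OF \<mu> disc_summable_deriv_pow[OF a, of n]]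
  have "(\<integral>\<^sup>+ z. ennreal (?W (c *\<^sub>C a) z * w z) \<partial>disc_measure) = (\<integral>\<^sup>+ z. ennreal ((norm c)\<^sup>2) * ennreal (?W a z * w z) \<partial>disc_measure)"
  proof (rule nn_integral_cong_AE)
    show "AE z in disc_measure. ennreal (?W (c *\<^sub>C a) z * w z) = ennreal ((norm c)\<^sup>2) * ennreal (?W a z * w z)"
      using AE_disc_measure
    proof eventually_elim
      case (elim z)
      have "?W (c *\<^sub>C a) z = (norm c)\<^sup>2 * ?W a z"
        unfolding coeff_deriv_pow_scaleC disc_series_scaleC[OF disc_summable_deriv_pow[OF a]] scaleC_fun_def[of _ "disc_series _"]
        by (rule poisson_quad_scaleC[OF \<mu> elim])
      then show ?case by (simp add: ennreal_mult' mult.assoc)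
    qed
  qed
  also have "\<dots> = ennreal ((norm c)\<^sup>2) * (\<integral>\<^sup>+ z. ennreal (?W a z * w z) \<partial>disc_measure)"
    unfolding w_def by (rule nn_integral_cmult) measurable
  finally show ?thesis
    unfolding dirichlet_integral_disc_series[OF disc_summable_scaleC[OF a]] dirichlet_integral_disc_series[OF a] w_def[symmetric]
    by (simp add: mult_ac)
qed

text \<open>The first \<open>n\<close> coefficients are split off, since the estimate for the shift needs them to vanish; they form a
  polynomial, whose Dirichlet integral is finite.\<close>

lemma dirichlet_integral_shift_finite:
  assumes a: "disc_summable a" and n: "1 \<le> n" and fin: "dirichlet_integral \<mu> n (disc_series a) < \<infinity>"
  shows "dirichlet_integral \<mu> n (disc_series (coeff_shift a)) < \<infinity>"
proof -
  define p where "p = truncate n a"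
  define t where "t j = (if j < n then 0 else a j)" for j
  have p: "disc_summable p" unfolding p_def by (rule disc_summable_truncate)
  have at: "a = p + t" by (auto simp: fun_eq_iff p_def t_def truncate_def)
  have tp: "t = a + (-1) *\<^sub>C p"
    by (auto simp: fun_eq_iff p_def t_def truncate_def scaleC_fun_def scaleC_minus_one)
  have t: "disc_summable t" unfolding tp by (intro disc_summable_add a disc_summable_scaleC p)
  have Dp: "dirichlet_integral \<mu> n (disc_series p) < \<infinity>"
    by (subst dirichlet_integral_finite(1)[OF _ n, of n]) (auto simp: p_def truncate_def)
  have Dsp: "dirichlet_integral \<mu> n (disc_series (coeff_shift p)) < \<infinity>"
    by (subst dirichlet_integral_finite(1)[OF coeff_shift_finite n, of n p]) (auto simp: p_def truncate_def)
  have "dirichlet_integral \<mu> n (disc_series t) \<le>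
      2 * dirichlet_integral \<mu> n (disc_series a) + 2 * (ennreal ((norm (- 1 :: complex))\<^sup>2) * dirichlet_integral \<mu> n (disc_series p))"
    unfolding tp dirichlet_integral_scaleC[OF p, symmetric]
    by (rule dirichlet_integral_add_le[OF a disc_summable_scaleC[OF p]])
  also have "\<dots> < \<infinity>" using fin Dp by (auto simp: ennreal_mult_less_top)
  finally have Dt: "dirichlet_integral \<mu> n (disc_series t) < \<infinity>" .
  have "dirichlet_integral \<mu> n (disc_series (coeff_shift t)) \<le> ennreal (n + 1) * dirichlet_integral \<mu> n (disc_series t)"
    by (rule dirichlet_integral_shift_le[OF t _ n]) (simp add: t_def)
  also have "\<dots> < \<infinity>" using Dt by (simp add: ennreal_mult_less_top)
  finally have Dst: "dirichlet_integral \<mu> n (disc_series (coeff_shift t)) < \<infinity>" .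
  have "dirichlet_integral \<mu> n (disc_series (coeff_shift a)) \<le>
      2 * dirichlet_integral \<mu> n (disc_series (coeff_shift p)) + 2 * dirichlet_integral \<mu> n (disc_series (coeff_shift t))"
    unfolding at coeff_shift_add by (rule dirichlet_integral_add_le[OF disc_summable_shift[OF p] disc_summable_shift[OF t]])
  also have "\<dots> < \<infinity>" using Dsp Dst by (simp add: ennreal_mult_less_top)
  finally show ?thesis .
qed

end

section \<open>Moments determine a measure on the circle\<close>

inductive_set trig_poly :: "(complex \<Rightarrow> complex) set" where
  monomial: "(\<lambda>\<zeta>. c * (\<zeta> ^ k * cnj \<zeta> ^ l)) \<in> trig_poly"
| add: "p \<in> trig_poly \<Longrightarrow> p' \<in> trig_poly \<Longrightarrow> (\<lambda>\<zeta>. p \<zeta> + p' \<zeta>) \<in> trig_poly"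

lemma trig_poly_mult:
  assumes p: "p \<in> trig_poly" and p': "p' \<in> trig_poly" shows "(\<lambda>\<zeta>. p \<zeta> * p' \<zeta>) \<in> trig_poly"
  using p
proof induction
  case (monomial c k l)
  show ?case using p'
  proof induction
    case (monomial d i j)
    have "(\<lambda>\<zeta>. c * (\<zeta> ^ k * cnj \<zeta> ^ l) * (d * (\<zeta> ^ i * cnj \<zeta> ^ j))) =
        (\<lambda>\<zeta>. (c * d) * (\<zeta> ^ (k + i) * cnj \<zeta> ^ (l + j)))"
      by (simp add: fun_eq_iff power_add mult_ac)
    then show ?case by (simp only: trig_poly.monomial)
  next
    case (add p p')
    then show ?case by (simp only: distrib_left trig_poly.add)
  qed
next
  case (add p p')
  then show ?case by (simp only: distrib_right trig_poly.add)
qed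

lemma trig_poly_const: "(\<lambda>\<zeta>. c) \<in> trig_poly"
  using trig_poly.monomial[of c 0 0] by simp

lemma real_polynomial_function_trig_poly:
  assumes "real_polynomial_function p" shows "(\<lambda>\<zeta>. complex_of_real (p \<zeta>)) \<in> trig_poly"
  using assms
proof induction
  case (linear f)
  have f: "f \<zeta> = Re \<zeta> * f 1 + Im \<zeta> * f \<i>" for \<zeta>
  proof -
    have "f \<zeta> = f (Re \<zeta> *\<^sub>R 1 + Im \<zeta> *\<^sub>R \<i>)" by (rule arg_cong[where f = f]) (simp add: complex_eq_iff)
    also have "\<dots> = Re \<zeta> * f 1 + Im \<zeta> * f \<i>"
      using bounded_linear.linear[OF linear] by (simp add: linear_add linear_cmul)
    finally show ?thesis .
  qed
  have "(\<lambda>\<zeta>. complex_of_real (f \<zeta>)) =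
      (\<lambda>\<zeta>. (f 1 - \<i> * f \<i>) / 2 * (\<zeta> ^ 1 * cnj \<zeta> ^ 0) + (f 1 + \<i> * f \<i>) / 2 * (\<zeta> ^ 0 * cnj \<zeta> ^ 1))"
    by (rule ext, subst f) (simp add: complex_eq_iff field_simps)
  then show ?case by (simp only: trig_poly.add trig_poly.monomial)
next
  case (const c)
  show ?case by (rule trig_poly_const)
next
  case (add f g)
  then show ?case by (simp only: of_real_add trig_poly.add)
next
  case (mult f g)
  then show ?case by (simp only: of_real_mult trig_poly_mult)
qed

text \<open>The negative moments are conjugates of the positive ones, so the integrals of trigonometric polynomials agree,
  hence those of continuous functions by Stone-Weierstrass, and those of indicator functions of closed sets as limits
  of continuous functions. Closed sets generate the Borel sets.\<close>

lemma circle_measure_eqI: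
  assumes M: "finite_measure M" "sets M = sets circle_borel"
    and N: "finite_measure N" "sets N = sets circle_borel"
    and moments: "\<And>k. (LINT \<zeta>|M. \<zeta> ^ k) = (LINT \<zeta>|N. \<zeta> ^ k)"
  shows "M = N"
proof -
  interpret M: finite_measure M by fact
  interpret N: finite_measure N by fact
  have sp: "space M = circle" "space N = circle"
    using sets_eq_imp_space_eq[OF M(2)] sets_eq_imp_space_eq[OF N(2)] by (auto simp: space_circle_borel)
  note [measurable] = measurable_ident_circle[OF M(2)] measurable_ident_circle[OF N(2)]
  have mono: "(LINT \<zeta>|M. \<zeta> ^ k * cnj \<zeta> ^ l) = (LINT \<zeta>|N. \<zeta> ^ k * cnj \<zeta> ^ l)" for k l
    unfolding circle_integral_monomial[OF sp(1)] circle_integral_monomial[OF sp(2)] moments ..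
  have trig: "integrable M p \<and> integrable N p \<and> integral\<^sup>L M p = integral\<^sup>L N p" if "p \<in> trig_poly" for p
    using that
  proof induction
    case (monomial c k l)
    have "integrable M (\<lambda>\<zeta>. \<zeta> ^ k * cnj \<zeta> ^ l)"
      by (rule M.integrable_const_bound[where B = 1]) (auto simp: sp norm_mult norm_power)
    moreover have "integrable N (\<lambda>\<zeta>. \<zeta> ^ k * cnj \<zeta> ^ l)"
      by (rule N.integrable_const_bound[where B = 1]) (auto simp: sp norm_mult norm_power)
    ultimately show ?case by (simp add: mono)
  qed auto
  have poly: "integrable M p \<and> integrable N p \<and> integral\<^sup>L M p = integral\<^sup>L N p"
    if "real_polynomial_function p" for p
  proof -
    have c: "integrable K (\<lambda>\<zeta>. complex_of_real (p \<zeta>)) \<longleftrightarrow> integrable K p" for K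
      by (rule complex_of_real_integrable_eq)
    show ?thesis
      using trig[OF real_polynomial_function_trig_poly[OF that]] by (simp add: c)
  qed
  have meas: "f \<in> borel_measurable M" "f \<in> borel_measurable N" if "continuous_on circle f" for f :: "complex \<Rightarrow> real"
    using borel_measurable_continuous_on_restrict[OF that]
    by (simp_all add: measurable_cong_sets[OF M(2) refl] measurable_cong_sets[OF N(2) refl])
  have cont: "integral\<^sup>L M f = integral\<^sup>L N f" if f: "continuous_on circle f" for f :: "complex \<Rightarrow> real"
  proof (rule ccontr)
    assume ne: "integral\<^sup>L M f \<noteq> integral\<^sup>L N f"
    define d where "d = \<bar>integral\<^sup>L M f - integral\<^sup>L N f\<bar>"
    define c where "c = measure M circle + measure N circle + 1"
    have c: "c > 0" by (simp add: c_def add_nonneg_pos)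
    have d: "d > 0" using ne by (simp add: d_def)
    obtain p where p: "real_polynomial_function p" "\<And>x. x \<in> circle \<Longrightarrow> \<bar>f x - p x\<bar> < d / (2 * c)"
      using Stone_Weierstrass_real_polynomial_function[OF compact_sphere f, of "d / (2 * c)"] c d by (auto simp: mult.commute)
    obtain B where B: "\<forall>x\<in>circle. \<bar>f x\<bar> \<le> B"
      using compact_imp_bounded[OF compact_continuous_image[OF f compact_sphere]] by (auto simp: bounded_iff)
    have fi: "integrable M f" "integrable N f"
      by (rule M.integrable_const_bound[where B = B] N.integrable_const_bound[where B = B];
          use B meas[OF f] sp in auto)+
    have close: "\<bar>integral\<^sup>L K f - integral\<^sup>L K p\<bar> \<le> d / (2 * c) * measure K circle"
      if K: "finite_measure K" "space K = circle" "integrable K f" "integrable K p" for K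
    proof -
      interpret K: finite_measure K by fact
      have "\<bar>integral\<^sup>L K f - integral\<^sup>L K p\<bar> \<le> (LINT x|K. \<bar>f x - p x\<bar>)"
        using integral_abs_bound[of K "\<lambda>x. f x - p x"] K by simp
      also have "\<dots> \<le> (LINT x|K. d / (2 * c))"
        by (rule integral_mono) (use K p(2) in \<open>auto intro: less_imp_le\<close>)
      finally show ?thesis using K by (simp add: mult.commute)
    qed
    have "d \<le> d / (2 * c) * measure M circle + d / (2 * c) * measure N circle"
      using close[of M] close[of N] poly[OF p(1)] fi sp M(1) N(1) unfolding d_def by auto
    also have "\<dots> = d * ((measure M circle + measure N circle) / (2 * c))"
      by (simp add: add_divide_distrib distrib_left mult.commute)
    also have "\<dots> < d * 1"
      using d c by (intro mult_strict_left_mono) (auto simp: c_def field_simps add_nonneg_pos)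
    finally show False by simp
  qed
  have closed: "measure M (C \<inter> circle) = measure N (C \<inter> circle)" if C: "closed C" for C
  proof (cases "C = {}")
    case False
    define f where "f n x = max 0 (1 - real n * infdist x C)" for n :: nat and x :: complex
    have fc: "continuous_on S (f n)" for S n unfolding f_def by (intro continuous_intros)
    have f01: "0 \<le> f n x" "f n x \<le> 1" for n x
      by (auto simp: f_def infdist_nonneg)
    have lim: "(\<lambda>n. f n x) \<longlonglongrightarrow> indicator C x" for x
    proof (cases "x \<in> C")
      case False
      then have i: "infdist x C > 0" using C \<open>C \<noteq> {}\<close> by (simp add: infdist_pos_not_in_closed)
      obtain n0 where n0: "1 < real n0 * infdist x C" using reals_Archimedean3[OF i] by blast
      have "f n x = 0" if "n \<ge> n0" for n
      proof -
        have "real n0 * infdist x C \<le> real n * infdist x C" using that i by (intro mult_right_mono) auto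
        then show ?thesis using n0 by (simp add: f_def)
      qed
      then show ?thesis using False
        by (intro tendsto_eventually eventually_sequentiallyI[of n0]) simp
    qed (simp add: f_def)
    have conv: "(\<lambda>n. integral\<^sup>L K (f n)) \<longlonglongrightarrow> measure K (C \<inter> circle)"
      if K: "finite_measure K" "sets K = sets circle_borel" "space K = circle" for K
    proof -
      interpret K: finite_measure K by fact
      have CK: "C \<inter> circle \<in> sets K" using C K by (auto simp: sets_restrict_space)
      have "(\<lambda>n. integral\<^sup>L K (f n)) \<longlonglongrightarrow> (LINT x|K. indicator (C \<inter> circle) x)"
      proof (rule integral_dominated_convergence[where w = "\<lambda>_. 1"])
        show "f n \<in> borel_measurable K" for n
          using borel_measurable_continuous_on_restrict[OF fc[of circle n]]
          by (simp add: measurable_cong_sets[OF K(2) refl])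
        show "(\<lambda>x. indicator (C \<inter> circle) x :: real) \<in> borel_measurable K" using CK by simp
        show "AE x in K. (\<lambda>n. f n x) \<longlonglongrightarrow> indicator (C \<inter> circle) x"
          using lim by (intro AE_I2) (auto simp: K indicator_def split: if_splits)
      qed (use f01 in auto)
      then show ?thesis using CK K by simp
    qed
    show ?thesis
      using LIMSEQ_unique[OF conv[OF M sp(1)]] conv[OF N sp(2)] cont[OF fc] by simp
  qed simp
  have ext: "distr M borel (\<lambda>x. x) = distr N borel (\<lambda>x. x)"
  proof (rule measure_eqI_generator_eq[where E = "Collect closed" and \<Omega> = UNIV and A = "\<lambda>_. UNIV"])
    show "Int_stable (Collect closed)" by (auto simp: Int_stable_def)
    show "sets (distr M borel (\<lambda>x. x)) = sigma_sets UNIV (Collect closed)"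
      "sets (distr N borel (\<lambda>x. x)) = sigma_sets UNIV (Collect closed)"
      by (simp_all add: borel_eq_closed)
    show "emeasure (distr M borel (\<lambda>x. x)) X = emeasure (distr N borel (\<lambda>x. x)) X" if "X \<in> Collect closed" for X
      using closed[of X] that sp
      by (simp add: emeasure_distr M.emeasure_eq_measure N.emeasure_eq_measure vimage_def)
    show "emeasure (distr M borel (\<lambda>x. x)) UNIV \<noteq> \<infinity>"
      by (simp add: emeasure_distr M.emeasure_eq_measure)
  qed auto
  show ?thesis
  proof (rule measure_eqI)
    fix A assume A: "A \<in> sets M"
    then have "A \<in> sets borel" "A \<subseteq> circle"
      using M(2) by (auto simp: sets_restrict_space)
    then have "emeasure (distr M borel (\<lambda>x. x)) A = emeasure M A" "emeasure (distr N borel (\<lambda>x. x)) A = emeasure N A"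
      using sp by (simp_all add: emeasure_distr Int_absorb2)
    then show "emeasure M A = emeasure N A" using ext by simp
  qed (simp add: M N)
qed

section \<open>The Hilbert space of a tuple of semi-spectral measures\<close>

definition single :: "nat \<Rightarrow> 'a::zero \<Rightarrow> nat \<Rightarrow> 'a" where
  "single k x j = (if j = k then x else 0)"

abbreviation monomial :: "nat \<Rightarrow> 'a::chilbert_space \<Rightarrow> complex \<Rightarrow> 'a" where
  "monomial k x \<equiv> disc_series (single k x)"

lemma single_finite: "\<forall>j\<ge>Suc k. single k x j = 0"
  by (simp add: single_def)

lemma square_summable_single: "square_summable (single k x)"
  by (rule square_summable_finite[of "Suc k"]) (simp add: single_def)

lemma disc_summable_single: "disc_summable (single k x)"
  by (rule square_summable_disc[OF square_summable_single])

lemma single_add: "single k (x + y) = single k x + single k (y :: 'a::chilbert_space)"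
  by (auto simp: single_def fun_eq_iff)

lemma single_scaleC: "single k (c *\<^sub>C x) = c *\<^sub>C single k (x :: 'a::chilbert_space)"
  by (auto simp: single_def fun_eq_iff scaleC_fun_def)

lemma monomial_add: "monomial k (x + y) = monomial k x + monomial k y"
  by (simp add: single_add disc_series_add disc_summable_single)

lemma monomial_scaleC: "monomial k (c *\<^sub>C x) = c *\<^sub>C monomial k x"
  by (simp add: single_scaleC disc_series_scaleC disc_summable_single)

lemma coeff_shift_single: "coeff_shift (single k x) = single (Suc k) x"
  by (auto simp: coeff_shift_def single_def fun_eq_iff split: nat.split)

lemma M_z_monomial: "M_z (monomial k x) = monomial (Suc k) x"
  by (simp add: disc_series_shift disc_summable_single coeff_shift_single)

lemma H_spaceE:
  assumes "f \<in> H_space m \<mu>" obtains a where "f = disc_series a" "square_summable a"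
  using assms by (auto simp: H_space_def hardy_space_eq)

lemma H_space_iff:
  assumes "square_summable a"
  shows "disc_series a \<in> H_space m \<mu> \<longleftrightarrow> (\<forall>r\<in>{1..m-1}. dirichlet_integral (\<mu> r) r (disc_series a) < \<infinity>)"
  using assms disc_series_holomorphic[OF square_summable_disc[OF assms]]
  by (auto simp: H_space_def dirichlet_space_def hardy_space_eq)

context
  fixes m :: nat and \<mu> :: "nat \<Rightarrow> complex set \<Rightarrow> 'a::chilbert_space \<Rightarrow> 'a"
  assumes \<mu>: "\<forall>r\<in>{1..m-1}. semi_spectral_measure (\<mu> r)"
begin

lemma H_space_add:
  assumes "f \<in> H_space m \<mu>" "g \<in> H_space m \<mu>" shows "f + g \<in> H_space m \<mu>"
proof -
  obtain a b where ab: "f = disc_series a" "square_summable a" "g = disc_series b" "square_summable b"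
    using assms by (metis H_spaceE)
  note s = square_summable_disc[OF ab(2)] square_summable_disc[OF ab(4)]
  have "dirichlet_integral (\<mu> r) r (disc_series (a + b)) < \<infinity>" if r: "r \<in> {1..m-1}" for r
  proof -
    have "dirichlet_integral (\<mu> r) r (disc_series (a + b)) \<le>
        2 * dirichlet_integral (\<mu> r) r (disc_series a) + 2 * dirichlet_integral (\<mu> r) r (disc_series b)"
      by (rule dirichlet_integral_add_le[OF \<mu>[rule_format, OF r] s])
    also have "\<dots> < \<infinity>"
      using assms r unfolding ab(1,3) H_space_iff[OF ab(2)] H_space_iff[OF ab(4)]
      by (auto simp: ennreal_mult_less_top)
    finally show ?thesis .
  qed
  then show ?thesis
    unfolding ab(1,3) disc_series_add[OF s, symmetric] H_space_iff[OF square_summable_add[OF ab(2,4)]] by blast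
qed

lemma H_space_scaleC:
  assumes "f \<in> H_space m \<mu>" shows "c *\<^sub>C f \<in> H_space m \<mu>"
proof -
  obtain a where a: "f = disc_series a" "square_summable a" using assms by (metis H_spaceE)
  note s = square_summable_disc[OF a(2)]
  show ?thesis
    using assms
    unfolding a(1) disc_series_scaleC[OF s, symmetric] H_space_iff[OF square_summable_scaleC[OF a(2)]] H_space_iff[OF a(2)]
    by (auto simp: dirichlet_integral_scaleC[OF \<mu>[rule_format] s] ennreal_mult_less_top)
qed

lemma monomial_in_H_space: "monomial k x \<in> H_space m \<mu>"
  unfolding H_space_iff[OF square_summable_single]
  by (auto simp: dirichlet_integral_finite(1)[OF \<mu>[rule_format] single_finite])

lemma M_z_in_H_space:
  assumes "f \<in> H_space m \<mu>" shows "M_z f \<in> H_space m \<mu>"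
proof -
  obtain a where a: "f = disc_series a" "square_summable a" using assms by (metis H_spaceE)
  note s = square_summable_disc[OF a(2)]
  have a': "square_summable (coeff_shift a)" using a(2) by (simp add: square_summable_shift)
  have "dirichlet_integral (\<mu> r) r (disc_series (coeff_shift a)) < \<infinity>" if r: "r \<in> {1..m-1}" for r
  proof (rule dirichlet_integral_shift_finite[OF \<mu>[rule_format, OF r] s])
    show "1 \<le> r" using r by simp
    show "dirichlet_integral (\<mu> r) r (disc_series a) < \<infinity>"
      using assms r unfolding a(1) H_space_iff[OF a(2)] by blast
  qed
  then show ?thesis unfolding a(1) disc_series_shift[OF s] H_space_iff[OF a'] by blast
qed

text \<open>If \<open>f\<close> has coefficients \<open>a\<close>, then \<open>h\<close> has the coefficients \<open>a (Suc j)\<close>. Its Dirichlet integrals are finite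
  because those of \<open>M_z h = f - f 0\<close> are.\<close>

lemma H_space_decompose:
  assumes "f \<in> H_space m \<mu>"
  obtains x h where "h \<in> H_space m \<mu>" "f = monomial 0 x + M_z h"
proof -
  obtain a where a: "f = disc_series a" "square_summable a" using assms by (metis H_spaceE)
  define b where "b j = a (Suc j)" for j
  have a_eq: "a = single 0 (a 0) + coeff_shift b"
    by (auto simp: fun_eq_iff single_def coeff_shift_def b_def split: nat.split)
  have b: "square_summable b"
    using a(2) unfolding square_summable_def b_def by (subst summable_Suc_iff)
  note sb = square_summable_disc[OF b]
  have f: "f = monomial 0 (a 0) + M_z (disc_series b)"
    unfolding a(1) disc_series_shift[OF sb] disc_series_add[OF disc_summable_single disc_summable_shift[OF sb], symmetric]
    by (rule arg_cong[OF a_eq])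
  have "M_z (disc_series b) = f + (-1) *\<^sub>C monomial 0 (a 0)"
    unfolding f by (simp add: fun_eq_iff scaleC_fun_def scaleC_minus_one)
  then have "disc_series (coeff_shift b) \<in> H_space m \<mu>"
    using H_space_add[OF assms H_space_scaleC[OF monomial_in_H_space]] disc_series_shift[OF sb] by metis
  then have fin: "dirichlet_integral (\<mu> r) r (disc_series (coeff_shift b)) < \<infinity>" if "r \<in> {1..m-1}" for r
    using that b by (simp only: H_space_iff square_summable_shift)
  have "dirichlet_integral (\<mu> r) r (disc_series b) < \<infinity>" if r: "r \<in> {1..m-1}" for r
  proof -
    have "dirichlet_integral (\<mu> r) r (disc_series b) \<le> 2 * dirichlet_integral (\<mu> r) r (disc_series (coeff_shift b))"
      by (rule dirichlet_integral_le_shift[OF \<mu>[rule_format, OF r] sb]) (use r in simp)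
    also have "\<dots> < \<infinity>" using fin[OF r] by (simp add: ennreal_mult_less_top)
    finally show ?thesis .
  qed
  then have "disc_series b \<in> H_space m \<mu>" unfolding H_space_iff[OF b] by blast
  with f that show thesis by blast
qed

text \<open>Derivatives annihilate constants, so constants are orthogonal to \<open>z\<close> times the space.\<close>

lemma H_norm_sq_constant_add:
  assumes h: "h \<in> H_space m \<mu>"
  shows "H_norm_sq m \<mu> (c *\<^sub>C M_z h + monomial 0 x) = (norm c)\<^sup>2 * H_norm_sq m \<mu> (M_z h) + (norm x)\<^sup>2"
proof -
  obtain a where a: "M_z h = disc_series a" "square_summable a" "a 0 = 0"
  proof -
    obtain b where b: "h = disc_series b" "square_summable b" using h by (metis H_spaceE)
    show thesis
      by (rule that[of "coeff_shift b"])
        (use b in \<open>simp_all add: disc_series_shift square_summable_disc square_summable_shift coeff_shift_def\<close>)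
  qed
  note sa = square_summable_disc[OF a(2)]
  note sca = disc_summable_scaleC[OF sa, of c]
  let ?b = "c *\<^sub>C a + single 0 x"
  have b: "disc_summable ?b" by (rule disc_summable_add[OF sca disc_summable_single])
  have eq: "c *\<^sub>C M_z h + monomial 0 x = disc_series ?b"
    unfolding a(1) disc_series_scaleC[OF sa, symmetric] disc_series_add[OF sca disc_summable_single] ..
  have D: "dirichlet_integral (\<mu> r) r (disc_series ?b) = ennreal ((norm c)\<^sup>2) * dirichlet_integral (\<mu> r) r (disc_series a)"
    if r: "r \<in> {1..m-1}" for r
  proof -
    have "(coeff_deriv ^^ r) ?b = (coeff_deriv ^^ r) (c *\<^sub>C a)"
      using r by (auto simp: fun_eq_iff coeff_deriv_pow single_def)
    then have "dirichlet_integral (\<mu> r) r (disc_series ?b) = dirichlet_integral (\<mu> r) r (disc_series (c *\<^sub>C a))"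
      by (simp only: dirichlet_integral_disc_series[OF \<mu>[rule_format, OF r] b] dirichlet_integral_disc_series[OF \<mu>[rule_format, OF r] sca])
    then show ?thesis by (simp only: dirichlet_integral_scaleC[OF \<mu>[rule_format, OF r] sa])
  qed
  have "(\<lambda>j. (norm c)\<^sup>2 * (norm (a j))\<^sup>2 + (if j = 0 then (norm x)\<^sup>2 else 0)) sums
      ((norm c)\<^sup>2 * (\<Sum>j. (norm (a j))\<^sup>2) + (norm x)\<^sup>2)"
    using a(2) unfolding square_summable_def
    by (intro sums_add sums_mult summable_sums sums_single[of 0 "\<lambda>_. (norm x)\<^sup>2"])
  moreover have "(norm c)\<^sup>2 * (norm (a j))\<^sup>2 + (if j = 0 then (norm x)\<^sup>2 else 0) = (norm (?b j))\<^sup>2" for j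
    by (simp add: scaleC_fun_def single_def norm_scaleC power_mult_distrib a(3))
  ultimately have hardy: "hardy_norm_sq (disc_series ?b) = (norm c)\<^sup>2 * hardy_norm_sq (disc_series a) + (norm x)\<^sup>2"
    unfolding hardy_norm_sq_disc_series[OF b] hardy_norm_sq_disc_series[OF sa]
    by (simp add: sums_unique[symmetric])
  have dirichlet: "(\<Sum>r=1..m-1. enn2real (dirichlet_integral (\<mu> r) r (disc_series ?b))) =
      (norm c)\<^sup>2 * (\<Sum>r=1..m-1. enn2real (dirichlet_integral (\<mu> r) r (disc_series a)))"
    unfolding sum_distrib_left by (rule sum.cong[OF refl]) (simp add: D enn2real_mult)
  show ?thesis
    unfolding eq unfolding a(1) H_norm_sq_def hardy dirichlet by (simp add: distrib_left)
qed

lemma H_norm_sq_eq_0: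
  assumes f: "f \<in> H_space m \<mu>" and 0: "H_norm_sq m \<mu> f = 0" shows "f = 0"
proof -
  obtain a where a: "f = disc_series a" "square_summable a" using f by (metis H_spaceE)
  have "0 \<le> (\<Sum>r=1..m-1. enn2real (dirichlet_integral (\<mu> r) r f))" by (intro sum_nonneg) simp
  moreover have s: "summable (\<lambda>j. (norm (a j))\<^sup>2)" using a(2) by (simp add: square_summable_def)
  moreover have "0 \<le> (\<Sum>j. (norm (a j))\<^sup>2)" by (rule suminf_nonneg[OF s]) simp
  ultimately have "(\<Sum>j. (norm (a j))\<^sup>2) = 0"
    using 0 by (simp add: H_norm_sq_def a(1) hardy_norm_sq_disc_series[OF square_summable_disc[OF a(2)]])
  then have "a j = 0" for j using suminf_eq_zero_iff[OF s] by simp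
  then show ?thesis by (simp add: a(1) disc_series_def fun_eq_iff)
qed

lemma H_inner_constant:
  assumes h: "h \<in> H_space m \<mu>" shows "H_inner m \<mu> (M_z h) (monomial 0 x) = 0"
proof -
  have "H_norm_sq m \<mu> (M_z h + \<i> ^ k *\<^sub>C monomial 0 x) = H_norm_sq m \<mu> (M_z h) + (norm x)\<^sup>2" for k
    using H_norm_sq_constant_add[OF h, of 1 "\<i> ^ k *\<^sub>C x"]
    by (simp add: monomial_scaleC norm_scaleC norm_power) (simp add: scaleC_fun_def)
  then show ?thesis
    unfolding H_inner_def polarization_def by (simp add: eval_nat_numeral algebra_simps)
qed

text \<open>This is \<open>\<langle>u, f 0 + u\<rangle> = \<langle>u, u\<rangle>\<close> for \<open>u = M_z h\<close>: a function that is orthogonal to \<open>u\<close> and has \<open>u\<close> as its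
  nonconstant part is therefore constant.\<close>

lemma H_inner_shift_self:
  assumes h: "h \<in> H_space m \<mu>"
  shows "H_inner m \<mu> (M_z h) (monomial 0 x + M_z h) = of_real (H_norm_sq m \<mu> (M_z h))"
proof -
  have "M_z h + \<i> ^ k *\<^sub>C (monomial 0 x + M_z h) = (1 + \<i> ^ k) *\<^sub>C M_z h + monomial 0 (\<i> ^ k *\<^sub>C x)" for k
    by (simp add: monomial_scaleC fun_eq_iff scaleC_fun_def scaleC_add_right scaleC_add_left)
  then have "H_norm_sq m \<mu> (M_z h + \<i> ^ k *\<^sub>C (monomial 0 x + M_z h)) =
      (norm (1 + \<i> ^ k))\<^sup>2 * H_norm_sq m \<mu> (M_z h) + (norm x)\<^sup>2" for k
    by (simp add: H_norm_sq_constant_add[OF h] norm_scaleC norm_power)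
  then show ?thesis
    unfolding H_inner_def polarization_def by (simp add: eval_nat_numeral cmod_def algebra_simps)
qed

text \<open>The Gram matrix of monomials. On finitely supported sequences the squared norm is the diagonal of a
  sesquilinear form, made Hermitian by averaging, so polarization recovers that form.\<close>

definition coeff_form :: "nat \<Rightarrow> (nat \<Rightarrow> 'a) \<Rightarrow> (nat \<Rightarrow> 'a) \<Rightarrow> complex" where
  "coeff_form K a b = (\<Sum>k<K. cinner (a k) (b k)) +
    (\<Sum>r=1..m-1. \<Sum>k<K. \<Sum>l<K. of_real (binom_kernel r 1 k l) * circle_moment (\<mu> r) k l (a k) (b l))"

lemma sesquilinear_coeff_form: "sesquilinear (coeff_form K)"
proof -
  note s = sesquilinearD[OF sesquilinear_circle_moment[OF \<mu>[rule_format]]]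
  show ?thesis
    unfolding sesquilinear_def coeff_form_def
    by (simp add: s cinner_add_left cinner_add_right cinner_scaleC_left cinner_scaleC_right scaleC_fun_def
        sum.distrib sum_distrib_left algebra_simps)
qed

lemma H_norm_sq_finite:
  assumes a: "\<forall>j\<ge>K. a j = 0"
  shows "H_norm_sq m \<mu> (disc_series a) = Re (coeff_form K a a)"
proof -
  have s: "disc_summable a" by (rule disc_summable_finite[of K]) (use a in simp)
  have "(\<Sum>j. (norm (a j))\<^sup>2) = (\<Sum>j<K. (norm (a j))\<^sup>2)"
    by (rule suminf_finite) (use a in \<open>auto simp: not_less\<close>)
  then have h: "hardy_norm_sq (disc_series a) = Re (\<Sum>k<K. cinner (a k) (a k))"
    by (simp add: hardy_norm_sq_disc_series[OF s] cinner_self)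
  have "enn2real (dirichlet_integral (\<mu> r) r (disc_series a)) = Re (toeplitz_sum (\<mu> r) (binom_kernel r 1) K a)"
    if r: "r \<in> {1..m-1}" for r
    using dirichlet_integral_finite[OF \<mu>[rule_format, OF r] a, of r] r by simp
  then show ?thesis
    unfolding H_norm_sq_def h coeff_form_def toeplitz_sum_def by simp
qed

lemma H_inner_monomial:
  "H_inner m \<mu> (monomial k x) (monomial l x) = (if k = l then of_real ((norm x)\<^sup>2) else 0) +
    (\<Sum>r=1..m-1. of_real (min k l choose r) * circle_moment (\<mu> r) k l x x)"
proof -
  define K where "K = Suc (max k l)"
  have kl: "k < K" "l < K" by (auto simp: K_def)
  define B where "B a b = (coeff_form K a b + cnj (coeff_form K b a)) / 2" for a b
  note s = sesquilinearD[OF sesquilinear_coeff_form]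
  have B: "sesquilinear B"
    unfolding sesquilinear_def B_def by (simp add: s field_simps)
  have q: "complex_of_real (H_norm_sq m \<mu> (monomial k x + \<i> ^ j *\<^sub>C monomial l x)) =
      B (single k x + \<i> ^ j *\<^sub>C single l x) (single k x + \<i> ^ j *\<^sub>C single l x)" for j
  proof -
    let ?a = "single k x + \<i> ^ j *\<^sub>C single l x"
    have "monomial k x + \<i> ^ j *\<^sub>C monomial l x = disc_series ?a"
      by (simp only: disc_series_add[OF disc_summable_single disc_summable_scaleC[OF disc_summable_single]]
          disc_series_scaleC[OF disc_summable_single])
    moreover have "\<forall>i\<ge>K. ?a i = 0" using kl by (auto simp: single_def scaleC_fun_def)
    moreover have "B ?a ?a = of_real (Re (coeff_form K ?a ?a))"
      unfolding B_def complex_add_cnj by simp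
    ultimately show ?thesis by (simp only: H_norm_sq_finite)
  qed
  have pick: "(\<Sum>i<K. F i (single p x i)) = F p x" if "p < K" "\<And>i. F i 0 = 0" for F :: "nat \<Rightarrow> 'a \<Rightarrow> complex" and p
    using that by (simp add: single_def if_distrib[of "F _"] sum.delta cong: if_cong)
  have val: "coeff_form K (single p x) (single p' x) = (if p = p' then of_real ((norm x)\<^sup>2) else 0) +
      (\<Sum>r=1..m-1. of_real (min p p' choose r) * circle_moment (\<mu> r) p p' x x)" if p: "p < K" "p' < K" for p p'
  proof -
    have "(\<Sum>i<K. cinner (single p x i) (single p' x i)) = cinner x (single p' x p)"
      by (rule pick[OF p(1), of "\<lambda>i v. cinner v (single p' x i)"]) simp
    moreover have "(\<Sum>i<K. \<Sum>j<K. of_real (binom_kernel r 1 i j) * circle_moment (\<mu> r) i j (single p x i) (single p' x j)) =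
        of_real (min p p' choose r) * circle_moment (\<mu> r) p p' x x" if r: "r \<in> {1..m-1}" for r
    proof -
      have "(\<Sum>j<K. of_real (binom_kernel r 1 i j) * circle_moment (\<mu> r) i j v (single p' x j)) =
          of_real (binom_kernel r 1 i p') * circle_moment (\<mu> r) i p' v x" for i v
        by (rule pick[OF p(2), of "\<lambda>j v'. of_real (binom_kernel r 1 i j) * circle_moment (\<mu> r) i j v v'"])
          (simp add: circle_moment_zero[OF \<mu>[rule_format, OF r]])
      then have "(\<Sum>i<K. \<Sum>j<K. of_real (binom_kernel r 1 i j) * circle_moment (\<mu> r) i j (single p x i) (single p' x j)) =
          (\<Sum>i<K. of_real (binom_kernel r 1 i p') * circle_moment (\<mu> r) i p' (single p x i) x)" by simp
      also have "\<dots> = of_real (binom_kernel r 1 p p') * circle_moment (\<mu> r) p p' x x"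
        by (rule pick[OF p(1), of "\<lambda>i v. of_real (binom_kernel r 1 i p') * circle_moment (\<mu> r) i p' v x"])
          (simp add: circle_moment_zero[OF \<mu>[rule_format, OF r]])
      finally show ?thesis by (simp add: binom_kernel_def)
    qed
    ultimately show ?thesis
      unfolding coeff_form_def by (simp add: single_def cinner_self)
  qed
  have herm: "cnj (circle_moment (\<mu> r) l k x x) = circle_moment (\<mu> r) k l x x" if r: "r \<in> {1..m-1}" for r
    unfolding circle_moment_diag[OF \<mu>[rule_format, OF r]]
    by (simp only: Bochner_Integration.integral_cnj[symmetric] complex_cnj_mult complex_cnj_power complex_cnj_cnj mult.commute)
  have "H_inner m \<mu> (monomial k x) (monomial l x) = B (single k x) (single l x)"
    unfolding H_inner_def polarization_def q by (rule sesquilinear_polarization[OF B])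
  also have "\<dots> = (if k = l then of_real ((norm x)\<^sup>2) else 0) +
    (\<Sum>r=1..m-1. of_real (min k l choose r) * circle_moment (\<mu> r) k l x x)"
  proof -
    have "cnj (\<Sum>r=1..m-1. of_real (min l k choose r) * circle_moment (\<mu> r) l k x x) =
        (\<Sum>r=1..m-1. of_real (min k l choose r) * circle_moment (\<mu> r) k l x x)"
      unfolding cnj_sum by (rule sum.cong[OF refl]) (simp only: complex_cnj_mult complex_cnj_complex_of_real herm min.commute)
    then show ?thesis unfolding B_def val[OF kl] val[OF kl(2,1)] complex_cnj_add by simp
  qed
  finally show ?thesis .
qed

end


section \<open>Unitary equivalence\<close>

lemma cadjoint_unitary:
  fixes V :: "'a::chilbert_space \<Rightarrow> 'b::chilbert_space"
  assumes V: "unitary_operator V"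
  shows "cinner (cadjoint V w) y = cinner w (V y)"
proof -
  have surj: "range V = UNIV" and iso: "cinner (V x) (V y) = cinner x y" for x y
    using V by (auto simp: unitary_on_def)
  have "cadjoint V = inv V"
    unfolding cadjoint_def
  proof (rule the_equality)
    show adj: "\<forall>x y. cinner (V x) y = cinner x (inv V y)"
      using iso f_inv_into_f[of _ V UNIV] surj by (metis UNIV_I)
    fix W assume W: "\<forall>x y. cinner (V x) y = cinner x (W y)"
    show "W = inv V"
    proof
      fix y show "W y = inv V y"
        by (rule cinner_eqI) (metis W adj cinner_commute)
    qed
  qed
  then show ?thesis using iso f_inv_into_f[of w V UNIV] surj by (metis UNIV_I)
qed

lemma unitary_operator_norm: "unitary_operator V \<Longrightarrow> norm (V x) = norm x"
proof -
  assume "unitary_operator V"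
  then have "complex_of_real ((norm (V x))\<^sup>2) = of_real ((norm x)\<^sup>2)"
    unfolding cinner_self[symmetric] by (auto simp: unitary_on_def)
  then show ?thesis by (simp only: of_real_eq_iff power2_eq_iff_nonneg norm_ge_zero)
qed

text \<open>The unitary equivalence is composition with \<open>V\<close>, which commutes with differentiation and carries the
  measures \<open>\<langle>\<mu>(\<cdot>)x, x\<rangle>\<close> to \<open>\<langle>\<nu>(\<cdot>)V x, V x\<rangle>\<close>.\<close>

lemma unitarily_equivalent_if:
  fixes \<mu> :: "nat \<Rightarrow> complex set \<Rightarrow> 'e::chilbert_space \<Rightarrow> 'e"
    and \<nu> :: "nat \<Rightarrow> complex set \<Rightarrow> 'f::chilbert_space \<Rightarrow> 'f"
  assumes \<mu>: "\<forall>r\<in>{1..m-1}. semi_spectral_measure (\<mu> r)"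
    and \<nu>: "\<forall>r\<in>{1..m-1}. semi_spectral_measure (\<nu> r)"
    and V: "unitary_operator V"
    and eq: "\<forall>r\<in>{1..m-1}. \<forall>\<Delta>\<in>sets circle_borel. \<mu> r \<Delta> = cadjoint V \<circ> \<nu> r \<Delta> \<circ> V"
  shows "unitarily_equivalent (H_space m \<mu>) (H_inner m \<mu>) M_z (H_space m \<nu>) (H_inner m \<nu>) M_z"
proof -
  have bc: "bounded_clinear V" using V by simp
  have add: "V (x + y) = V x + V y" and scale: "V (c *\<^sub>C x) = c *\<^sub>C V x" for x y c
    using V by (auto simp: unitary_on_def)
  have nV: "norm (V x) = norm x" for x by (rule unitary_operator_norm[OF V])
  have quad: "quad_measure (\<mu> r) x = quad_measure (\<nu> r) (V x)" if r: "r \<in> {1..m-1}" for r x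
  proof (rule measure_eqI)
    fix A assume "A \<in> sets (quad_measure (\<mu> r) x)"
    then have A: "A \<in> sets circle_borel" by simp
    have "cinner (\<mu> r A x) x = cinner (\<nu> r A (V x)) (V x)"
      using eq r A by (simp add: cadjoint_unitary[OF V])
    then show "emeasure (quad_measure (\<mu> r) x) A = emeasure (quad_measure (\<nu> r) (V x)) A"
      by (simp only: emeasure_quad_measure[OF \<mu>[rule_format, OF r] A] emeasure_quad_measure[OF \<nu>[rule_format, OF r] A])
  qed simp
  have dir: "dirichlet_integral (\<nu> r) r (V \<circ> disc_series a) = dirichlet_integral (\<mu> r) r (disc_series a)"
    if r: "r \<in> {1..m-1}" and a: "disc_summable a" for r a
  proof -
    note Va = disc_series_clinear[OF a bc]
    have "(coeff_deriv ^^ r) (V \<circ> a) = V \<circ> (coeff_deriv ^^ r) a"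
      by (simp add: fun_eq_iff coeff_deriv_pow scale)
    then have "disc_series ((coeff_deriv ^^ r) (V \<circ> a)) z = V (disc_series ((coeff_deriv ^^ r) a) z)" for z
      using disc_series_clinear(2)[OF disc_summable_deriv_pow[OF a, of r] bc] by simp
    then have "poisson_quad (\<nu> r) z (disc_series ((coeff_deriv ^^ r) (V \<circ> a)) z) =
        poisson_quad (\<mu> r) z (disc_series ((coeff_deriv ^^ r) a) z)" for z
      by (simp only: poisson_quad_def quad[OF r])
    then show ?thesis
      unfolding Va(2)[symmetric] dirichlet_integral_disc_series[OF \<nu>[rule_format, OF r] Va(1)] dirichlet_integral_disc_series[OF \<mu>[rule_format, OF r] a]
      by simp
  qed
  have sq: "square_summable (V \<circ> a) \<longleftrightarrow> square_summable a" for a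
    by (simp add: square_summable_def nV)
  have norm_eq: "H_norm_sq m \<nu> (V \<circ> f) = H_norm_sq m \<mu> f" if f: "f \<in> hardy_space" for f
  proof -
    obtain a where a: "f = disc_series a" "disc_summable a"
      using f by (auto simp: hardy_space_eq square_summable_disc)
    have "hardy_norm_sq (V \<circ> f) = hardy_norm_sq f"
      unfolding a(1) disc_series_clinear(2)[OF a(2) bc, symmetric]
        hardy_norm_sq_disc_series[OF disc_series_clinear(1)[OF a(2) bc]] hardy_norm_sq_disc_series[OF a(2)]
      by (simp add: nV)
    then show ?thesis
      unfolding H_norm_sq_def using dir[OF _ a(2)] by (simp add: a(1))
  qed
  have mem: "V \<circ> disc_series a \<in> H_space m \<nu> \<longleftrightarrow> disc_series a \<in> H_space m \<mu>" if a: "square_summable a" for a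
  proof -
    note s = square_summable_disc[OF a]
    have "V \<circ> disc_series a \<in> H_space m \<nu> \<longleftrightarrow> (\<forall>r\<in>{1..m-1}. dirichlet_integral (\<nu> r) r (V \<circ> disc_series a) < \<infinity>)"
      using H_space_iff[of "V \<circ> a" m \<nu>] a by (simp only: disc_series_clinear(2)[OF s bc] sq)
    also have "\<dots> \<longleftrightarrow> disc_series a \<in> H_space m \<mu>"
      unfolding H_space_iff[OF a] using dir[OF _ s] by simp
    finally show ?thesis .
  qed
  have hardy: "f \<in> hardy_space" if "f \<in> H_space m \<mu>" for f using that by (simp add: H_space_def)
  have comb: "f + c *\<^sub>C g \<in> hardy_space" if fg: "f \<in> H_space m \<mu>" "g \<in> H_space m \<mu>" for f g c
    using H_space_add[OF \<mu> fg(1) H_space_scaleC[OF \<mu> fg(2)]] by (simp add: hardy)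
  have image: "(\<lambda>f. V \<circ> f) ` H_space m \<mu> = H_space m \<nu>"
  proof (intro equalityI subsetI)
    fix g assume "g \<in> (\<lambda>f. V \<circ> f) ` H_space m \<mu>"
    then obtain f where f: "f \<in> H_space m \<mu>" "g = V \<circ> f" by blast
    obtain a where "f = disc_series a" "square_summable a" using f(1) by (metis H_spaceE)
    with f mem show "g \<in> H_space m \<nu>" by blast
  next
    fix g assume g: "g \<in> H_space m \<nu>"
    then obtain b where b: "g = disc_series b" "square_summable b" by (metis H_spaceE)
    have Vinv: "V \<circ> (inv V \<circ> b) = b"
      using V by (auto simp: fun_eq_iff unitary_on_def f_inv_into_f)
    have a: "square_summable (inv V \<circ> b)" using sq[of "inv V \<circ> b"] b(2) by (simp only: Vinv)
    have "V \<circ> disc_series (inv V \<circ> b) = g"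
      using disc_series_clinear(2)[OF square_summable_disc[OF a] bc] by (simp only: Vinv b(1))
    then show "g \<in> (\<lambda>f. V \<circ> f) ` H_space m \<mu>" using mem[OF a] g by (metis imageI)
  qed
  have inner: "H_inner m \<nu> (V \<circ> f) (V \<circ> g) = H_inner m \<mu> f g" if fg: "f \<in> H_space m \<mu>" "g \<in> H_space m \<mu>" for f g
  proof -
    have "(V \<circ> f) + c *\<^sub>C (V \<circ> g) = V \<circ> (f + c *\<^sub>C g)" for c
      by (simp add: fun_eq_iff scaleC_fun_def add scale)
    then show ?thesis unfolding H_inner_def polarization_def by (simp only: norm_eq[OF comb[OF fg]])
  qed
  show ?thesis
    unfolding unitarily_equivalent_def
  proof (intro exI conjI ballI)
    show "unitary_on (H_space m \<mu>) (H_inner m \<mu>) (H_space m \<nu>) (H_inner m \<nu>) (\<lambda>f. V \<circ> f)"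
      unfolding unitary_on_def
      using image inner by (auto simp: fun_eq_iff scaleC_fun_def add scale)
    show "V \<circ> M_z f = M_z (V \<circ> f)" for f by (simp add: fun_eq_iff M_z_def scale)
  qed
qed

text \<open>The converse. The constants are the orthogonal complement of \<open>z\<close> times the space, so a unitary
  intertwiner restricts to a unitary \<open>V\<close> between the spaces of constants and maps \<open>z ^ k * x\<close> to
  \<open>z ^ k * V x\<close>. Equality of the Gram matrices of monomials is a triangular system for the
  moments of the measures.\<close>

lemma unitarily_equivalent_only_if:
  fixes \<mu> :: "nat \<Rightarrow> complex set \<Rightarrow> 'e::chilbert_space \<Rightarrow> 'e"
    and \<nu> :: "nat \<Rightarrow> complex set \<Rightarrow> 'f::chilbert_space \<Rightarrow> 'f"
  assumes \<mu>: "\<forall>r\<in>{1..m-1}. semi_spectral_measure (\<mu> r)"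
    and \<nu>: "\<forall>r\<in>{1..m-1}. semi_spectral_measure (\<nu> r)"
    and ue: "unitarily_equivalent (H_space m \<mu>) (H_inner m \<mu>) M_z (H_space m \<nu>) (H_inner m \<nu>) M_z"
  shows "\<exists>V. unitary_operator V \<and>
    (\<forall>r\<in>{1..m-1}. \<forall>\<Delta>\<in>sets circle_borel. \<mu> r \<Delta> = cadjoint V \<circ> \<nu> r \<Delta> \<circ> V)"
proof -
  let ?A = "H_space m \<mu>" and ?B = "H_space m \<nu>"
  obtain U where U: "unitary_on ?A (H_inner m \<mu>) ?B (H_inner m \<nu>) U" "\<forall>f\<in>?A. U (M_z f) = M_z (U f)"
    using ue unfolding unitarily_equivalent_def by blast
  have Uadd: "U (f + g) = U f + U g" if "f \<in> ?A" "g \<in> ?A" for f g using U(1) that by (auto simp: unitary_on_def)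
  have Uscale: "U (c *\<^sub>C f) = c *\<^sub>C U f" if "f \<in> ?A" for c f using U(1) that by (auto simp: unitary_on_def)
  have Uim: "U ` ?A = ?B" using U(1) by (auto simp: unitary_on_def)
  have Uin: "H_inner m \<nu> (U f) (U g) = H_inner m \<mu> f g" if "f \<in> ?A" "g \<in> ?A" for f g
    using U(1) that by (auto simp: unitary_on_def)
  have UM: "U (M_z f) = M_z (U f)" if "f \<in> ?A" for f using U(2) that by blast
  have monA: "monomial k x \<in> ?A" for k x by (rule monomial_in_H_space[OF \<mu>])
  have const: "\<exists>y. U (monomial 0 x) = monomial 0 y" for x
  proof -
    have "U (monomial 0 x) \<in> ?B" using Uim monA by blast
    then obtain y h where h: "h \<in> ?B" "U (monomial 0 x) = monomial 0 y + M_z h"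
      using H_space_decompose[OF \<nu>] by metis
    obtain f where f: "f \<in> ?A" "h = U f" using Uim h(1) by blast
    have "of_real (H_norm_sq m \<nu> (M_z h)) = H_inner m \<nu> (U (M_z f)) (U (monomial 0 x))"
      unfolding h(2) UM[OF f(1)] f(2)[symmetric] by (rule H_inner_shift_self[OF \<nu> h(1), symmetric])
    also have "\<dots> = H_inner m \<mu> (M_z f) (monomial 0 x)" by (rule Uin[OF M_z_in_H_space[OF \<mu> f(1)] monA])
    also have "\<dots> = 0" by (rule H_inner_constant[OF \<mu> f(1)])
    finally have "M_z h = 0" by (intro H_norm_sq_eq_0[OF \<nu> M_z_in_H_space[OF \<nu> h(1)]]) simp
    then show ?thesis using h(2) by auto
  qed
  have const': "\<exists>x. U (monomial 0 x) = monomial 0 y" for y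
  proof -
    have "monomial 0 y \<in> U ` ?A" unfolding Uim by (rule monomial_in_H_space[OF \<nu>])
    then obtain g where g: "g \<in> ?A" "U g = monomial 0 y" by (metis imageE)
    obtain x h where h: "h \<in> ?A" "g = monomial 0 x + M_z h" using H_space_decompose[OF \<mu> g(1)] by metis
    have "U h \<in> ?B" using Uim h(1) by blast
    have "of_real (H_norm_sq m \<mu> (M_z h)) = H_inner m \<mu> (M_z h) g"
      unfolding h(2) by (rule H_inner_shift_self[OF \<mu> h(1), symmetric])
    also have "\<dots> = H_inner m \<nu> (M_z (U h)) (monomial 0 y)"
      unfolding UM[OF h(1), symmetric] g(2)[symmetric] by (rule Uin[OF M_z_in_H_space[OF \<mu> h(1)] g(1), symmetric])
    also have "\<dots> = 0" by (rule H_inner_constant[OF \<nu> \<open>U h \<in> ?B\<close>])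
    finally have "M_z h = 0" by (intro H_norm_sq_eq_0[OF \<mu> M_z_in_H_space[OF \<mu> h(1)]]) simp
    then show ?thesis using h(2) g(2) by auto
  qed
  define V where "V x = U (monomial 0 x) 0" for x
  have U0: "U (monomial 0 x) = monomial 0 (V x)" for x
    using const[of x] by (auto simp: V_def single_def)
  have Uk: "U (monomial k x) = monomial k (V x)" for k x
  proof (induction k)
    case (Suc k)
    show ?case unfolding M_z_monomial[symmetric] UM[OF monA] Suc ..
  qed (rule U0)
  have Vadd: "V (x + y) = V x + V y" for x y
    unfolding V_def monomial_add Uadd[OF monA monA] by simp
  have Vscale: "V (c *\<^sub>C x) = c *\<^sub>C V x" for x c
    unfolding V_def monomial_scaleC Uscale[OF monA] by (simp add: scaleC_fun_def)
  have gram: "H_inner m \<nu> (monomial k (V x)) (monomial l (V x)) = H_inner m \<mu> (monomial k x) (monomial l x)" for k l x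
    unfolding Uk[symmetric] by (rule Uin[OF monA monA])
  have Vnorm: "norm (V x) = norm x" for x
  proof -
    have "(\<Sum>r=1..m-1. of_nat (min 0 0 choose r) * F r) = 0" for F :: "nat \<Rightarrow> complex"
      by (rule sum.neutral) (auto simp: binomial_eq_0)
    then have "complex_of_real ((norm (V x))\<^sup>2) = of_real ((norm x)\<^sup>2)"
      using gram[of 0 x 0] unfolding H_inner_monomial[OF \<mu>] H_inner_monomial[OF \<nu>] of_real_of_nat_eq
      by (simp del: of_real_power)
    then show ?thesis by (simp only: of_real_eq_iff power2_eq_iff_nonneg norm_ge_zero)
  qed
  have bl: "bounded_linear V"
    by (rule bounded_linear_intro[of _ 1]) (simp_all add: Vadd Vscale scaleR_eq_scaleC Vnorm)
  have VB: "sesquilinear (\<lambda>x y. B (V x) (V y))" if "sesquilinear B" for B :: "'f \<Rightarrow> 'f \<Rightarrow> complex"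
    using that by (simp add: sesquilinear_def Vadd Vscale)
  have diag: "B x y = B' x y" if "sesquilinear B" "sesquilinear B'" "\<And>x. B x x = B' x x" for B B' :: "'e \<Rightarrow> 'e \<Rightarrow> complex" and x y
    using sesquilinear_polarization[OF that(2), of x y]
    unfolding that(3)[symmetric] by (rule trans[OF sesquilinear_polarization[OF that(1), of x y, symmetric]])
  have Vinner: "cinner (V x) (V y) = cinner x y" for x y
    by (rule diag[OF VB[OF sesquilinear_cinner] sesquilinear_cinner]) (simp add: cinner_self Vnorm)
  have surj: "range V = UNIV"
  proof -
    have "y \<in> range V" for y
    proof -
      obtain x where "U (monomial 0 x) = monomial 0 y" using const' by blast
      then have "V x = y" by (simp add: V_def single_def)
      then show ?thesis by blast
    qed
    then show ?thesis by blast
  qed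
  have V: "unitary_operator V"
    using bl by (auto simp: bounded_clinear_def unitary_on_def Vadd Vscale Vinner surj)
  have moment: "circle_moment (\<mu> r) d 0 x x = circle_moment (\<nu> r) d 0 (V x) (V x)" if "r \<in> {1..m-1}" for r d x
    using that
  proof (induction r arbitrary: d rule: less_induct)
    case (less r)
    \<comment> \<open>In the equation for \<open>k = d + r\<close>, \<open>l = r\<close>, orders above \<open>r\<close> have coefficient 0 and orders below \<open>r\<close>
      vanish by induction.\<close>
    define \<delta> where "\<delta> i k l = circle_moment (\<mu> i) k l x x - circle_moment (\<nu> i) k l (V x) (V x)" for i k l
    have shift: "\<delta> i (d + r) (0 + r) = \<delta> i d 0" if "i \<in> {1..m-1}" for i
      unfolding \<delta>_def circle_moment_shift[OF \<mu>[rule_format, OF that]] circle_moment_shift[OF \<nu>[rule_format, OF that]] ..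
    have "(\<Sum>i=1..m-1. of_real (r choose i) * \<delta> i (d + r) (0 + r)) = 0"
      using gram[of "d + r" x "0 + r"] unfolding H_inner_monomial[OF \<mu>] H_inner_monomial[OF \<nu>] Vnorm
      by (simp add: \<delta>_def right_diff_distrib sum_subtractf)
    also have "(\<Sum>i=1..m-1. of_real (r choose i) * \<delta> i (d + r) (0 + r)) = (\<Sum>i=1..m-1. if i = r then \<delta> r d 0 else 0)"
    proof (rule sum.cong[OF refl])
      fix i assume i: "i \<in> {1..m-1}"
      consider "i < r" | "i = r" | "r < i" by linarith
      then show "of_real (r choose i) * \<delta> i (d + r) (0 + r) = (if i = r then \<delta> r d 0 else 0)"
      proof cases
        case 1
        then have "\<delta> i d 0 = 0" using less.IH[OF 1 i, of d] by (simp add: \<delta>_def)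
        then show ?thesis using 1 shift[OF i] by simp
      next
        case 2
        then show ?thesis using shift[OF i] by simp
      next
        case 3
        then show ?thesis by (simp add: binomial_eq_0)
      qed
    qed
    also have "\<dots> = \<delta> r d 0" using less.prems by simp
    finally show ?case by (simp add: \<delta>_def)
  qed
  have quad: "quad_measure (\<mu> r) x = quad_measure (\<nu> r) (V x)" if r: "r \<in> {1..m-1}" for r x
  proof (rule circle_measure_eqI[OF finite_measure_quad_measure[OF \<mu>[rule_format, OF r]] sets_quad_measure
        finite_measure_quad_measure[OF \<nu>[rule_format, OF r]] sets_quad_measure])
    fix k show "(LINT \<zeta>|quad_measure (\<mu> r) x. \<zeta> ^ k) = (LINT \<zeta>|quad_measure (\<nu> r) (V x). \<zeta> ^ k)"
      using moment[OF r, of k x] by (simp add: circle_moment_diag[OF \<mu>[rule_format, OF r]] circle_moment_diag[OF \<nu>[rule_format, OF r]])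
  qed
  have "\<mu> r \<Delta> = cadjoint V \<circ> \<nu> r \<Delta> \<circ> V" if r: "r \<in> {1..m-1}" and \<Delta>: "\<Delta> \<in> sets circle_borel" for r \<Delta>
  proof
    fix x
    have "cinner (\<mu> r \<Delta> x) y = cinner (\<nu> r \<Delta> (V x)) (V y)" for y
    proof (rule diag[OF semi_spectral_measureD(2)[OF \<mu>[rule_format, OF r] \<Delta>] VB[OF semi_spectral_measureD(2)[OF \<nu>[rule_format, OF r] \<Delta>]]])
      fix x show "cinner (\<mu> r \<Delta> x) x = cinner (\<nu> r \<Delta> (V x)) (V x)"
        by (simp only: measure_quad_measure[OF \<mu>[rule_format, OF r] \<Delta>, symmetric] measure_quad_measure[OF \<nu>[rule_format, OF r] \<Delta>, symmetric] quad[OF r])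
    qed
    then show "\<mu> r \<Delta> x = (cadjoint V \<circ> \<nu> r \<Delta> \<circ> V) x"
      by (intro cinner_eqI) (simp add: cadjoint_unitary[OF V])
  qed
  with V show ?thesis by blast
qed

theorem proposition6p3:
  fixes m :: nat
    and \<mu> :: "nat \<Rightarrow> complex set \<Rightarrow> 'e::separable_chilbert_space \<Rightarrow> 'e"
    and \<nu> :: "nat \<Rightarrow> complex set \<Rightarrow> 'f::separable_chilbert_space \<Rightarrow> 'f"
  assumes "m \<ge> 2"
    and "\<And>r. r \<in> {1..m-1} \<Longrightarrow> semi_spectral_measure (\<mu> r)"
    and "\<And>r. r \<in> {1..m-1} \<Longrightarrow> semi_spectral_measure (\<nu> r)"
  shows "unitarily_equivalent
      (H_space m \<mu>) (H_inner m \<mu>) M_z (H_space m \<nu>) (H_inner m \<nu>) M_z \<longleftrightarrow>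
    (\<exists>V :: 'e \<Rightarrow> 'f. unitary_operator V \<and>
      (\<forall>r\<in>{1..m-1}. \<forall>\<Delta>\<in>sets circle_borel. \<mu> r \<Delta> = cadjoint V \<circ> \<nu> r \<Delta> \<circ> V))"
proof -
  have "\<forall>r\<in>{1..m-1}. semi_spectral_measure (\<mu> r)" "\<forall>r\<in>{1..m-1}. semi_spectral_measure (\<nu> r)"
    using assms by auto
  note unitarily_equivalent_if[OF this] unitarily_equivalent_only_if[OF this]
  then show ?thesis by blast
qed

end
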